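(* Let $X,Q\ge2$ and $Q\le q\le2Q$, and let $\mathcal{E}_q$ be a subset of $\{\chi:\chi\text{ is a primitive Dirichlet character modulo }q\}$. Let $0\le\beta<1$ and let $f:\mathbb{N}\to\mathbb{C}$ be a multiplicative function satisfying the following conditions. (C1) (Divisor bound) For any integer $n\ge1$, $f(n)\ll\tau_d(n)$ for some fixed constant $d\ge2$. (C2) (Average bound) For $X^{1-o(1)}\le Y\le X$, $\displaystyle\sum_{X\le n\le X+Y}|f(n)|^2\ll Y$. (C3) (Sieve bound) For any $2\le P_1\le P_2\le X$, $\displaystyle\sum_{n\le X,\ (n,\prod_{P_1\le p\le P_2}p)=1}|f(n)|^2\ll X\prod_{P_1\le p\le P_2}\Big(1-\frac1p\Big)$. (C4) (Cancellation over primes) For $\exp(\log^{\beta+\varepsilon}X)\le Y\le\exp\big(\frac{\log X}{\log\log X}\big)$ and $\frac{Y}{\log X}\le h\le Y$, $$\sup_{\chi\in\mathcal{E}_q}\Big|\sum_{Y\le p\le Y+h}f(p)\chi(p)\Big|\ll\frac{Y}{(\log Y)^{1+\gamma}}$$ for some $\gamma>0$. Then, for any $\eta<\min(\frac23\gamma,1-\beta)$, $$\sum_{\chi\in\mathcal{E}_q}\Big|\sum_{n\le X}f(n)\chi(n)\Big|^2\ll qX^{1+\varepsilon}+\frac{X^2}{\log^{\eta}X}.$$ Moreover, if (C4) holds for all $Q\le q\le2Q$ (with a given set $\mathcal{E}_q$ for each such $q$), then, for any $\eta<\min(\frac23\gamma,1-\beta)$, $$\sum_{Q\le q\le2Q}\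 \sum_{\chi\in\mathcal{E}_q}\Big|\sum_{n\le X}f(n)\chi(n)\Big|^2\ll Q^2X^{1+\varepsilon}+\frac{X^2}{\log^{\eta}X}.$$
   Context: $\tau_d$ is the $d$-fold divisor function, $p$ always denotes a prime, $\log^a x=(\log x)^a$. $\varepsilon$ denotes an arbitrarily small positive number, possibly different at each occurrence. Conditions (C2) and (C3) are conditions on $f$ alone and are understood to hold for all (large) $X$, with $X$ a dummy variable; $X^{1-o(1)}\le Y$ means $\log Y\ge(1-o(1))\log X$ as $X\to\infty$. All implied constants in the hypotheses are uniform in the variables $X,Y,h,P_1,P_2,q,\chi$; the implied constants in the conclusions depend only on these constants and on $d,\beta,\gamma,\eta,\varepsilon$, not on $X,Q,q$. *)

theory Defs
  imports Complex_Main "HOL-Computational_Algebra.Primes"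
begin

definition multiplicative_fun :: "(nat \<Rightarrow> complex) \<Rightarrow> bool" where
  "multiplicative_fun f \<longleftrightarrow> f 1 = 1 \<and>
     (\<forall>m n. m \<ge> 1 \<longrightarrow> n \<ge> 1 \<longrightarrow> coprime m n \<longrightarrow> f (m * n) = f m * f n)"

text \<open>The number of ordered factorizations of \<open>n\<close> into \<open>d\<close> factors; only used for \<open>n \<ge> 1\<close>,
  where the set below is finite.\<close>
definition divisor_tau :: "nat \<Rightarrow> nat \<Rightarrow> nat" where
  "divisor_tau d n = card {xs :: nat list. length xs = d \<and> prod_list xs = n}"

definition dirichlet_character :: "nat \<Rightarrow> (nat \<Rightarrow> complex) \<Rightarrow> bool" where
  "dirichlet_character q \<chi> \<longleftrightarrow> q \<ge> 1 \<and> \<chi> 1 = 1 \<and>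
     (\<forall>m n. \<chi> (m * n) = \<chi> m * \<chi> n) \<and>
     (\<forall>n. \<chi> (n + q) = \<chi> n) \<and>
     (\<forall>n. \<chi> n = 0 \<longleftrightarrow> \<not> coprime n q)"

text \<open>A character modulo \<open>q\<close> is primitive if it is not induced by a character modulo
  a proper divisor of \<open>q\<close>.\<close>
definition primitive_dirichlet_characters :: "nat \<Rightarrow> (nat \<Rightarrow> complex) set" where
  "primitive_dirichlet_characters q =
     {\<chi>. dirichlet_character q \<chi> \<and>
         \<not> (\<exists>r \<psi>. r dvd q \<and> r < q \<and> dirichlet_character r \<psi> \<and>
              (\<forall>n. coprime n q \<longrightarrow> \<chi> n = \<psi> n))}"

text \<open>In the conditions below the parameters \<open>K\<close> are the implied constants.\<close>

definition divisor_bound :: "nat \<Rightarrow> real \<Rightarrow> (nat \<Rightarrow> complex) \<Rightarrow> bool" where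
  "divisor_bound d K f \<longleftrightarrow> (\<forall>n\<ge>1. norm (f n) \<le> K * real (divisor_tau d n))"

text \<open>The range \<open>Y \<ge> X\<^bsup>1-o(1)\<^esup>\<close>, \<open>Y \<le> X\<close>: the bound holds for every choice \<open>\<delta>\<close> of the \<open>o(1)\<close> term.
  The constant \<open>K\<close> is uniform, but how large \<open>X\<close> has to be may depend on \<open>\<delta>\<close>
  and is given by \<open>X0 \<delta>\<close>.\<close>
definition average_bound ::
    "real \<Rightarrow> ((real \<Rightarrow> real) \<Rightarrow> real) \<Rightarrow> (nat \<Rightarrow> complex) \<Rightarrow> bool" where
  "average_bound K X0 f \<longleftrightarrow>
     (\<forall>\<delta>. (\<delta> \<longlongrightarrow> 0) at_top \<longrightarrow>
       (\<forall>X Y. X \<ge> 2 \<and> X \<ge> X0 \<delta> \<and> X powr (1 - \<delta> X) \<le> Y \<and> Y \<le> X \<longrightarrow>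
          (\<Sum>n | X \<le> real n \<and> real n \<le> X + Y. (norm (f n))\<^sup>2) \<le> K * Y))"

definition sieve_bound :: "real \<Rightarrow> real \<Rightarrow> (nat \<Rightarrow> complex) \<Rightarrow> bool" where
  "sieve_bound K X0 f \<longleftrightarrow>
     (\<forall>X P1 P2. X \<ge> X0 \<and> 2 \<le> P1 \<and> P1 \<le> P2 \<and> P2 \<le> X \<longrightarrow>
        (\<Sum>n | 1 \<le> n \<and> real n \<le> X \<and>
               coprime n (\<Prod>p | prime p \<and> P1 \<le> real p \<and> real p \<le> P2. p).
            (norm (f n))\<^sup>2)
        \<le> K * (X * (\<Prod>p | prime p \<and> P1 \<le> real p \<and> real p \<le> P2. 1 - 1 / real p)))"

text \<open>The small positive number \<open>\<epsilon>\<close> in the lower end of the range of \<open>Y\<close> is arbitrary, and the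
  implied constant \<open>K \<epsilon>\<close> may depend on it. The bound for each \<open>\<chi>\<close>, with a constant not depending
  on \<open>\<chi>\<close>, is the bound for the supremum over \<open>\<chi>\<close>; it is spelled out because a real supremum
  over the empty set has no specified value.\<close>
definition prime_cancellation ::
    "real \<Rightarrow> real \<Rightarrow> (real \<Rightarrow> real) \<Rightarrow> real \<Rightarrow> (nat \<Rightarrow> complex) set \<Rightarrow> (nat \<Rightarrow> complex) \<Rightarrow> bool" where
  "prime_cancellation \<beta> \<gamma> K X E f \<longleftrightarrow>
     (\<forall>\<epsilon>>0. \<forall>Y h. exp (ln X powr (\<beta> + \<epsilon>)) \<le> Y \<and> Y \<le> exp (ln X / ln (ln X)) \<and>
                   Y / ln X \<le> h \<and> h \<le> Y \<longrightarrow>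
        (\<forall>\<chi>\<in>E. norm (\<Sum>p | prime p \<and> Y \<le> real p \<and> real p \<le> Y + h. f p * \<chi> p)
                 \<le> K \<epsilon> * (Y / ln Y powr (1 + \<gamma>))))"

definition twisted_sum :: "(nat \<Rightarrow> complex) \<Rightarrow> (nat \<Rightarrow> complex) \<Rightarrow> real \<Rightarrow> complex" where
  "twisted_sum f \<chi> X = (\<Sum>n | 1 \<le> n \<and> real n \<le> X. f n * \<chi> n)"

end

theory Submission
  imports Defs "HOL-Analysis.Convex" "HOL-Real_Asymp.Real_Asymp" "HOL-Number_Theory.Number_Theory"
begin

text \<open>
  Put \<open>L = log X\<close> and let \<open>\<beta> < \<alpha> < 1\<close>. Call a prime eligible if it lies between
  \<open>exp (L\<^sup>\<alpha>)\<close> and \<open>exp (L / log L)\<close>. The \<open>n \<le> X\<close> without eligible prime factors are few by (C3), so by the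
  large sieve they contribute at most \<open>(D + X) X L\<^bsup>\<alpha> - 1 + o(1)\<^esup>\<close>, where \<open>D\<close> is \<open>q\<close> or \<open>Q\<^sup>2\<close>.
  For the others let \<open>(2\<^sup>j, 2\<^bsup>j + 1\<^esup>]\<close> be the dyadic block of the largest eligible prime factor.
  Apart from rare exceptions \<open>n = p m\<close>, where \<open>p\<close> is in the block and \<open>m\<close> has no prime
  factors from the block upwards, so that by (C3) these \<open>m\<close> have density about \<open>j log L / L\<close>.

  To separate the variables in \<open>p m \<le> X\<close>, cut the range of \<open>m\<close> into \<open>H\<close> equal intervals, \<open>H\<close>
  about \<open>L\<close>, and bound \<open>p\<close> in terms of the end point of the interval; the \<open>n\<close> lost are within
  \<open>2 X / H\<close> of \<open>X\<close> and are handled by (C2). After Cauchy-Schwarz over the intervals the sums over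
  \<open>p\<close> are bounded by (C4), whose right-hand side does not depend on \<open>h\<close>, and the sums over \<open>m\<close> by
  the large sieve for short intervals. As the intervals are disjoint, no power of \<open>H\<close> is lost in the
  term \<open>X\<^sup>2\<close>, and block \<open>j\<close> contributes \<open>X\<^sup>2 j\<^bsup>-1 - 2\<gamma>\<^esup> log L / L\<close>. Summing over \<open>j\<close> saves
  \<open>L\<^bsup>min (2\<gamma>) 1 - o(1)\<^esup>\<close>.
\<close>

section \<open>The additive large sieve\<close>

text \<open>The shape is dictated by (C4), which needs \<open>h >= Y / log X\<close>. Separating
  \<open>p\<close> from \<open>m\<close> with \<open>H\<close> intervals therefore allows only
  \<open>H <= log X\<close>, while the integers lost near \<open>X\<close> have proportion about
  \<open>1 / H\<close>, so \<open>H\<close> cannot be small either. A factor \<open>H\<close> in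
  front of \<open>X^2\<close> would destroy the saving. It does not appear: Cauchy-Schwarz over the
  intervals costs \<open>H\<close>, and the length term of the large sieve on an interval of length
  \<open>X / (2^j H)\<close> gives back \<open>1 / H\<close>. Only the term with \<open>D\<close>
  keeps a factor \<open>H 2^j\<close>. This is \<open>X^o(1)\<close> because the eligible primes
  stop at \<open>exp (L / log L)\<close>, and it is the source of \<open>X^\<epsilon>\<close>. At
  the lower end \<open>\<alpha> > \<beta>\<close> is what (C4) asks for, and \<open>\<alpha>\<close>
  close to \<open>\<beta>\<close> keeps the integers without eligible prime factors rare.

  Taking \<open>p\<close> from the topmost block makes the representation \<open>n = p m\<close>
  unique, so no weights that count prime factors occur, and it sifts \<open>m\<close> by all
  eligible primes from that block on.

  Both assertions are instances of one estimate for a finite family of completely multiplicative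
  functions that satisfies a large sieve inequality with parameter \<open>D\<close>.\<close>

lemma large_sieve_duality:
  fixes \<phi> :: "'t \<Rightarrow> 'n \<Rightarrow> complex"
  assumes "finite T" "finite A" "\<Delta> \<ge> 0"
    and dual: "\<And>b. (\<Sum>n\<in>A. (cmod (\<Sum>t\<in>T. b t * \<phi> t n))\<^sup>2) \<le> \<Delta> * (\<Sum>t\<in>T. (cmod (b t))\<^sup>2)"
  shows "(\<Sum>t\<in>T. (cmod (\<Sum>n\<in>A. a n * \<phi> t n))\<^sup>2) \<le> \<Delta> * (\<Sum>n\<in>A. (cmod (a n))\<^sup>2)"
proof -
  define S where "S t = (\<Sum>n\<in>A. a n * \<phi> t n)" for t
  define V where "V = (\<Sum>t\<in>T. (cmod (S t))\<^sup>2)"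
  define B where "B n = (\<Sum>t\<in>T. cnj (S t) * \<phi> t n)" for n
  define W where "W = (\<Sum>n\<in>A. (cmod (a n))\<^sup>2)"
  have V0: "V \<ge> 0" unfolding V_def by (intro sum_nonneg) auto
  have W0: "W \<ge> 0" unfolding W_def by (intro sum_nonneg) auto
  have "complex_of_real V = (\<Sum>t\<in>T. cnj (S t) * S t)"
    unfolding V_def of_real_sum by (simp only: complex_norm_square mult.commute)
  also have "\<dots> = (\<Sum>t\<in>T. \<Sum>n\<in>A. a n * (cnj (S t) * \<phi> t n))"
    by (subst (2) S_def) (simp add: sum_distrib_left mult_ac)
  also have "\<dots> = (\<Sum>n\<in>A. a n * B n)"
    by (subst sum.swap) (simp add: B_def sum_distrib_left)
  finally have "V = cmod (\<Sum>n\<in>A. a n * B n)"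
    using V0 by (metis abs_of_nonneg norm_of_real)
  also have "\<dots> \<le> (\<Sum>n\<in>A. cmod (a n) * cmod (B n))"
    by (metis (mono_tags, lifting) norm_mult norm_sum sum.cong)
  finally have "V\<^sup>2 \<le> (\<Sum>n\<in>A. cmod (a n) * cmod (B n))\<^sup>2"
    using V0 by (intro power_mono) auto
  also have "\<dots> \<le> W * (\<Sum>n\<in>A. (cmod (B n))\<^sup>2)"
    unfolding W_def by (rule Cauchy_Schwarz_ineq_sum)
  \<comment> \<open>The dual inequality is tested on the conjugates of the sums \<open>S t\<close>
    themselves, so that \<open>V\<close> returns on the right and one factor \<open>V\<close>
    cancels.\<close>
  also have "\<dots> \<le> W * (\<Delta> * V)"
    using dual[of "\<lambda>t. cnj (S t)"] W0 by (intro mult_left_mono) (simp_all add: B_def V_def)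
  finally have "V * V \<le> (\<Delta> * W) * V"
    by (simp add: power2_eq_square mult_ac)
  then have "V \<le> \<Delta> * W"
    using V0 W0 assms(3) by (cases "V = 0") auto
  then show ?thesis by (simp add: V_def W_def S_def)
qed

section \<open>Exponential sums at well-spaced points\<close>

definition unit_circle :: "real \<Rightarrow> complex" where
  "unit_circle x = cis (2 * pi * x)"

lemma unit_circle_add: "unit_circle (x + y) = unit_circle x * unit_circle y"
  by (simp add: unit_circle_def cis_mult algebra_simps)

lemma unit_circle_0 [simp]: "unit_circle 0 = 1"
  by (simp add: unit_circle_def)

lemma norm_unit_circle [simp]: "cmod (unit_circle x) = 1"
  by (simp add: unit_circle_def)

lemma cnj_unit_circle: "cnj (unit_circle x) = unit_circle (- x)"
  by (simp add: unit_circle_def cis_cnj)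

lemma unit_circle_int [simp]: "unit_circle (of_int k) = 1"
  by (simp add: unit_circle_def cis_multiple_2pi)

lemma unit_circle_power: "unit_circle x ^ n = unit_circle (real n * x)"
  by (induction n) (simp_all add: unit_circle_add algebra_simps)

lemma unit_circle_cong:
  assumes "x - y \<in> \<int>"
  shows "unit_circle x = unit_circle y"
proof -
  obtain k where "x - y = of_int k" using assms by (elim Ints_cases)
  then have "x = y + of_int k" by simp
  then show ?thesis by (simp add: unit_circle_add)
qed

text \<open>By concavity on \<open>[0, \<pi>]\<close> the sine lies above its chord from
  \<open>0\<close> to \<open>\<pi> / 2\<close>; the point \<open>\<pi> y\<close> divides this chord
  with weights \<open>1 - 2 y\<close> and \<open>2 y\<close>. Negative arguments follow by
  oddness.\<close>

lemma abs_sin_pi_ge: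
  fixes x :: real
  assumes "\<bar>x\<bar> \<le> 1/2"
  shows "2 * \<bar>x\<bar> \<le> \<bar>sin (pi * x)\<bar>"
proof -
  have *: "2 * y \<le> sin (pi * y)" if "0 \<le> y" "y \<le> 1/2" for y :: real
  proof -
    have cc: "concave_on {0..pi} sin"
    proof (rule f''_le0_imp_concave)
      show "convex {0..pi}" by simp
      fix x :: real assume "x \<in> {0..pi}"
      show "(sin has_real_derivative cos x) (at x)" "(cos has_real_derivative - sin x) (at x)"
        by (auto intro!: derivative_eq_intros)
      show "- sin x \<le> 0" using \<open>x \<in> {0..pi}\<close> by (simp add: sin_ge_zero)
    qed
    have "sin ((1 - 2*y) *\<^sub>R 0 + (2*y) *\<^sub>R (pi/2)) \<ge> (1 - 2*y) * sin 0 + (2*y) * sin (pi/2)"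
      using that by (intro concave_onD[OF cc]) auto
    then show ?thesis by (simp add: mult.commute)
  qed
  show ?thesis
  proof (cases "x \<ge> 0")
    case True
    then show ?thesis using *[of x] assms by simp
  next
    case False
    then show ?thesis using *[of "-x"] assms by simp
  qed
qed

text \<open>The numerator of the closed form of the geometric sum has modulus at most
  \<open>2\<close>, and the denominator has modulus \<open>2 |sin (\<pi> y)| >= 4 |y|\<close> with
  \<open>y = x - k\<close>.\<close>

lemma norm_geometric_unit_circle_le:
  assumes "0 < \<bar>x - of_int k\<bar>" "\<bar>x - of_int k\<bar> \<le> 1/2"
  shows "cmod (\<Sum>u<N. unit_circle (real u * x)) \<le> 1 / (2 * \<bar>x - of_int k\<bar>)"
proof -
  define y where "y = x - of_int k"
  have "unit_circle x = unit_circle y"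
    by (rule unit_circle_cong) (simp add: y_def)
  have s: "\<bar>sin (pi * y)\<bar> \<ge> 2 * \<bar>y\<bar>"
    using assms by (intro abs_sin_pi_ge) (simp add: y_def)
  have n1: "cmod (1 - unit_circle x) = 2 * \<bar>sin (pi * y)\<bar>"
  proof -
    have "(cmod (1 - unit_circle y))\<^sup>2 = (1 - cos (2*pi*y))\<^sup>2 + (sin (2*pi*y))\<^sup>2"
      by (simp add: unit_circle_def cmod_power2)
    also have "\<dots> = 2 - 2 * cos (2*(pi*y))"
      using sin_cos_squared_add[of "2*pi*y"] by (simp add: power2_eq_square algebra_simps)
    also have "\<dots> = (2 * \<bar>sin (pi * y)\<bar>)\<^sup>2"
      by (subst cos_double_sin) (simp add: power2_eq_square)
    finally have "cmod (1 - unit_circle y) = 2 * \<bar>sin (pi * y)\<bar>"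
      by (subst (asm) power2_eq_iff_nonneg) auto
    then show ?thesis using \<open>unit_circle x = unit_circle y\<close> by simp
  qed
  have ne: "unit_circle x \<noteq> 1" using n1 s assms by (auto simp: y_def)
  have "(\<Sum>u<N. unit_circle (real u * x)) = (\<Sum>u<N. unit_circle x ^ u)"
    by (simp add: unit_circle_power)
  also have "\<dots> = (1 - unit_circle x ^ N) / (1 - unit_circle x)"
    using ne by (simp add: sum_gp_strict)
  finally have "cmod (\<Sum>u<N. unit_circle (real u * x)) = cmod (1 - unit_circle x ^ N) / cmod (1 - unit_circle x)"
    by (simp add: norm_divide)
  also have "cmod (1 - unit_circle x ^ N) \<le> 2"
    using norm_triangle_ineq4[of 1 "unit_circle x ^ N"] by (simp add: norm_power)
  also have "2 / cmod (1 - unit_circle x) \<le> 2 / (2 * (2 * \<bar>y\<bar>))"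
    using n1 s assms by (intro divide_left_mono mult_pos_pos) (auto simp: y_def)
  finally show ?thesis by (simp add: y_def divide_right_mono)
qed

lemma sum_inverse_squares_le: "(\<Sum>k=1..n. 1 / (real k)\<^sup>2) \<le> 2"
proof (cases "n = 0")
  case False
  then have "n \<ge> 1" by simp
  then have "(\<Sum>k=1..n. 1 / (real k)\<^sup>2) \<le> 2 - 1 / real n"
  proof (induction n rule: nat_induct_at_least)
    case (Suc n)
    have "1 / (real (Suc n))\<^sup>2 \<le> 1 / real n - 1 / real (Suc n)"
      using Suc.hyps by (simp add: divide_simps power2_eq_square)
    then show ?case using Suc.IH by simp
  qed auto
  also have "\<dots> \<le> 2" by simp
  finally show ?thesis .
qed auto

lemma sum_inverse_squares_int_le:
  assumes "finite (S :: int set)" "0 \<notin> S"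
  shows "(\<Sum>k\<in>S. 1 / (real_of_int k)\<^sup>2) \<le> 4"
proof -
  define n where "n = nat (Max (abs ` insert 0 S))"
  have bnd: "\<bar>k\<bar> \<le> int n" if "k \<in> S" for k
    using assms that unfolding n_def by (simp add: Max_ge_iff)
  have "S \<subseteq> int ` {1..n} \<union> (\<lambda>k. - int k) ` {1..n}"
  proof
    fix k assume "k \<in> S"
    then have "k \<noteq> 0" "\<bar>k\<bar> \<le> int n" using assms bnd by auto
    then consider "k > 0" "nat k \<in> {1..n}" | "k < 0" "nat (-k) \<in> {1..n}" by force
    then show "k \<in> int ` {1..n} \<union> (\<lambda>k. - int k) ` {1..n}"
    proof cases
      case 1 then show ?thesis by (metis UnI1 image_eqI int_nat_eq order_less_le)
    next
      case 2 then show ?thesis by (intro UnI2 image_eqI[of _ _ "nat (-k)"]) auto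
    qed
  qed
  then have "(\<Sum>k\<in>S. 1 / (real_of_int k)\<^sup>2) \<le>
      (\<Sum>k\<in>int ` {1..n} \<union> (\<lambda>k. - int k) ` {1..n}. 1 / (real_of_int k)\<^sup>2)"
    by (intro sum_mono2) auto
  also have "\<dots> \<le> (\<Sum>k\<in>int ` {1..n}. 1 / (real_of_int k)\<^sup>2) + (\<Sum>k\<in>(\<lambda>k. - int k) ` {1..n}. 1 / (real_of_int k)\<^sup>2)"
    by (subst sum_Un) (auto intro!: sum_nonneg)
  also have "\<dots> = 2 * (\<Sum>k=1..n. 1 / (real k)\<^sup>2)"
    by (subst (1 2) sum.reindex) (auto simp: inj_on_def)
  also have "\<dots> \<le> 4" using sum_inverse_squares_le[of n] by simp
  finally show ?thesis .
qed

text \<open>Reduce \<open>\<alpha> r - \<alpha> s\<close> modulo 1 to \<open>\<beta> s\<close> in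
  \<open>[-1/2, 1/2]\<close> and cut the line into cells of length \<open>\<delta>\<close>. By the
  spacing no cell contains two of the \<open>\<beta> s\<close>, and none with
  \<open>s \<noteq> r\<close> lies in cell \<open>0\<close>. The term in cell \<open>j\<close> is at
  most \<open>1 / (2 |\<beta> s|)^2 <= 1 / (j \<delta>)^2\<close>, which is summed over nonzero
  integers \<open>j\<close>. The factor \<open>2\<close> in \<open>jle\<close> pays for the floor of
  a negative number.\<close>

lemma spaced_sum_le:
  fixes \<alpha> :: "'a \<Rightarrow> real"
  assumes "finite T" "\<delta> > 0" "r \<in> T"
    and sp: "\<And>s t k. s \<in> T \<Longrightarrow> t \<in> T \<Longrightarrow> s \<noteq> t \<Longrightarrow> \<bar>\<alpha> s - \<alpha> t - of_int k\<bar> \<ge> \<delta>"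
  shows "(\<Sum>s\<in>T. (cmod (\<Sum>u<N. unit_circle (real u * (\<alpha> r - \<alpha> s))))\<^sup>2) \<le> (real N)\<^sup>2 + 4 / \<delta>\<^sup>2"
proof -
  define k where "k s = round (\<alpha> r - \<alpha> s)" for s
  define \<beta> where "\<beta> s = \<alpha> r - \<alpha> s - of_int (k s)" for s
  define j where "j s = \<lfloor>\<beta> s / \<delta>\<rfloor>" for s
  define F where "F s = (cmod (\<Sum>u<N. unit_circle (real u * (\<alpha> r - \<alpha> s))))\<^sup>2" for s
  have half: "\<bar>\<beta> s\<bar> \<le> 1/2" for s
    using of_int_round_abs_le[of "\<alpha> r - \<alpha> s"] by (simp add: \<beta>_def k_def abs_minus_commute)
  have far: "\<bar>\<beta> s\<bar> \<ge> \<delta>" if "s \<in> T - {r}" for s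
    using sp[of r s "k s"] that assms by (auto simp: \<beta>_def)
  have j: "of_int (j s) * \<delta> \<le> \<beta> s" "\<beta> s < (of_int (j s) + 1) * \<delta>" for s
    using floor_divide_lower[OF \<open>\<delta> > 0\<close>] floor_divide_upper[OF \<open>\<delta> > 0\<close>] by (simp_all add: j_def)
  have jle: "\<bar>of_int (j s)\<bar> * \<delta> \<le> 2 * \<bar>\<beta> s\<bar>" and jne: "j s \<noteq> 0" if "s \<in> T - {r}" for s
  proof -
    show "j s \<noteq> 0"
      using far[OF that] j[of s] by auto
    show "\<bar>of_int (j s)\<bar> * \<delta> \<le> 2 * \<bar>\<beta> s\<bar>"
      using far[OF that] j[of s] \<open>\<delta> > 0\<close> by (cases "j s \<ge> 0") (auto simp: algebra_simps abs_if split: if_splits)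
  qed
  have inj: "inj_on j (T - {r})"
  proof (rule inj_onI, rule ccontr)
    fix s t assume st: "s \<in> T - {r}" "t \<in> T - {r}" "j s = j t" "s \<noteq> t"
    have "\<bar>\<beta> s - \<beta> t\<bar> < \<delta>"
      using j[of s] j[of t] st(3) by (auto simp: algebra_simps abs_if)
    moreover have "\<beta> s - \<beta> t = - (\<alpha> s - \<alpha> t - of_int (k t - k s))"
      by (simp add: \<beta>_def)
    ultimately show False
      using sp[of s t "k t - k s"] st by simp
  qed
  have F_le: "F s \<le> (1 / \<delta>\<^sup>2) * (1 / (of_int (j s))\<^sup>2)" if s: "s \<in> T - {r}" for s
  proof -
    have "cmod (\<Sum>u<N. unit_circle (real u * (\<alpha> r - \<alpha> s))) \<le> 1 / (2 * \<bar>\<beta> s\<bar>)"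
      unfolding \<beta>_def
      using far[OF s] half[of s] \<open>\<delta> > 0\<close>
      by (intro norm_geometric_unit_circle_le) (auto simp: \<beta>_def)
    also have "\<dots> \<le> 1 / (\<bar>of_int (j s)\<bar> * \<delta>)"
      using jle[OF s] jne[OF s] far[OF s] \<open>\<delta> > 0\<close> by (intro divide_left_mono mult_pos_pos) auto
    finally have "F s \<le> (1 / (\<bar>of_int (j s)\<bar> * \<delta>))\<^sup>2"
      unfolding F_def by (intro power_mono) auto
    then show ?thesis by (simp add: power_divide power_mult_distrib mult_ac)
  qed
  have "(\<Sum>s\<in>T. F s) = F r + (\<Sum>s\<in>T-{r}. F s)"
    using assms by (simp add: sum.remove)
  also have "F r \<le> (real N)\<^sup>2"
    unfolding F_def by simp
  also have "(\<Sum>s\<in>T-{r}. F s) \<le> (\<Sum>s\<in>T-{r}. (1 / \<delta>\<^sup>2) * (1 / (of_int (j s))\<^sup>2))"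
    by (intro sum_mono F_le)
  also have "\<dots> = (1 / \<delta>\<^sup>2) * (\<Sum>k\<in>j ` (T-{r}). 1 / (of_int k)\<^sup>2)"
    by (simp add: sum.reindex[OF inj] sum_distrib_left)
  also have "\<dots> \<le> (1 / \<delta>\<^sup>2) * 4"
  proof (intro mult_left_mono sum_inverse_squares_int_le)
    show "0 \<notin> j ` (T - {r})" by (metis imageE jne)
  qed (use assms in auto)
  finally show ?thesis by (simp add: F_def)
qed

lemma sum_swap_pairs:
  "(\<Sum>u\<in>U. \<Sum>v\<in>V. \<Sum>s\<in>S. \<Sum>t\<in>T. g u v s t) = (\<Sum>s\<in>S. \<Sum>t\<in>T. \<Sum>u\<in>U. \<Sum>v\<in>V. g u v s t)"
proof -
  have "(\<Sum>u\<in>U. \<Sum>v\<in>V. \<Sum>s\<in>S. \<Sum>t\<in>T. g u v s t) = (\<Sum>u\<in>U. \<Sum>s\<in>S. \<Sum>v\<in>V. \<Sum>t\<in>T. g u v s t)"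
    by (rule sum.cong[OF refl], rule sum.swap)
  also have "\<dots> = (\<Sum>s\<in>S. \<Sum>u\<in>U. \<Sum>v\<in>V. \<Sum>t\<in>T. g u v s t)"
    by (rule sum.swap)
  also have "\<dots> = (\<Sum>s\<in>S. \<Sum>u\<in>U. \<Sum>t\<in>T. \<Sum>v\<in>V. g u v s t)"
    by (rule sum.cong[OF refl], rule sum.cong[OF refl], rule sum.swap)
  also have "\<dots> = (\<Sum>s\<in>S. \<Sum>t\<in>T. \<Sum>u\<in>U. \<Sum>v\<in>V. g u v s t)"
    by (rule sum.cong[OF refl], rule sum.swap)
  finally show ?thesis .
qed

text \<open>The sum over \<open>u, v < 2 N\<close> is the Fejer-weighted mean of \<open>\<bar>B\<bar>\<^sup>2\<close>; each \<open>c + i\<close>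
  with \<open>i < N\<close> is hit by at least \<open>N\<close> of the pairs.\<close>

lemma spaced_dual_sum_le:
  fixes \<alpha> :: "'a \<Rightarrow> real"
  assumes "finite T" "\<delta> > 0" "N > 0"
    and sp: "\<And>s t k. s \<in> T \<Longrightarrow> t \<in> T \<Longrightarrow> s \<noteq> t \<Longrightarrow> \<bar>\<alpha> s - \<alpha> t - of_int k\<bar> \<ge> \<delta>"
  shows "(\<Sum>n\<in>{M..<M+N}. (cmod (\<Sum>t\<in>T. b t * unit_circle (real n * \<alpha> t)))\<^sup>2)
    \<le> (4 * real N + 4 / (\<delta>\<^sup>2 * real N)) * (\<Sum>t\<in>T. (cmod (b t))\<^sup>2)"
proof -
  define B where "B x = (\<Sum>t\<in>T. b t * unit_circle (x * \<alpha> t))" for x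
  define G where "G s t = (cmod (\<Sum>u<2*N. unit_circle (real u * (\<alpha> s - \<alpha> t))))\<^sup>2" for s t
  have B2: "complex_of_real ((cmod (B x))\<^sup>2) = (\<Sum>s\<in>T. \<Sum>t\<in>T. b s * cnj (b t) * unit_circle (x * (\<alpha> s - \<alpha> t)))" for x
    unfolding complex_norm_square B_def cnj_sum sum_product
    by (intro sum.cong refl) (simp add: cnj_unit_circle right_diff_distrib flip: unit_circle_add)
  have G_eq: "(\<Sum>u<2*N. \<Sum>v<2*N. unit_circle ((real M + real u - real v) * (\<alpha> s - \<alpha> t)))
      = unit_circle (real M * (\<alpha> s - \<alpha> t)) * complex_of_real (G s t)" for s t
  proof -
    have "unit_circle ((real M + real u - real v) * x)
        = unit_circle (real M * x) * (unit_circle (real u * x) * cnj (unit_circle (real v * x)))" for u v x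
      by (simp add: cnj_unit_circle algebra_simps flip: unit_circle_add)
    then show ?thesis
      unfolding G_def complex_norm_square cnj_sum sum_product by (simp add: sum_distrib_left)
  qed
  have inj: "inj_on (\<lambda>(i,v). (i + v, v)) ({..<N} \<times> {..<N})"
    by (auto simp: inj_on_def)
  have "real N * (\<Sum>n\<in>{M..<M+N}. (cmod (B (real n)))\<^sup>2) = (\<Sum>i<N. \<Sum>v<N. (cmod (B (real (M + i))))\<^sup>2)"
    by (subst sum.atLeastLessThan_shift_0) (simp add: sum_distrib_left atLeast0LessThan add.commute)
  also have "\<dots> = (\<Sum>(i,v)\<in>{..<N}\<times>{..<N}. (cmod (B (real M + real (i + v) - real v)))\<^sup>2)"
    by (simp flip: sum.cartesian_product)
  also have "\<dots> = (\<Sum>(u,v)\<in>(\<lambda>(i,v). (i + v, v)) ` ({..<N} \<times> {..<N}). (cmod (B (real M + real u - real v)))\<^sup>2)"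
    by (subst sum.reindex[OF inj]) (simp add: case_prod_unfold)
  also have "\<dots> \<le> (\<Sum>(u,v)\<in>{..<2*N}\<times>{..<2*N}. (cmod (B (real M + real u - real v)))\<^sup>2)"
    by (intro sum_mono2) auto
  also have "\<dots> = (\<Sum>u<2*N. \<Sum>v<2*N. (cmod (B (real M + real u - real v)))\<^sup>2)"
    by (simp add: sum.cartesian_product)
  finally have le: "real N * (\<Sum>n\<in>{M..<M+N}. (cmod (B (real n)))\<^sup>2) \<le> (\<Sum>u<2*N. \<Sum>v<2*N. (cmod (B (real M + real u - real v)))\<^sup>2)" (is "_ \<le> ?R") .
  have "complex_of_real ?R = (\<Sum>u<2*N. \<Sum>v<2*N. \<Sum>s\<in>T. \<Sum>t\<in>T. b s * cnj (b t) * unit_circle ((real M + real u - real v) * (\<alpha> s - \<alpha> t)))"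
    by (simp only: of_real_sum B2)
  also have "\<dots> = (\<Sum>s\<in>T. \<Sum>t\<in>T. \<Sum>u<2*N. \<Sum>v<2*N. b s * cnj (b t) * unit_circle ((real M + real u - real v) * (\<alpha> s - \<alpha> t)))"
    by (rule sum_swap_pairs)
  also have "\<dots> = (\<Sum>s\<in>T. \<Sum>t\<in>T. b s * cnj (b t) * (unit_circle (real M * (\<alpha> s - \<alpha> t)) * complex_of_real (G s t)))"
    by (simp add: G_eq flip: sum_distrib_left)
  finally have eqR: "complex_of_real ?R = (\<Sum>s\<in>T. \<Sum>t\<in>T. b s * cnj (b t) * (unit_circle (real M * (\<alpha> s - \<alpha> t)) * complex_of_real (G s t)))" .
  have G0: "G s t \<ge> 0" for s t by (simp add: G_def)
  have Gsym: "G s t = G t s" for s t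
  proof -
    have "(\<Sum>u<2*N. unit_circle (real u * (\<alpha> s - \<alpha> t))) = cnj (\<Sum>u<2*N. unit_circle (real u * (\<alpha> t - \<alpha> s)))"
      by (simp add: cnj_unit_circle algebra_simps)
    from arg_cong[OF this, of cmod] show ?thesis unfolding G_def complex_mod_cnj by (rule arg_cong)
  qed
  define C where "C = (real (2*N))\<^sup>2 + 4 / \<delta>\<^sup>2"
  have Gsum: "(\<Sum>t\<in>T. G s t) \<le> C" if "s \<in> T" for s
    unfolding G_def C_def by (rule spaced_sum_le[OF assms(1,2) that sp])
  have "?R \<le> cmod (complex_of_real ?R)"
    by (simp only: norm_of_real abs_ge_self)
  also have "\<dots> \<le> (\<Sum>s\<in>T. \<Sum>t\<in>T. cmod (b s) * cmod (b t) * G s t)"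
    unfolding eqR
    by (intro order_trans[OF norm_sum] sum_mono) (simp add: norm_mult G0 mult.assoc)
  \<comment> \<open>Schur test: \<open>G\<close> is symmetric with nonnegative entries and row sums
    at most \<open>C\<close>, so its quadratic form is at most \<open>C\<close> times the square of
    the norm of \<open>b\<close>.\<close>
  also have "\<dots> \<le> (\<Sum>s\<in>T. \<Sum>t\<in>T. ((cmod (b s))\<^sup>2 * G s t + (cmod (b t))\<^sup>2 * G t s) / 2)"
  proof (intro sum_mono)
    fix s t
    have "cmod (b s) * cmod (b t) \<le> ((cmod (b s))\<^sup>2 + (cmod (b t))\<^sup>2) / 2"
      using sum_squares_bound[of "cmod (b s)" "cmod (b t)"] by simp
    then have "cmod (b s) * cmod (b t) * G s t \<le> ((cmod (b s))\<^sup>2 + (cmod (b t))\<^sup>2) / 2 * G s t"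
      by (rule mult_right_mono) (rule G0)
    then show "cmod (b s) * cmod (b t) * G s t \<le> ((cmod (b s))\<^sup>2 * G s t + (cmod (b t))\<^sup>2 * G t s) / 2"
      by (simp add: Gsym[of t s] algebra_simps)
  qed
  also have "\<dots> = (\<Sum>s\<in>T. (cmod (b s))\<^sup>2 * (\<Sum>t\<in>T. G s t))"
  proof -
    have "(\<Sum>s\<in>T. \<Sum>t\<in>T. (cmod (b t))\<^sup>2 * G t s) = (\<Sum>s\<in>T. \<Sum>t\<in>T. (cmod (b s))\<^sup>2 * G s t)"
      by (rule sum.swap)
    then show ?thesis
      by (simp add: sum.distrib add_divide_distrib sum_distrib_left flip: sum_divide_distrib)
  qed
  also have "\<dots> \<le> (\<Sum>s\<in>T. (cmod (b s))\<^sup>2 * C)"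
    by (intro sum_mono mult_left_mono Gsum) auto
  finally have "real N * (\<Sum>n\<in>{M..<M+N}. (cmod (B (real n)))\<^sup>2) \<le> C * (\<Sum>s\<in>T. (cmod (b s))\<^sup>2)"
    using le by (simp add: sum_distrib_left mult.commute)
  then have "(\<Sum>n\<in>{M..<M+N}. (cmod (B (real n)))\<^sup>2) \<le> (C / real N) * (\<Sum>s\<in>T. (cmod (b s))\<^sup>2)"
    using assms by (simp add: field_simps)
  also have "C / real N = 4 * real N + 4 / (\<delta>\<^sup>2 * real N)"
    using assms by (simp add: C_def field_simps power2_eq_square)
  finally show ?thesis by (simp add: B_def)
qed

text \<open>The bound \<open>4 N + 4 D^2 / N\<close> for the dual sum is poor when \<open>N\<close>
  is much smaller than \<open>D\<close>. As the summands are nonnegative, the interval may be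
  lengthened by about \<open>D\<close> beforehand, which makes both terms of size
  \<open>N + D\<close>.\<close>

lemma additive_large_sieve:
  fixes \<alpha> :: "'a \<Rightarrow> real" and D :: real
  assumes "finite T" "D \<ge> 1"
    and sp: "\<And>s t k. s \<in> T \<Longrightarrow> t \<in> T \<Longrightarrow> s \<noteq> t \<Longrightarrow> \<bar>\<alpha> s - \<alpha> t - of_int k\<bar> \<ge> 1 / D"
  shows "(\<Sum>t\<in>T. (cmod (\<Sum>n\<in>{M..<M+N}. a n * unit_circle (real n * \<alpha> t)))\<^sup>2)
    \<le> 12 * (D + real N) * (\<Sum>n\<in>{M..<M+N}. (cmod (a n))\<^sup>2)"
proof (rule large_sieve_duality)
  fix b :: "'a \<Rightarrow> complex"
  define N' where "N' = N + nat \<lceil>D\<rceil>"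
  have N': "N' > 0" "real N' \<ge> D" "real N' \<le> N + D + 1"
    using assms(2) unfolding N'_def by linarith+
  have "(\<Sum>n\<in>{M..<M+N}. (cmod (\<Sum>t\<in>T. b t * unit_circle (real n * \<alpha> t)))\<^sup>2)
      \<le> (\<Sum>n\<in>{M..<M+N'}. (cmod (\<Sum>t\<in>T. b t * unit_circle (real n * \<alpha> t)))\<^sup>2)"
    by (intro sum_mono2) (auto simp: N'_def)
  also have "\<dots> \<le> (4 * real N' + 4 / ((1/D)\<^sup>2 * real N')) * (\<Sum>t\<in>T. (cmod (b t))\<^sup>2)"
    using assms N' by (intro spaced_dual_sum_le) auto
  also have "4 / ((1/D)\<^sup>2 * real N') \<le> 4 * D"
    using N' assms(2) by (simp add: field_simps power2_eq_square)
  then have "4 * real N' + 4 / ((1/D)\<^sup>2 * real N') \<le> 12 * (D + real N)"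
    using N' assms(2) by simp
  then have "(4 * real N' + 4 / ((1/D)\<^sup>2 * real N')) * (\<Sum>t\<in>T. (cmod (b t))\<^sup>2) \<le> 12 * (D + real N) * (\<Sum>t\<in>T. (cmod (b t))\<^sup>2)"
    by (intro mult_right_mono sum_nonneg) auto
  finally show "(\<Sum>n\<in>{M..<M+N}. (cmod (\<Sum>t\<in>T. b t * unit_circle (real n * \<alpha> t)))\<^sup>2)
      \<le> 12 * (D + real N) * (\<Sum>t\<in>T. (cmod (b t))\<^sup>2)" .
qed (use assms in auto)

section \<open>Dirichlet characters and Gauss sums\<close>

lemma dirichlet_character_mult:
  "dirichlet_character q \<chi> \<Longrightarrow> \<chi> (m * n) = \<chi> m * \<chi> n"
  unfolding dirichlet_character_def by blast

lemma dirichlet_character_eq_0_iff: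
  "dirichlet_character q \<chi> \<Longrightarrow> \<chi> n = 0 \<longleftrightarrow> \<not> coprime n q"
  unfolding dirichlet_character_def by blast

lemma dirichlet_character_power:
  assumes "dirichlet_character q \<chi>"
  shows "\<chi> (n ^ k) = \<chi> n ^ k"
proof (induction k)
  case 0
  show ?case using assms by (simp add: dirichlet_character_def)
next
  case (Suc k)
  then show ?case by (simp add: dirichlet_character_mult[OF assms])
qed

lemma dirichlet_character_cong:
  assumes "dirichlet_character q \<chi>" "[m = n] (mod q)"
  shows "\<chi> m = \<chi> n"
proof -
  have "\<chi> (r + k * q) = \<chi> r" for r k
  proof (induction k)
    case (Suc k)
    have "\<chi> ((r + k * q) + q) = \<chi> (r + k * q)"
      using assms(1) unfolding dirichlet_character_def by blast
    then show ?case using Suc by (simp add: algebra_simps)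
  qed simp
  then have "\<chi> x = \<chi> (x mod q)" for x
    using mod_mult_div_eq[of x q] by (metis mult.commute)
  then show ?thesis using assms(2) by (metis cong_def)
qed

lemma norm_dirichlet_character:
  assumes "dirichlet_character q \<chi>" "coprime n q"
  shows "cmod (\<chi> n) = 1"
proof -
  have "q > 0" using assms(1) by (simp add: dirichlet_character_def)
  have "\<chi> (n ^ totient q) = \<chi> 1"
    using assms euler_theorem by (intro dirichlet_character_cong[OF assms(1)]) auto
  also have "\<chi> 1 = 1" using assms(1) by (simp add: dirichlet_character_def)
  finally have "\<chi> n ^ totient q = 1"
    by (simp add: dirichlet_character_power[OF assms(1)])
  from arg_cong[OF this, of cmod] have "cmod (\<chi> n) ^ totient q = 1 ^ totient q"
    by (simp add: norm_power)
  moreover have "totient q > 0" using \<open>q > 0\<close> by simp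
  ultimately show ?thesis
    using power_eq_imp_eq_base[of "cmod (\<chi> n)" "totient q" 1] by simp
qed

text \<open>Representatives start at \<open>0\<close>, as the values of \<open>mod\<close> do. Hence
  multiplication by a unit followed by \<open>mod q\<close> permutes the set also for
  \<open>q = 1\<close>, where it is \<open>{0}\<close>.\<close>

definition units_mod :: "nat \<Rightarrow> nat set" where
  "units_mod q = {a. a < q \<and> coprime a q}"

lemma finite_units_mod [simp]: "finite (units_mod q)"
  by (simp add: units_mod_def)

lemma card_units_mod_le: "card (units_mod q) \<le> q"
  using card_mono[of "{..<q}" "units_mod q"] by (auto simp: units_mod_def)

lemma bij_betw_units_mod:
  assumes "coprime c q" "q \<ge> 1"
  shows "bij_betw (\<lambda>a. c * a mod q) (units_mod q) (units_mod q)"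
proof -
  have inj: "inj_on (\<lambda>a. c * a mod q) (units_mod q)"
  proof (rule inj_onI)
    fix a b assume ab: "a \<in> units_mod q" "b \<in> units_mod q" "c * a mod q = c * b mod q"
    then have "[c * a = c * b] (mod q)" by (simp add: cong_def)
    then have "[a = b] (mod q)" using assms by (simp add: cong_mult_lcancel_nat)
    then show "a = b" using ab by (simp add: units_mod_def cong_def)
  qed
  moreover have "(\<lambda>a. c * a mod q) ` units_mod q \<subseteq> units_mod q"
    using assms by (auto simp: units_mod_def)
  ultimately show ?thesis
    by (simp add: bij_betw_def endo_inj_surj)
qed

lemma sum_units_mod_mult:
  assumes "coprime c q" "q \<ge> 1"
  shows "(\<Sum>a\<in>units_mod q. g (c * a mod q)) = (\<Sum>a\<in>units_mod q. g a)"
  using sum.reindex_bij_betw[OF bij_betw_units_mod[OF assms], of g] by simp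

text \<open>Choose \<open>c\<close> with \<open>\<chi> c \<noteq> \<psi> c\<close>; it is coprime to
  \<open>q\<close> because both characters vanish on the other integers. Replacing \<open>a\<close>
  by \<open>c a\<close> multiplies the sum by \<open>\<chi> c * cnj (\<psi> c)\<close>, which is not
  \<open>1\<close>.\<close>

lemma dirichlet_character_orthogonal:
  assumes "dirichlet_character q \<chi>" "dirichlet_character q \<psi>" "\<chi> \<noteq> \<psi>"
  shows "(\<Sum>a\<in>units_mod q. \<chi> a * cnj (\<psi> a)) = 0"
proof -
  have q: "q \<ge> 1" using assms(1) by (simp add: dirichlet_character_def)
  obtain c where c: "\<chi> c \<noteq> \<psi> c" using assms(3) by auto
  then have cop: "coprime c q"
    using assms(1,2) dirichlet_character_eq_0_iff by metis
  define S where "S = (\<Sum>a\<in>units_mod q. \<chi> a * cnj (\<psi> a))"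
  have "S = (\<Sum>a\<in>units_mod q. \<chi> (c * a mod q) * cnj (\<psi> (c * a mod q)))"
    unfolding S_def by (rule sum_units_mod_mult[OF cop q, symmetric])
  also have "\<dots> = (\<Sum>a\<in>units_mod q. (\<chi> c * cnj (\<psi> c)) * (\<chi> a * cnj (\<psi> a)))"
  proof (intro sum.cong refl)
    fix a
    have "\<chi> (c * a mod q) = \<chi> c * \<chi> a" "\<psi> (c * a mod q) = \<psi> c * \<psi> a"
      using assms(1,2) dirichlet_character_cong[of q _ "c * a mod q" "c * a"]
      by (auto simp: dirichlet_character_mult)
    then show "\<chi> (c * a mod q) * cnj (\<psi> (c * a mod q)) = (\<chi> c * cnj (\<psi> c)) * (\<chi> a * cnj (\<psi> a))"
      by simp
  qed
  also have "\<dots> = (\<chi> c * cnj (\<psi> c)) * S"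
    by (simp add: S_def sum_distrib_left)
  finally have "S * (1 - \<chi> c * cnj (\<psi> c)) = 0" by (simp add: algebra_simps)
  moreover have "\<chi> c * cnj (\<psi> c) \<noteq> 1"
  proof
    assume "\<chi> c * cnj (\<psi> c) = 1"
    then have "\<chi> c * (cnj (\<psi> c) * \<psi> c) = \<psi> c" by (simp add: mult.assoc[symmetric])
    moreover have "\<psi> c * cnj (\<psi> c) = 1"
      using norm_dirichlet_character[OF assms(2) cop] complex_norm_square[of "\<psi> c"] by simp
    ultimately show False using c by (simp add: mult.commute)
  qed
  ultimately show ?thesis by (simp add: S_def)
qed

lemma dirichlet_character_sum_norm_eq:
  assumes "finite E" "\<And>\<chi>. \<chi> \<in> E \<Longrightarrow> dirichlet_character q \<chi>"
  shows "(\<Sum>a\<in>units_mod q. (cmod (\<Sum>\<chi>\<in>E. b \<chi> * \<chi> a))\<^sup>2) = card (units_mod q) * (\<Sum>\<chi>\<in>E. (cmod (b \<chi>))\<^sup>2)"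
proof -
  have diag: "(\<Sum>a\<in>units_mod q. \<chi> a * cnj (\<psi> a)) = (if \<chi> = \<psi> then of_nat (card (units_mod q)) else 0)"
    if "\<chi> \<in> E" "\<psi> \<in> E" for \<chi> \<psi>
  proof (cases "\<chi> = \<psi>")
    case True
    have "(\<Sum>a\<in>units_mod q. \<chi> a * cnj (\<chi> a)) = (\<Sum>a\<in>units_mod q. 1)"
      using norm_dirichlet_character[OF assms(2)[OF that(1)]]
      by (intro sum.cong refl) (simp add: units_mod_def flip: complex_norm_square)
    then show ?thesis using True by simp
  qed (use that assms dirichlet_character_orthogonal in auto)
  have "complex_of_real (\<Sum>a\<in>units_mod q. (cmod (\<Sum>\<chi>\<in>E. b \<chi> * \<chi> a))\<^sup>2)
     = (\<Sum>a\<in>units_mod q. \<Sum>\<chi>\<in>E. \<Sum>\<psi>\<in>E. (b \<chi> * \<chi> a) * cnj (b \<psi> * \<psi> a))"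
    unfolding of_real_sum complex_norm_square cnj_sum sum_product ..
  also have "\<dots> = (\<Sum>\<chi>\<in>E. \<Sum>a\<in>units_mod q. \<Sum>\<psi>\<in>E. (b \<chi> * \<chi> a) * cnj (b \<psi> * \<psi> a))"
    by (rule sum.swap)
  also have "\<dots> = (\<Sum>\<chi>\<in>E. \<Sum>\<psi>\<in>E. \<Sum>a\<in>units_mod q. (b \<chi> * \<chi> a) * cnj (b \<psi> * \<psi> a))"
    by (rule sum.cong[OF refl], rule sum.swap)
  also have "\<dots> = (\<Sum>\<chi>\<in>E. \<Sum>\<psi>\<in>E. b \<chi> * cnj (b \<psi>) * (\<Sum>a\<in>units_mod q. \<chi> a * cnj (\<psi> a)))"
    by (simp add: sum_distrib_left mult_ac)
  also have "\<dots> = (\<Sum>\<chi>\<in>E. \<Sum>\<psi>\<in>E. if \<psi> = \<chi> then b \<chi> * cnj (b \<chi>) * of_nat (card (units_mod q)) else 0)"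
    by (intro sum.cong refl) (auto simp: diag)
  also have "\<dots> = (\<Sum>\<chi>\<in>E. b \<chi> * cnj (b \<chi>) * of_nat (card (units_mod q)))"
    using assms(1) by simp
  also have "\<dots> = complex_of_real (card (units_mod q) * (\<Sum>\<chi>\<in>E. (cmod (b \<chi>))\<^sup>2))"
    unfolding of_real_mult of_real_sum complex_norm_square by (simp add: sum_distrib_left mult_ac)
  finally show ?thesis by (simp only: of_real_eq_iff)
qed

text \<open>Orthogonality, in the form of the preceding identity, is a dual inequality with
  \<open>\<Delta>\<close> the number of units, so Bessel's inequality is another case of duality.
  The characters are conjugated here because this is how they enter the Gauss sums.\<close>

lemma dirichlet_character_bessel:
  assumes "finite E" "\<And>\<chi>. \<chi> \<in> E \<Longrightarrow> dirichlet_character q \<chi>"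
  shows "(\<Sum>\<chi>\<in>E. (cmod (\<Sum>a\<in>units_mod q. F a * cnj (\<chi> a)))\<^sup>2) \<le> q * (\<Sum>a\<in>units_mod q. (cmod (F a))\<^sup>2)"
proof -
  have "(\<Sum>\<chi>\<in>E. (cmod (\<Sum>a\<in>units_mod q. cnj (F a) * \<chi> a))\<^sup>2)
      \<le> real (card (units_mod q)) * (\<Sum>a\<in>units_mod q. (cmod (cnj (F a)))\<^sup>2)"
    by (rule large_sieve_duality[OF assms(1) finite_units_mod _ eq_refl[OF dirichlet_character_sum_norm_eq[OF assms]]]) simp
  also have "\<dots> \<le> q * (\<Sum>a\<in>units_mod q. (cmod (F a))\<^sup>2)"
    using card_units_mod_le[of q] by (simp add: mult_right_mono sum_nonneg)
  also have "(\<lambda>\<chi>. cmod (\<Sum>a\<in>units_mod q. cnj (F a) * \<chi> a)) = (\<lambda>\<chi>. cmod (\<Sum>a\<in>units_mod q. F a * cnj (\<chi> a)))"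
  proof
    fix \<chi> :: "nat \<Rightarrow> complex"
    have "(\<Sum>a\<in>units_mod q. cnj (F a) * \<chi> a) = cnj (\<Sum>a\<in>units_mod q. F a * cnj (\<chi> a))"
      by simp
    then show "cmod (\<Sum>a\<in>units_mod q. cnj (F a) * \<chi> a) = cmod (\<Sum>a\<in>units_mod q. F a * cnj (\<chi> a))"
      by (metis complex_mod_cnj)
  qed
  finally show ?thesis .
qed

section \<open>Primitive characters and their Gauss sums\<close>

lemma unit_circle_cong_mod:
  assumes "[x = y] (mod q)"
  shows "unit_circle (real x / real q) = unit_circle (real y / real q)"
proof (cases "q = 0")
  case False
  have "[int x = int y] (mod int q)" using assms by (simp add: cong_int_iff)
  then obtain k where "int x - int y = int q * k"
    by (metis cong_iff_dvd_diff dvdE)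
  then have "real x - real y = real q * of_int k"
    by (metis of_int_diff of_int_mult of_int_of_nat_eq)
  then have "real x / real q - real y / real q = of_int k"
    using False by (simp add: field_simps)
  then show ?thesis by (intro unit_circle_cong) simp
qed auto

lemma not_coprime_prime_dvd:
  fixes a b :: nat
  assumes "\<not> coprime a b"
  obtains p where "prime p" "p dvd a" "p dvd b"
proof -
  obtain p where "prime p" "p dvd gcd a b"
    using assms prime_factor_nat[of "gcd a b"] unfolding coprime_iff_gcd_eq_1 by blast
  then show ?thesis by (intro that) auto
qed

text \<open>Take \<open>m = n + r t\<close>, where \<open>t\<close> is the product of the primes
  that divide \<open>q\<close> but not \<open>n\<close>. A prime divisor of \<open>q\<close> that
  divides \<open>n\<close> divides neither \<open>r\<close> nor \<open>t\<close>; one that does not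
  divide \<open>n\<close> divides \<open>t\<close>. In both cases it divides exactly one of the two
  summands.\<close>

lemma exists_coprime_lift:
  fixes n q r :: nat
  assumes "coprime n r" "q > 0"
  shows "\<exists>m. coprime m q \<and> [m = n] (mod r)"
proof -
  define P where "P = {p. prime p \<and> p dvd q \<and> \<not> p dvd n}"
  define t where "t = \<Prod>P"
  have fin: "finite P"
    using assms(2) by (intro finite_subset[of P "{..q}"]) (auto simp: P_def dest: dvd_imp_le)
  have "coprime (n + r * t) q"
  proof (rule ccontr)
    assume "\<not> coprime (n + r * t) q"
    then obtain p where p: "prime p" "p dvd n + r * t" "p dvd q"
      by (rule not_coprime_prime_dvd)
    show False
    proof (cases "p dvd n")
      case True
      then have "p dvd r * t" using p(2) by (simp add: dvd_add_right_iff)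
      moreover have "\<not> p dvd r"
        using True assms(1) p(1) coprime_common_divisor not_prime_unit by blast
      ultimately have "p dvd \<Prod>P" using p(1) by (simp add: t_def prime_dvd_mult_iff)
      then obtain p' where "p' \<in> P" "p dvd p'"
        using p(1) fin prime_dvd_prod_iff[of P p "\<lambda>x. x"] by auto
      then have "p' = p" using p(1) primes_dvd_imp_eq unfolding P_def by blast
      then show False using \<open>p' \<in> P\<close> True unfolding P_def by blast
    next
      case False
      then have "p \<in> P" using p(1,3) unfolding P_def by blast
      then have "p dvd t" unfolding t_def using dvd_prodI[OF fin, of p "\<lambda>x. x"] by simp
      then have "p dvd r * t" by (rule dvd_mult)
      then show False using False p(2) by (simp add: dvd_add_left_iff)
    qed
  qed
  then show ?thesis by (intro exI[of _ "n + r * t"]) (simp add: cong_def)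
qed

text \<open>A character that is trivial on the units congruent to \<open>1\<close> modulo
  \<open>r\<close> depends only on residues modulo \<open>r\<close>, hence is induced by a character
  modulo \<open>r\<close>, against primitivity. Most of the proof constructs that character
  \<open>\<psi>\<close>.\<close>

lemma primitive_character_nontrivial_on_kernel:
  assumes "\<chi> \<in> primitive_dirichlet_characters q" "r dvd q" "r < q"
  shows "\<exists>c. coprime c q \<and> [c = 1] (mod r) \<and> \<chi> c \<noteq> 1"
proof (rule ccontr)
  assume contra: "\<not> ?thesis"
  have ch: "dirichlet_character q \<chi>" using assms(1) by (simp add: primitive_dirichlet_characters_def)
  have q: "q > 0" using ch by (simp add: dirichlet_character_def)
  have r: "r > 0" using assms(2) q by (metis dvd_pos_nat)
  have eq: "\<chi> a = \<chi> b" if ab: "coprime a q" "coprime b q" "[a = b] (mod r)" for a b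
  proof -
    obtain b' where b': "[b * b' = 1] (mod q)" using ab(2) by (metis cong_solve_coprime_nat One_nat_def)
    then have "coprime b' q" by (metis coprime_iff_invertible_nat mult.commute One_nat_def)
    moreover have "[a * b' = 1] (mod r)"
    proof -
      have "[a * b' = b * b'] (mod r)" using ab(3) by (rule cong_scalar_right)
      moreover have "[b * b' = 1] (mod r)" using b' assms(2) by (rule cong_dvd_modulus_nat)
      ultimately show ?thesis by (rule cong_trans)
    qed
    ultimately have "\<chi> (a * b') = 1" using contra ab(1) by auto
    moreover have "\<chi> (b * b') = 1"
      using dirichlet_character_cong[OF ch b'] ch by (simp add: dirichlet_character_def)
    ultimately show ?thesis
      by (metis ch dirichlet_character_mult mult_cancel_right mult_zero_right zero_neq_one)
  qed
  \<comment> \<open>A unit modulo \<open>r\<close> is lifted to a unit modulo \<open>q\<close>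
    before \<open>\<chi>\<close> is applied; \<open>eq\<close> makes the value independent of the
    chosen lift.\<close>
  define l where "l n = (SOME m. coprime m q \<and> [m = n] (mod r))" for n
  have l: "coprime (l n) q" "[l n = n] (mod r)" if "coprime n r" for n
    using someI_ex[OF exists_coprime_lift[OF that q]] by (simp_all add: l_def)
  define \<psi> where "\<psi> n = (if coprime n r then \<chi> (l n) else 0)" for n
  have \<psi>_eq: "\<psi> n = \<chi> m" if "coprime m q" "[m = n] (mod r)" for m n
  proof -
    have "coprime m r" using that(1) assms(2) by (metis coprime_divisors dvd_refl)
    then have "coprime n r" using that(2) by (metis cong_imp_coprime)
    moreover have "[l n = m] (mod r)"
      using l(2)[OF \<open>coprime n r\<close>] that(2) by (metis cong_sym cong_trans)
    ultimately show ?thesis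
      unfolding \<psi>_def using eq[OF l(1)[OF \<open>coprime n r\<close>] that(1)] by simp
  qed
  have \<psi>_0: "\<psi> n = 0" if "\<not> coprime n r" for n
    unfolding \<psi>_def using that by (rule if_not_P)
  have \<psi>_l: "\<psi> n = \<chi> (l n)" if "coprime n r" for n
    unfolding \<psi>_def using that by (rule if_P)
  have \<psi>_1: "\<psi> 1 = 1"
    using \<psi>_eq[of 1 1] ch by (simp add: dirichlet_character_def)
  have \<psi>_mult: "\<psi> (m * n) = \<psi> m * \<psi> n" for m n
  proof (cases "coprime m r \<and> coprime n r")
    case True
    then have "\<psi> (m * n) = \<chi> (l m * l n)"
      using l by (intro \<psi>_eq) (auto intro: cong_mult)
    then show ?thesis using True by (simp only: \<psi>_l dirichlet_character_mult[OF ch])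
  next
    case False
    then have "\<not> coprime (m * n) r" by (simp only: coprime_mult_left_iff not_False_eq_True)
    then have "\<psi> (m * n) = 0" by (rule \<psi>_0)
    then show ?thesis using False \<psi>_0 by auto
  qed
  have \<psi>_period: "\<psi> (n + r) = \<psi> n" for n
  proof (cases "coprime n r")
    case True
    have "[l n = n + r] (mod r)" using l(2)[OF True] by (simp add: cong_def)
    then show ?thesis using \<psi>_eq[OF l(1)[OF True]] \<psi>_l[OF True] by metis
  next
    case False
    then have "\<not> coprime (n + r) r" unfolding coprime_iff_gcd_eq_1 gcd_add1 .
    then show ?thesis using False \<psi>_0 by metis
  qed
  have \<psi>_iff: "\<psi> n = 0 \<longleftrightarrow> \<not> coprime n r" for n
  proof (cases "coprime n r")
    case True
    then have "\<psi> n \<noteq> 0"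
      using l(1)[OF True] \<psi>_l[OF True] dirichlet_character_eq_0_iff[OF ch, of "l n"] by metis
    then show ?thesis using True by blast
  qed (use \<psi>_0 in blast)
  have "1 \<le> r" using r by linarith
  then have "dirichlet_character r \<psi>"
    unfolding dirichlet_character_def using \<psi>_1 \<psi>_mult \<psi>_period \<psi>_iff by blast
  moreover have "\<chi> n = \<psi> n" if "coprime n q" for n
    using \<psi>_eq[OF that cong_refl] by (rule sym)
  ultimately show False
    using assms unfolding primitive_dirichlet_characters_def by blast
qed

text \<open>The character is conjugated so that for primitive \<open>\<chi>\<close> the sum at
  \<open>n\<close> is a multiple of \<open>\<chi> n\<close> itself.\<close>

definition gauss_sum :: "nat \<Rightarrow> (nat \<Rightarrow> complex) \<Rightarrow> nat \<Rightarrow> complex" where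
  "gauss_sum q \<chi> n = (\<Sum>a\<in>units_mod q. cnj (\<chi> a) * unit_circle (real (n * a) / real q))"

lemma gauss_sum_substitute:
  assumes ch: "dirichlet_character q \<chi>" and c: "coprime c q"
  shows "gauss_sum q \<chi> n = cnj (\<chi> c) * gauss_sum q \<chi> (n * c)"
proof -
  have q: "q \<ge> 1" using ch by (simp add: dirichlet_character_def)
  have "gauss_sum q \<chi> n = (\<Sum>a\<in>units_mod q. cnj (\<chi> (c * a mod q)) * unit_circle (real (n * (c * a mod q)) / real q))"
    unfolding gauss_sum_def by (rule sum_units_mod_mult[OF c q, symmetric])
  also have "\<dots> = (\<Sum>a\<in>units_mod q. cnj (\<chi> c) * (cnj (\<chi> a) * unit_circle (real (n * c * a) / real q)))"
  proof (intro sum.cong refl)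
    fix a
    have "\<chi> (c * a mod q) = \<chi> (c * a)"
      by (rule dirichlet_character_cong[OF ch]) simp
    moreover have "unit_circle (real (n * (c * a mod q)) / real q) = unit_circle (real (n * c * a) / real q)"
      by (rule unit_circle_cong_mod) (simp add: cong_def mod_mult_right_eq mult.assoc)
    ultimately show "cnj (\<chi> (c * a mod q)) * unit_circle (real (n * (c * a mod q)) / real q) =
        cnj (\<chi> c) * (cnj (\<chi> a) * unit_circle (real (n * c * a) / real q))"
      by (simp add: dirichlet_character_mult[OF ch])
  qed
  finally show ?thesis by (simp add: gauss_sum_def sum_distrib_left)
qed

text \<open>For \<open>n\<close> coprime to \<open>q\<close> substitute \<open>n a\<close> for
  \<open>a\<close>. Otherwise the reduced denominator \<open>r\<close> of \<open>n / q\<close> is a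
  proper divisor of \<open>q\<close>, and multiplying \<open>n\<close> by some \<open>c\<close>
  congruent to \<open>1\<close> modulo \<open>r\<close> changes no exponential. Choosing
  \<open>c\<close> with \<open>\<chi> c \<noteq> 1\<close>, which primitivity permits, forces the
  sum to vanish, as \<open>\<chi> n\<close> does.\<close>

lemma gauss_sum_primitive:
  assumes "\<chi> \<in> primitive_dirichlet_characters q"
  shows "gauss_sum q \<chi> n = \<chi> n * gauss_sum q \<chi> 1"
proof -
  have ch: "dirichlet_character q \<chi>" using assms by (simp add: primitive_dirichlet_characters_def)
  have q: "q > 0" using ch by (simp add: dirichlet_character_def)
  show ?thesis
  proof (cases "coprime n q")
    case True
    have "\<chi> n * cnj (\<chi> n) = 1"
      using norm_dirichlet_character[OF ch True] complex_norm_square[of "\<chi> n"] by simp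
    then show ?thesis
      using gauss_sum_substitute[OF ch True, of 1] by (simp add: mult.assoc[symmetric])
  next
    case False
    define g where "g = gcd n q"
    have "g \<noteq> 1" using False unfolding g_def coprime_iff_gcd_eq_1 .
    moreover have "g > 0" using q by (simp add: g_def)
    ultimately have g: "g > 1" by linarith
    have "g dvd q" "g dvd n" by (simp_all add: g_def)
    then obtain r n' where r: "q = g * r" "n = g * n'" by (elim dvdE)
    have "r dvd q" unfolding r(1) by (rule dvd_triv_right)
    have "r > 0" using r(1) q by (cases "r = 0") auto
    then have "1 * r < g * r" using g by (intro mult_strict_right_mono)
    then have "r < q" using r(1) by simp
    then obtain c where c: "coprime c q" "[c = 1] (mod r)" "\<chi> c \<noteq> 1"
      using primitive_character_nontrivial_on_kernel[OF assms \<open>r dvd q\<close> \<open>r < q\<close>] by blast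
    have "[n' * c = n' * 1] (mod r)" using c(2) by (rule cong_scalar_left)
    then have "[g * (n' * c) = g * (n' * 1)] (mod (g * r))" by (rule cong_cmult_leftI)
    then have *: "[n * c = n] (mod q)"
      using r by (simp add: mult.assoc)
    have "gauss_sum q \<chi> (n * c) = gauss_sum q \<chi> n"
      unfolding gauss_sum_def
      by (intro sum.cong refl arg_cong2[of _ _ _ _ "(*)"] unit_circle_cong_mod cong_mult *) simp
    then have "gauss_sum q \<chi> n * (1 - cnj (\<chi> c)) = 0"
      using gauss_sum_substitute[OF ch c(1), of n] by (simp add: algebra_simps)
    moreover have "cnj (\<chi> c) \<noteq> 1" using c(3) by (metis complex_cnj_cnj complex_cnj_one)
    ultimately show ?thesis
      using False by (simp add: dirichlet_character_eq_0_iff[OF ch])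
  qed
qed

lemma sum_unit_circle_mod:
  assumes "a < q" "b < q"
  shows "(\<Sum>n<q. unit_circle (real (n * a) / real q) * cnj (unit_circle (real (n * b) / real q))) = (if a = b then of_nat q else 0)"
proof -
  define z where "z = unit_circle ((real a - real b) / real q)"
  have *: "unit_circle (real (n * a) / real q) * cnj (unit_circle (real (n * b) / real q)) = z ^ n" for n
    by (simp add: z_def cnj_unit_circle unit_circle_power algebra_simps diff_divide_distrib flip: unit_circle_add)
  show ?thesis
  proof (cases "a = b")
    case True
    then show ?thesis unfolding * by (simp add: z_def)
  next
    case False
    have "z \<noteq> 1"
    proof
      assume "z = 1"
      then have "cos (2 * pi * ((real a - real b) / real q)) = 1"
        by (simp add: z_def unit_circle_def complex_eq_iff)
      then obtain k :: int where "2 * pi * ((real a - real b) / real q) = of_int k * (2 * pi)"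
        by (auto simp: cos_one_2pi_int)
      then have "(2 * pi) * ((real a - real b) / real q) = (2 * pi) * of_int k"
        by (simp only: mult.commute)
      then have "(real a - real b) / real q = of_int k"
        by (subst (asm) mult_left_cancel) auto
      then have "real a - real b = of_int k * real q"
        using assms by (simp add: divide_eq_eq split: if_splits)
      then have "real_of_int (int a - int b) = of_int (k * int q)"
        by simp
      then have "int a - int b = k * int q" by (simp only: of_int_eq_iff)
      then have "int q dvd int a - int b" by simp
      then have "[a = b] (mod q)" by (metis cong_iff_dvd_diff cong_int_iff)
      then show False using assms False by (simp add: cong_def)
    qed
    moreover have "z ^ q = 1"
    proof -
      have "z ^ q = unit_circle (of_int (int a - int b))"
        using assms by (simp add: z_def unit_circle_power)
      then show ?thesis by (simp only: unit_circle_int)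
    qed
    ultimately show ?thesis unfolding * using False by (simp add: sum_gp_strict)
  qed
qed

text \<open>The sum of \<open>|gauss_sum q \<chi> n|^2\<close> over all residues \<open>n\<close> is
  evaluated twice. Orthogonality of the exponentials gives \<open>q\<close> times the number of
  units; the relation for primitive characters gives the number of units times
  \<open>|gauss_sum q \<chi> 1|^2\<close>.\<close>

lemma norm_gauss_sum_primitive:
  assumes "\<chi> \<in> primitive_dirichlet_characters q"
  shows "(cmod (gauss_sum q \<chi> 1))\<^sup>2 = q"
proof -
  have ch: "dirichlet_character q \<chi>" using assms by (simp add: primitive_dirichlet_characters_def)
  have q: "q > 0" using ch by (simp add: dirichlet_character_def)
  define e where "e n a = unit_circle (real (n * a) / real q)" for n a
  have "complex_of_real (\<Sum>n<q. (cmod (gauss_sum q \<chi> n))\<^sup>2) =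
      (\<Sum>n<q. \<Sum>a\<in>units_mod q. \<Sum>b\<in>units_mod q. (cnj (\<chi> a) * e n a) * cnj (cnj (\<chi> b) * e n b))"
    unfolding of_real_sum complex_norm_square gauss_sum_def cnj_sum sum_product e_def ..
  also have "\<dots> = (\<Sum>a\<in>units_mod q. \<Sum>n<q. \<Sum>b\<in>units_mod q. (cnj (\<chi> a) * e n a) * cnj (cnj (\<chi> b) * e n b))"
    by (rule sum.swap)
  also have "\<dots> = (\<Sum>a\<in>units_mod q. \<Sum>b\<in>units_mod q. \<Sum>n<q. (cnj (\<chi> a) * e n a) * cnj (cnj (\<chi> b) * e n b))"
    by (rule sum.cong[OF refl], rule sum.swap)
  also have "\<dots> = (\<Sum>a\<in>units_mod q. \<Sum>b\<in>units_mod q. cnj (\<chi> a) * \<chi> b * (\<Sum>n<q. e n a * cnj (e n b)))"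
    by (simp add: sum_distrib_left mult_ac)
  also have "\<dots> = (\<Sum>a\<in>units_mod q. \<Sum>b\<in>units_mod q. if a = b then cnj (\<chi> a) * \<chi> a * of_nat q else 0)"
    unfolding e_def by (intro sum.cong refl, subst sum_unit_circle_mod) (auto simp: units_mod_def)
  also have "\<dots> = (\<Sum>a\<in>units_mod q. cnj (\<chi> a) * \<chi> a * of_nat q)"
    by simp
  also have "\<dots> = (\<Sum>a\<in>units_mod q. of_nat q)"
  proof (intro sum.cong refl)
    fix a assume "a \<in> units_mod q"
    then have "cnj (\<chi> a) * \<chi> a = 1"
      using norm_dirichlet_character[OF ch, of a] complex_norm_square[of "\<chi> a"]
      by (simp add: units_mod_def mult.commute)
    then show "cnj (\<chi> a) * \<chi> a * of_nat q = of_nat q" by simp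
  qed
  also have "\<dots> = complex_of_real (card (units_mod q) * q)" by simp
  finally have 1: "(\<Sum>n<q. (cmod (gauss_sum q \<chi> n))\<^sup>2) = card (units_mod q) * q"
    by (simp only: of_real_eq_iff)
  have "(\<Sum>n<q. (cmod (gauss_sum q \<chi> n))\<^sup>2) = (\<Sum>n\<in>units_mod q. (cmod (gauss_sum q \<chi> n))\<^sup>2)"
  proof (rule sum.mono_neutral_right)
    show "\<forall>n\<in>{..<q} - units_mod q. (cmod (gauss_sum q \<chi> n))\<^sup>2 = 0"
    proof
      fix n assume "n \<in> {..<q} - units_mod q"
      then have "\<chi> n = 0" by (auto simp: units_mod_def dirichlet_character_eq_0_iff[OF ch])
      then show "(cmod (gauss_sum q \<chi> n))\<^sup>2 = 0" by (subst gauss_sum_primitive[OF assms]) simp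
    qed
  qed (auto simp: units_mod_def)
  also have "\<dots> = (\<Sum>n\<in>units_mod q. (cmod (gauss_sum q \<chi> 1))\<^sup>2)"
  proof (intro sum.cong refl)
    fix n assume "n \<in> units_mod q"
    then have "cmod (\<chi> n) = 1" using norm_dirichlet_character[OF ch] by (simp add: units_mod_def)
    then show "(cmod (gauss_sum q \<chi> n))\<^sup>2 = (cmod (gauss_sum q \<chi> 1))\<^sup>2"
      using gauss_sum_primitive[OF assms, of n] by (simp add: norm_mult)
  qed
  finally have "real (card (units_mod q) * q) = (\<Sum>n\<in>units_mod q. (cmod (gauss_sum q \<chi> 1))\<^sup>2)"
    unfolding 1 .
  then have "real (card (units_mod q)) * real q = real (card (units_mod q)) * (cmod (gauss_sum q \<chi> 1))\<^sup>2"
    by (simp only: sum_constant of_nat_mult)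
  moreover
  have "card (units_mod q) > 0"
  proof -
    \<comment> \<open>The residue of \<open>1\<close>, which for \<open>q = 1\<close> is represented
      by \<open>0\<close>.\<close>
    have "(if q = 1 then 0 else 1) \<in> units_mod q"
      using q by (cases "q = 1") (auto simp: units_mod_def)
    then have "units_mod q \<noteq> {}" by blast
    then show ?thesis using finite_units_mod card_gt_0_iff by blast
  qed
  then have "real (card (units_mod q)) \<noteq> 0" by linarith
  ultimately show ?thesis by (metis mult_left_cancel)
qed

text \<open>Multiplication by the Gauss sum writes \<open>\<chi> n\<close> as a combination of
  exponentials with coefficients \<open>cnj (\<chi> a)\<close>. Bessel's inequality over the
  characters then costs a factor \<open>q\<close>, which equals the squared modulus of the Gauss sum
  and cancels.\<close>

lemma primitive_character_sum_le:
  assumes "E \<subseteq> primitive_dirichlet_characters q" "finite E" "finite A"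
  shows "(\<Sum>\<chi>\<in>E. (cmod (\<Sum>n\<in>A. x n * \<chi> n))\<^sup>2)
    \<le> (\<Sum>a\<in>units_mod q. (cmod (\<Sum>n\<in>A. x n * unit_circle (real n * (real a / real q))))\<^sup>2)"
proof (cases "E = {}")
  case False
  then obtain \<chi>0 where "dirichlet_character q \<chi>0"
    using assms(1) by (auto simp: primitive_dirichlet_characters_def)
  then have q: "q > 0" by (simp add: dirichlet_character_def)
  define F where "F a = (\<Sum>n\<in>A. x n * unit_circle (real n * (real a / real q)))" for a
  have *: "q * (cmod (\<Sum>n\<in>A. x n * \<chi> n))\<^sup>2 = (cmod (\<Sum>a\<in>units_mod q. F a * cnj (\<chi> a)))\<^sup>2" if "\<chi> \<in> E" for \<chi>
  proof -
    have pr: "\<chi> \<in> primitive_dirichlet_characters q" using that assms by auto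
    have "(\<Sum>n\<in>A. x n * \<chi> n) * gauss_sum q \<chi> 1 = (\<Sum>n\<in>A. x n * gauss_sum q \<chi> n)"
      by (subst gauss_sum_primitive[OF pr]) (simp add: sum_distrib_right mult.assoc)
    also have "\<dots> = (\<Sum>a\<in>units_mod q. F a * cnj (\<chi> a))"
      unfolding gauss_sum_def F_def sum_distrib_left sum_distrib_right
      by (subst sum.swap) (simp add: mult_ac)
    finally have "(cmod (\<Sum>a\<in>units_mod q. F a * cnj (\<chi> a)))\<^sup>2 = (cmod (\<Sum>n\<in>A. x n * \<chi> n))\<^sup>2 * (cmod (gauss_sum q \<chi> 1))\<^sup>2"
      by (metis norm_mult power_mult_distrib)
    then show ?thesis unfolding norm_gauss_sum_primitive[OF pr] by (simp only: mult.commute)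
  qed
  have "q * (\<Sum>\<chi>\<in>E. (cmod (\<Sum>n\<in>A. x n * \<chi> n))\<^sup>2) = (\<Sum>\<chi>\<in>E. (cmod (\<Sum>a\<in>units_mod q. F a * cnj (\<chi> a)))\<^sup>2)"
    by (simp add: sum_distrib_left *)
  also have "\<dots> \<le> q * (\<Sum>a\<in>units_mod q. (cmod (F a))\<^sup>2)"
    using assms by (intro dirichlet_character_bessel) (auto simp: primitive_dirichlet_characters_def)
  finally show ?thesis using q by (simp add: F_def)
qed (auto intro: sum_nonneg)

text \<open>The difference has denominator \<open>q r\<close> and an integer numerator
  \<open>z\<close>. If \<open>z\<close> were \<open>0\<close>, the fractions being reduced would
  force \<open>q\<close> and \<open>r\<close> to divide each other, and then
  \<open>a = b\<close>.\<close>

lemma farey_spacing: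
  assumes "a \<in> units_mod q" "b \<in> units_mod r" "q > 0" "r > 0" "(q, a) \<noteq> (r, b)"
  shows "\<bar>real a / real q - real b / real r - of_int k\<bar> \<ge> 1 / (real q * real r)"
proof -
  define z where "z = int a * int r - int b * int q - k * int q * int r"
  have eq: "real a / real q - real b / real r - of_int k = of_int z / (real q * real r)"
    using assms by (simp add: z_def field_simps)
  have "z \<noteq> 0"
  proof
    assume "z = 0"
    then have *: "int a * int r = (int b + k * int r) * int q" by (simp add: z_def algebra_simps)
    then have "int q dvd int a * int r" by simp
    then have "q dvd a * r" by (metis int_dvd_int_iff of_nat_mult)
    then have 1: "q dvd r" using assms(1) by (simp add: units_mod_def coprime_dvd_mult_right_iff coprime_commute)
    have "int b * int q = (int a - k * int q) * int r" using * by (simp add: algebra_simps)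
    then have "int r dvd int b * int q" by simp
    then have "r dvd b * q" by (metis int_dvd_int_iff of_nat_mult)
    then have 2: "r dvd q" using assms(2) by (simp add: units_mod_def coprime_dvd_mult_right_iff coprime_commute)
    have qr: "q = r" using 1 2 by (rule dvd_antisym)
    then have "int a = int b + k * int q" using * assms(3) by simp
    then have "[a = b] (mod q)" by (metis cong_int_iff cong_iff_lin cong_sym mult.commute)
    then have "a = b" using assms(1,2) qr by (simp add: units_mod_def cong_def)
    then show False using assms(5) qr by simp
  qed
  then have "1 \<le> \<bar>real_of_int z\<bar>" by linarith
  then show ?thesis unfolding eq using assms by (simp add: divide_right_mono)
qed

text \<open>\<open>D\<close> bounds products of two moduli because \<open>1 / (q r)\<close> is the
  spacing of the fractions.\<close>

lemma multiplicative_large_sieve: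
  fixes D :: real
  assumes "finite R" "\<And>q. q \<in> R \<Longrightarrow> q > 0" "D \<ge> 1"
    "\<And>q r. q \<in> R \<Longrightarrow> r \<in> R \<Longrightarrow> real q * real r \<le> D"
    "\<And>q. q \<in> R \<Longrightarrow> E q \<subseteq> primitive_dirichlet_characters q" "\<And>q. q \<in> R \<Longrightarrow> finite (E q)"
  shows "(\<Sum>q\<in>R. \<Sum>\<chi>\<in>E q. (cmod (\<Sum>n\<in>{M..<M+N}. x n * \<chi> n))\<^sup>2) \<le> 12 * (D + N) * (\<Sum>n\<in>{M..<M+N}. (cmod (x n))\<^sup>2)"
proof -
  have "(\<Sum>q\<in>R. \<Sum>\<chi>\<in>E q. (cmod (\<Sum>n\<in>{M..<M+N}. x n * \<chi> n))\<^sup>2)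
     \<le> (\<Sum>q\<in>R. \<Sum>a\<in>units_mod q. (cmod (\<Sum>n\<in>{M..<M+N}. x n * unit_circle (real n * (real a / real q))))\<^sup>2)"
    using assms by (intro sum_mono primitive_character_sum_le) auto
  also have "\<dots> = (\<Sum>t\<in>Sigma R units_mod. (cmod (\<Sum>n\<in>{M..<M+N}. x n * unit_circle (real n * (real (snd t) / real (fst t)))))\<^sup>2)"
    by (subst sum.Sigma) (auto simp: assms case_prod_unfold)
  also have "\<dots> \<le> 12 * (D + real N) * (\<Sum>n\<in>{M..<M+N}. (cmod (x n))\<^sup>2)"
  proof (rule additive_large_sieve)
    fix s t k assume st: "s \<in> Sigma R units_mod" "t \<in> Sigma R units_mod" "s \<noteq> t"
    obtain q a r b where eq: "s = (q, a)" "t = (r, b)" by (metis surj_pair)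
    have *: "q \<in> R" "r \<in> R" "a \<in> units_mod q" "b \<in> units_mod r" "(q, a) \<noteq> (r, b)"
      using st unfolding eq by blast+
    then have pos: "q > 0" "r > 0" using assms(2) by blast+
    have "1 / D \<le> 1 / (real q * real r)"
      using assms(4)[OF *(1,2)] pos assms(3) by (intro divide_left_mono mult_pos_pos) simp_all
    also have "\<dots> \<le> \<bar>real a / real q - real b / real r - of_int k\<bar>"
      by (rule farey_spacing[OF *(3,4) pos *(5)])
    finally show "1 / D \<le> \<bar>real (snd s) / real (fst s) - real (snd t) / real (fst t) - of_int k\<bar>"
      unfolding eq by simp
  qed (use assms in auto)
  finally show ?thesis .
qed

text \<open>For a single modulus the points \<open>a / q\<close> are \<open>1 / q\<close>-spaced, which is better than what
  Farey fractions with denominators up to \<open>q\<close> give.\<close>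

lemma multiplicative_large_sieve_single:
  assumes "q > 0" "E \<subseteq> primitive_dirichlet_characters q" "finite E"
  shows "(\<Sum>\<chi>\<in>E. (cmod (\<Sum>n\<in>{M..<M+N}. x n * \<chi> n))\<^sup>2) \<le> 12 * (real q + real N) * (\<Sum>n\<in>{M..<M+N}. (cmod (x n))\<^sup>2)"
proof -
  have "(\<Sum>\<chi>\<in>E. (cmod (\<Sum>n\<in>{M..<M+N}. x n * \<chi> n))\<^sup>2)
     \<le> (\<Sum>a\<in>units_mod q. (cmod (\<Sum>n\<in>{M..<M+N}. x n * unit_circle (real n * (real a / real q))))\<^sup>2)"
    using assms by (intro primitive_character_sum_le) auto
  also have "\<dots> \<le> 12 * (real q + real N) * (\<Sum>n\<in>{M..<M+N}. (cmod (x n))\<^sup>2)"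
  proof (rule additive_large_sieve)
    fix a b k assume ab: "a \<in> units_mod q" "b \<in> units_mod q" "a \<noteq> b"
    have "int a - int b - k * int q \<noteq> 0"
    proof
      assume "int a - int b - k * int q = 0"
      then have "int a = int b + k * int q" by simp
      then have "[a = b] (mod q)" by (metis cong_int_iff cong_iff_lin cong_sym mult.commute)
      then show False using ab by (simp add: units_mod_def cong_def)
    qed
    then have "1 \<le> \<bar>int a - int b - k * int q\<bar>" by linarith
    then have "1 \<le> \<bar>real_of_int (int a - int b - k * int q)\<bar>" by linarith
    moreover have "real a / real q - real b / real q - of_int k = of_int (int a - int b - k * int q) / real q"
      using assms by (simp add: field_simps)
    ultimately show "1 / real q \<le> \<bar>real a / real q - real b / real q - of_int k\<bar>"
      using assms by (simp add: divide_right_mono)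
  qed (use assms in auto)
  finally show ?thesis .
qed

section \<open>Primes in dyadic blocks\<close>

definition prime_block :: "nat \<Rightarrow> nat set" where
  "prime_block j = {p. prime p \<and> 2 ^ j < p \<and> p \<le> 2 ^ Suc j}"

lemma finite_prime_block [simp]: "finite (prime_block j)"
  by (rule finite_subset[of _ "{..2 ^ Suc j}"]) (auto simp: prime_block_def)

lemma prime_block_bounds:
  assumes "p \<in> prime_block j"
  shows "2 ^ j < real p" "real p \<le> 2 * 2 ^ j" "prime p" "real p > 1"
proof -
  have "2 ^ j < p" "p \<le> 2 ^ Suc j" "prime p" using assms by (auto simp: prime_block_def)
  then have "real (2 ^ j) < real p" "real p \<le> real (2 ^ Suc j)" "p > 1"
    by (simp_all only: of_nat_less_iff of_nat_le_iff prime_gt_1_nat)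
  then show "2 ^ j < real p" "real p \<le> 2 * 2 ^ j" "prime p" "real p > 1"
    using \<open>prime p\<close> by auto
qed

lemma prime_block_disjoint:
  assumes "p \<in> prime_block i" "p \<in> prime_block j"
  shows "i = j"
proof -
  have *: "\<not> i < j" if "p \<in> prime_block i" "p \<in> prime_block j" for i j
  proof
    assume "i < j"
    then have "(2::nat) ^ Suc i \<le> 2 ^ j" by (intro power_increasing) auto
    then show False using that by (auto simp: prime_block_def)
  qed
  show ?thesis using *[of i j] *[of j i] assms by auto
qed

lemma primes_between_powers:
  assumes "i \<le> j"
  shows "{p. prime p \<and> 2 ^ i < p \<and> p \<le> 2 ^ j} = (\<Union>k\<in>{i..<j}. prime_block k)"
  using assms
proof (induction j rule: dec_induct)
  case base
  then show ?case by auto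
next
  case (step j)
  have "(2::nat) ^ i < x" if "2 ^ j < x" for x
    using that power_increasing[OF step(1), of "2::nat"] by linarith
  then have "{p. prime p \<and> 2 ^ i < p \<and> p \<le> 2 ^ Suc j} = {p. prime p \<and> 2 ^ i < p \<and> p \<le> 2 ^ j} \<union> prime_block j"
    by (auto simp: prime_block_def)
  also have "\<dots> = (\<Union>k\<in>{i..<j}. prime_block k) \<union> prime_block j" using step by simp
  also have "\<dots> = (\<Union>k\<in>{i..<Suc j}. prime_block k)"
    using step by (auto simp: less_Suc_eq)
  finally show ?case .
qed

lemma sum_primes_between_powers:
  assumes "i \<le> j"
  shows "(\<Sum>p | prime p \<and> 2 ^ i < p \<and> p \<le> 2 ^ j. g p) = (\<Sum>k=i..<j. \<Sum>p\<in>prime_block k. g p)"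
  unfolding primes_between_powers[OF assms]
  using prime_block_disjoint by (intro sum.UNION_disjoint) auto

lemma prod_pairwise_coprime_dvd:
  fixes m :: nat
  assumes "finite A" "\<And>p. p \<in> A \<Longrightarrow> p dvd m" "\<And>p q. p \<in> A \<Longrightarrow> q \<in> A \<Longrightarrow> p \<noteq> q \<Longrightarrow> coprime p q"
  shows "\<Prod>A dvd m"
  using assms
proof (induction A rule: finite_induct)
  case (insert p A)
  then have "coprime p (\<Prod>A)" by (intro prod_coprime_right) auto
  then show ?case using insert by (simp add: divides_mult)
qed auto

text \<open>With \<open>n = 2^j\<close>, every prime in \<open>(n, 2 n]\<close> divides the binomial
  coefficient of \<open>2 n\<close> over \<open>n\<close>, which is at most
  \<open>2^(2 n)\<close>.\<close>

lemma chebyshev_prime_block: "(\<Sum>p\<in>prime_block j. ln (real p)) \<le> 2 * 2 ^ j * ln 2"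
proof -
  define n :: nat where "n = 2 ^ j"
  have dvd: "\<Prod>(prime_block j) dvd (2 * n) choose n"
  proof (rule prod_pairwise_coprime_dvd)
    fix p assume p: "p \<in> prime_block j"
    then have "prime p" "n < p" "p \<le> 2 * n" by (auto simp: prime_block_def n_def)
    have "(fact (2 * n) :: nat) = fact n * fact n * (2 * n choose n)"
      using binomial_fact_lemma[of n "2*n"] by (simp add: mult_ac)
    moreover have "p dvd fact (2 * n)" using \<open>p \<le> 2 * n\<close> \<open>prime p\<close> by (simp add: prime_dvd_fact_iff)
    moreover have "\<not> p dvd fact n" using \<open>n < p\<close> \<open>prime p\<close> by (simp add: prime_dvd_fact_iff)
    ultimately show "p dvd (2 * n choose n)" using \<open>prime p\<close> by (simp add: prime_dvd_mult_iff)
  next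
    fix p q assume "p \<in> prime_block j" "q \<in> prime_block j" "p \<noteq> q"
    then show "coprime p q" by (simp add: prime_block_def primes_coprime)
  qed simp
  have "\<Prod>(prime_block j) \<le> (2 * n) choose n"
    using dvd by (intro dvd_imp_le) auto
  also have "\<dots> \<le> 2 ^ (2 * n)" by (rule binomial_le_pow2)
  finally have "real (\<Prod>(prime_block j)) \<le> 2 ^ (2 * n)"
    by (metis of_nat_le_iff of_nat_numeral of_nat_power)
  moreover have pos: "real p > 0" if "p \<in> prime_block j" for p
    using that prime_block_bounds(4)[of p j] by simp
  then have "0 < (\<Prod>p\<in>prime_block j. real p)" by (intro prod_pos) auto
  ultimately have "ln (\<Prod>p\<in>prime_block j. real p) \<le> ln (2 ^ (2 * n))"
    by (subst ln_le_cancel_iff) auto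
  also have "\<dots> = 2 * 2 ^ j * ln 2" by (simp add: ln_realpow n_def)
  also have "ln (\<Prod>p\<in>prime_block j. real p) = (\<Sum>p\<in>prime_block j. ln (real p))"
    using pos by (intro ln_prod) force+
  finally show ?thesis .
qed

text \<open>Each prime of the block has logarithm at least \<open>j ln 2\<close>. Written as a
  product, the bound needs no exception for \<open>j = 0\<close>.\<close>

lemma card_prime_block_le:
  shows "real (card (prime_block j)) * real j \<le> 2 * 2 ^ j"
proof -
  have "real (card (prime_block j)) * (real j * ln 2) = (\<Sum>p\<in>prime_block j. ln (2 ^ j))"
    by (simp add: ln_realpow)
  also have "\<dots> \<le> (\<Sum>p\<in>prime_block j. ln (real p))"
  proof (intro sum_mono)
    fix p assume "p \<in> prime_block j"
    then show "ln (2 ^ j) \<le> ln (real p)" using prime_block_bounds[of p j] by simp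
  qed
  also have "\<dots> \<le> 2 * 2 ^ j * ln 2" by (rule chebyshev_prime_block)
  finally have "(real (card (prime_block j)) * real j) * ln 2 \<le> (2 * 2 ^ j) * ln 2"
    by (simp add: mult_ac)
  then show ?thesis by (rule mult_right_le_imp_le) simp
qed

section \<open>Mertens' theorems along powers of two\<close>

lemma sum_mangoldt_div:
  "(\<Sum>d=1..N. mangoldt d * real (N div d)) = (\<Sum>n=1..N. ln (real n))"
proof -
  have "(\<Sum>n=1..N. ln (real n)) = (\<Sum>n=1..N. \<Sum>d | d \<in> {1..N} \<and> d dvd n. mangoldt d)"
  proof (intro sum.cong refl)
    fix n assume n: "n \<in> {1..N}"
    then have "{d. d \<in> {1..N} \<and> d dvd n} = {d. d dvd n}"
      by (auto dest: dvd_imp_le intro: Suc_leI dvd_pos_nat)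
    then show "ln (real n) = (\<Sum>d | d \<in> {1..N} \<and> d dvd n. mangoldt d)"
      using mangoldt_sum[of n, where ?'a = real] n by simp
  qed
  also have "\<dots> = (\<Sum>d=1..N. \<Sum>n | n \<in> {1..N} \<and> d dvd n. mangoldt d)"
    by (rule sum.swap_restrict) auto
  also have "\<dots> = (\<Sum>d=1..N. mangoldt d * real (N div d))"
  proof (intro sum.cong refl)
    fix d assume d: "d \<in> {1..N}"
    have "{n. n \<in> {1..N} \<and> d dvd n} = (\<lambda>k. d * k) ` {1..N div d}"
    proof (intro equalityI subsetI)
      fix n assume n: "n \<in> {n. n \<in> {1..N} \<and> d dvd n}"
      then obtain k where k: "n = d * k" by auto
      then have "k \<ge> 1" using n by (cases k) auto
      moreover have "k \<le> N div d" using n k d by (simp add: less_eq_div_iff_mult_less_eq mult.commute)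
      ultimately show "n \<in> (\<lambda>k. d * k) ` {1..N div d}" using k by auto
    next
      fix n assume "n \<in> (\<lambda>k. d * k) ` {1..N div d}"
      then obtain k where "n = d * k" "k \<in> {1..N div d}" by blast
      then show "n \<in> {n. n \<in> {1..N} \<and> d dvd n}"
        using d by (auto simp: less_eq_div_iff_mult_less_eq mult.commute)
    qed
    moreover have "inj_on (\<lambda>k. d * k) {1..N div d}" using d by (auto simp: inj_on_def)
    ultimately have "card {n. n \<in> {1..N} \<and> d dvd n} = N div d" by (simp add: card_image)
    then show "(\<Sum>n | n \<in> {1..N} \<and> d dvd n. mangoldt d) = mangoldt d * real (N div d)" by simp
  qed
  finally show ?thesis ..
qed

lemma sum_ln_ge: "N * ln (real N) - N \<le> (\<Sum>n=1..N. ln (real n))"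
proof (induction N)
  case (Suc N)
  show ?case
  proof (cases "N = 0")
    case False
    have "ln (1 + 1 / real N) \<le> 1 / real N" by (rule ln_add_one_self_le_self) simp
    moreover have "real (Suc N) = real N * (1 + 1 / real N)" using False by (simp add: field_simps)
    then have "ln (real (Suc N)) = ln (real N) + ln (1 + 1 / real N)"
      using False by (simp only: ln_mult_pos of_nat_0_less_iff add_pos_nonneg zero_less_one divide_nonneg_nonneg of_nat_0_le_iff)
    ultimately have "real N * ln (real (Suc N)) \<le> real N * ln (real N) + 1"
      using False by (simp add: field_simps)
    then show ?thesis using Suc by (simp add: algebra_simps)
  qed auto
qed auto

lemma sum_ln_le: "(\<Sum>n=1..N. ln (real n)) \<le> N * ln (real N)"
proof -
  have "(\<Sum>n=1..N. ln (real n)) \<le> (\<Sum>n=1..N. ln (real N))" by (intro sum_mono) auto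
  then show ?thesis by simp
qed

lemma theta_power_of_two_le: "(\<Sum>p | prime p \<and> p \<le> 2 ^ k. ln (real p)) \<le> 2 * 2 ^ k * ln 2"
proof -
  have "{p. prime p \<and> p \<le> (2::nat) ^ k} = {p. prime p \<and> 2 ^ 0 < p \<and> p \<le> 2 ^ k}"
    by (auto simp: prime_gt_1_nat prime_gt_Suc_0_nat)
  then have "(\<Sum>p | prime p \<and> p \<le> 2 ^ k. ln (real p)) = (\<Sum>j=0..<k. \<Sum>p\<in>prime_block j. ln (real p))"
    using sum_primes_between_powers[of 0 k "\<lambda>p. ln (real p)"] by simp
  also have "\<dots> \<le> (\<Sum>j=0..<k. 2 * 2 ^ j * ln 2)"
    by (intro sum_mono chebyshev_prime_block)
  also have "\<dots> = 2 * ln 2 * (\<Sum>j=0..<k. 2 ^ j)" by (simp add: sum_distrib_left mult_ac)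
  also have "(\<Sum>j=0..<k. (2::real) ^ j) = 2 ^ k - 1"
    by (induction k) auto
  also have "2 * ln 2 * (2 ^ k - 1) \<le> 2 * 2 ^ k * ln (2::real)" by (simp add: algebra_simps)
  finally show ?thesis .
qed

definition block_mertens :: "nat \<Rightarrow> real" where
  "block_mertens i = (\<Sum>p\<in>prime_block i. ln (real p) / real p)"

lemma sum_block_mertens:
  "(\<Sum>i<k. block_mertens i) = (\<Sum>p | prime p \<and> p \<le> 2 ^ k. ln (real p) / real p)"
proof -
  have "{p. prime p \<and> p \<le> (2::nat) ^ k} = {p. prime p \<and> 2 ^ 0 < p \<and> p \<le> 2 ^ k}"
    by (auto simp: prime_gt_1_nat prime_gt_Suc_0_nat)
  then show ?thesis
    using sum_primes_between_powers[of 0 k "\<lambda>p. ln (real p) / real p"]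
    by (simp add: block_mertens_def lessThan_atLeast0)
qed

text \<open>This compares with \<open>log N!\<close> for \<open>N = 2^k\<close>, written as the sum
  of \<open>mangoldt d * (N div d)\<close>. Dropping the floor at the primes costs the sum of their
  logarithms, which is \<open>O(N)\<close> by Chebyshev's bound.\<close>

lemma sum_block_mertens_le: "(\<Sum>i<k. block_mertens i) \<le> k * ln 2 + 2 * ln 2"
proof -
  define N :: nat where "N = 2 ^ k"
  have N: "N > 0" "ln (real N) = k * ln 2" by (simp_all add: N_def ln_realpow)
  define P where "P = {p. prime p \<and> p \<le> N}"
  have P: "P \<subseteq> {1..N}" by (auto simp: P_def Suc_le_eq prime_gt_0_nat)
  have fin: "finite P" using P by (rule finite_subset) simp
  have "N * (\<Sum>i<k. block_mertens i) = (\<Sum>p\<in>P. ln (real p) * (real N / real p))"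
    unfolding sum_block_mertens by (simp add: P_def N_def sum_distrib_left mult_ac)
  also have "\<dots> \<le> (\<Sum>p\<in>P. ln (real p) * (real (N div p) + 1))"
  proof (intro sum_mono mult_left_mono)
    fix p assume "p \<in> P"
    then have "p \<ge> 1" using P by auto
    then show "0 \<le> ln (real p)" by simp
    show "real N / real p \<le> real (N div p) + 1"
      using floor_divide_of_nat_eq[of N p, where ?'a = real] by linarith
  qed
  also have "\<dots> = (\<Sum>p\<in>P. mangoldt p * real (N div p)) + (\<Sum>p\<in>P. ln (real p))"
    by (simp add: distrib_left sum.distrib P_def)
  also have "(\<Sum>p\<in>P. mangoldt p * real (N div p)) \<le> (\<Sum>d=1..N. mangoldt d * real (N div d))"
    using P by (intro sum_mono2) (auto simp: mangoldt_nonneg)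
  also have "\<dots> \<le> N * (k * ln 2)"
    unfolding sum_mangoldt_div using sum_ln_le[of N] N by simp
  also have "(\<Sum>p\<in>P. ln (real p)) \<le> 2 * N * ln 2"
    using theta_power_of_two_le[of k] by (simp add: P_def N_def)
  finally have "N * (\<Sum>i<k. block_mertens i) \<le> N * (k * ln 2 + 2 * ln 2)" by (simp add: algebra_simps)
  then show ?thesis using N by simp
qed

lemma sum_power_ge_2_le:
  fixes x :: real
  assumes "0 \<le> x" "x \<le> 1/2"
  shows "(\<Sum>i=2..n. x ^ i) \<le> 2 * x\<^sup>2"
proof (cases "n \<ge> 1")
  case True
  \<comment> \<open>The added term bounds the rest of the series and makes the claim
    inductive.\<close>
  then have "(\<Sum>i=2..n. x ^ i) + 2 * x ^ Suc n \<le> 2 * x\<^sup>2"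
  proof (induction n rule: nat_induct_at_least)
    case base
    then show ?case by (simp add: power2_eq_square)
  next
    case (Suc n)
    have "2 * x ^ Suc (Suc n) \<le> x ^ Suc n"
      using assms mult_right_mono[of "2 * x" 1 "x ^ Suc n"] by simp
    then show ?case using Suc by (simp add: sum.nat_ivl_Suc')
  qed
  then show ?thesis using assms by (smt (verit) zero_le_power)
qed auto

text \<open>The powers from the second on of one prime \<open>p\<close> contribute at most
  \<open>2 ln p / p^2\<close>. By Chebyshev's bound block \<open>j\<close> then contributes at most
  \<open>4 ln 2 / 2^j\<close>, and the geometric series gives \<open>8 ln 2\<close>.\<close>

lemma sum_mangoldt_nonprime_le:
  "(\<Sum>d | d \<in> {1..2 ^ k} \<and> \<not> prime d. mangoldt d / real d) \<le> 8 * ln 2"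
proof -
  define N :: nat where "N = 2 ^ k"
  define P where "P = {p. prime p \<and> p \<le> N}"
  define S where "S = {d. d \<in> {1..N} \<and> primepow d \<and> \<not> prime d}"
  have fin: "finite P" by (simp add: P_def)
  have "S \<subseteq> (\<lambda>(p, i). p ^ i) ` (P \<times> {2..N})"
  proof
    fix d assume d: "d \<in> S"
    then obtain p i where pi: "prime p" "i > 0" "d = p ^ i"
      by (auto simp: S_def primepow_def)
    have "i \<noteq> 1" using pi d by (auto simp: S_def)
    then have i2: "i \<ge> 2" using pi by linarith
    have "p \<le> p ^ i" using pi prime_gt_0_nat[of p] by (intro self_le_power) auto
    moreover have "i < p ^ i" using pi prime_gt_1_nat[of p] by (intro power_gt_expt) auto
    moreover have "p ^ i \<le> N" using d pi by (simp add: S_def)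
    ultimately have "p \<in> P" "i \<le> N" using pi by (auto simp: P_def)
    then show "d \<in> (\<lambda>(p, i). p ^ i) ` (P \<times> {2..N})" using pi i2 by force
  qed
  have "(\<Sum>d | d \<in> {1..N} \<and> \<not> prime d. mangoldt d / real d) = (\<Sum>d\<in>S. mangoldt d / real d)"
    by (intro sum.mono_neutral_right) (auto simp: S_def mangoldt_def)
  also have "\<dots> \<le> (\<Sum>d\<in>(\<lambda>(p, i). p ^ i) ` (P \<times> {2..N}). mangoldt d / real d)"
    using fin \<open>S \<subseteq> _\<close> by (intro sum_mono2) (auto simp: mangoldt_nonneg)
  also have "\<dots> \<le> (\<Sum>(p, i)\<in>P \<times> {2..N}. mangoldt (p ^ i) / real (p ^ i))"
    using fin by (intro order_trans[OF sum_image_le]) (auto simp: mangoldt_nonneg case_prod_unfold o_def)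
  also have "\<dots> = (\<Sum>p\<in>P. ln (real p) * (\<Sum>i=2..N. (1 / real p) ^ i))"
    unfolding sum.cartesian_product[symmetric] sum_distrib_left
    by (intro sum.cong refl) (auto simp: P_def power_divide)
  also have "\<dots> \<le> (\<Sum>p\<in>P. ln (real p) * (2 * (1 / real p)\<^sup>2))"
  proof (intro sum_mono mult_left_mono sum_power_ge_2_le)
    fix p assume "p \<in> P"
    then have "p \<ge> 2" by (simp add: P_def prime_ge_2_nat)
    then show "1 / real p \<le> 1 / 2" "0 \<le> ln (real p)" by (auto simp: field_simps)
  qed auto
  also have "\<dots> = (\<Sum>j=0..<k. \<Sum>p\<in>prime_block j. ln (real p) * (2 * (1 / real p)\<^sup>2))"
  proof -
    have "P = {p. prime p \<and> 2 ^ 0 < p \<and> p \<le> 2 ^ k}"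
      by (auto simp: P_def N_def prime_gt_1_nat prime_gt_Suc_0_nat)
    then show ?thesis using sum_primes_between_powers[of 0 k "\<lambda>p. ln (real p) * (2 * (1 / real p)\<^sup>2)"] by simp
  qed
  also have "\<dots> \<le> (\<Sum>j=0..<k. 4 * ln 2 * (1 / 2) ^ j)"
  proof (rule sum_mono)
    fix j
    have "(\<Sum>p\<in>prime_block j. ln (real p) * (2 * (1 / real p)\<^sup>2)) \<le> (\<Sum>p\<in>prime_block j. ln (real p) * (2 * (1 / 2 ^ j)\<^sup>2))"
    proof (intro sum_mono mult_left_mono power_mono)
      fix p assume "p \<in> prime_block j"
      then show "1 / real p \<le> 1 / 2 ^ j" "0 \<le> ln (real p)"
        using prime_block_bounds[of p j] by (auto intro!: divide_left_mono)
    qed auto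
    also have "\<dots> \<le> (2 * 2 ^ j * ln 2) * (2 * (1 / 2 ^ j)\<^sup>2)"
      unfolding sum_distrib_right[symmetric] by (intro mult_right_mono chebyshev_prime_block) auto
    also have "\<dots> = 4 * ln 2 * (1 / 2) ^ j"
      by (simp add: power2_eq_square field_simps)
    finally show "(\<Sum>p\<in>prime_block j. ln (real p) * (2 * (1 / real p)\<^sup>2)) \<le> 4 * ln 2 * (1 / 2) ^ j" .
  qed
  also have "\<dots> = 4 * ln 2 * (2 - 2 * (1 / 2) ^ k)"
  proof -
    have "(\<Sum>j=0..<k. (1/2 :: real) ^ j) = 2 - 2 * (1/2) ^ k" by (induction k) auto
    then show ?thesis by (simp add: sum_distrib_left[symmetric])
  qed
  also have "\<dots> \<le> 8 * ln 2" by (simp add: algebra_simps)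
  finally show ?thesis by (simp add: N_def)
qed

text \<open>The same comparison with \<open>log N!\<close> from the other side: \<open>1\<close>
  comes from the crude Stirling bound and \<open>8 ln 2\<close> from the proper prime
  powers.\<close>

lemma sum_block_mertens_ge: "k * ln 2 - (1 + 8 * ln 2) \<le> (\<Sum>i<k. block_mertens i)"
proof -
  define N :: nat where "N = 2 ^ k"
  have N: "N > 0" "ln (real N) = k * ln 2" by (simp_all add: N_def ln_realpow)
  define P where "P = {p. prime p \<and> p \<le> N}"
  have P: "{d. d \<in> {1..N} \<and> prime d} = P" by (auto simp: P_def Suc_le_eq prime_gt_0_nat)
  have "N * (k * ln 2) - N \<le> (\<Sum>d=1..N. mangoldt d * real (N div d))"
    unfolding sum_mangoldt_div using sum_ln_ge[of N] N by simp
  also have "\<dots> \<le> (\<Sum>d=1..N. N * (mangoldt d / real d))"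
  proof (rule sum_mono)
    fix d
    have "mangoldt d * real (N div d) \<le> mangoldt d * (real N / real d)"
      by (intro mult_left_mono of_nat_div_le_of_nat mangoldt_nonneg)
    then show "mangoldt d * real (N div d) \<le> N * (mangoldt d / real d)" by (simp add: mult_ac)
  qed
  also have "\<dots> = N * (\<Sum>d=1..N. mangoldt d / real d)" by (simp add: sum_distrib_left)
  also have "(\<Sum>d=1..N. mangoldt d / real d) = (\<Sum>d | d \<in> {1..N} \<and> prime d. mangoldt d / real d) + (\<Sum>d | d \<in> {1..N} \<and> \<not> prime d. mangoldt d / real d)"
    by (subst sum.union_disjoint[symmetric]) (auto intro!: sum.cong)
  also have "(\<Sum>d | d \<in> {1..N} \<and> prime d. mangoldt d / real d) = (\<Sum>i<k. block_mertens i)"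
    unfolding P sum_block_mertens by (intro sum.cong) (auto simp: P_def N_def)
  also have "N * ((\<Sum>i<k. block_mertens i) + (\<Sum>d | d \<in> {1..N} \<and> \<not> prime d. mangoldt d / real d))
      \<le> N * ((\<Sum>i<k. block_mertens i) + 8 * ln 2)"
    unfolding N_def by (intro mult_left_mono add_left_mono sum_mangoldt_nonprime_le) simp
  finally have "N * (k * ln 2) - N \<le> N * ((\<Sum>i<k. block_mertens i) + 8 * ln 2)" .
  then have "N * (k * ln 2 - (1 + 8 * ln 2)) \<le> N * (\<Sum>i<k. block_mertens i)" by (simp add: algebra_simps)
  then show ?thesis using N by simp
qed

text \<open>Abel summation against the error term \<open>E\<close> of Mertens' first theorem.\<close>

lemma abel_harmonic_le:
  fixes E :: "nat \<Rightarrow> real"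
  assumes "\<And>k. \<bar>E k\<bar> \<le> C" "1 \<le> j" "j \<le> J"
  shows "E J / J - 2 * C + C / J \<le> (\<Sum>k=j..<J. (E (Suc k) - E k) / Suc k)"
  using assms(3)
proof (induction J rule: dec_induct)
  case base
  have "C \<ge> 0" using assms(1)[of 0] by linarith
  then have "C / j \<le> C" "E j / j \<le> C / j"
    using assms mult_left_mono[of 1 "real j" C] by (auto simp: field_simps abs_le_iff)
  then show ?case by simp
next
  case (step J)
  have J: "real J > 0" using step assms by simp
  \<comment> \<open>The lower bounds \<open>- C (1 / J - 1 / (J + 1))\<close> telescope; the term
    \<open>C / J\<close> in the claim records what is still unspent.\<close>
  have "(- C) * (1 / J - 1 / Suc J) \<le> E J * (1 / J - 1 / Suc J)"
    using J assms(1)[of J] by (intro mult_right_mono) (auto simp: field_simps)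
  then have "E (Suc J) / Suc J - 2 * C + C / Suc J \<le> (E J / J - 2 * C + C / J) + (E (Suc J) - E J) / Suc J"
    by (simp add: algebra_simps diff_divide_distrib)
  then show ?case using step by simp
qed

lemma sum_harmonic_ge:
  assumes "j \<le> J"
  shows "ln ((real J + 1) / (real j + 1)) \<le> (\<Sum>k=j..<J. 1 / Suc k)"
  using assms
proof (induction J rule: dec_induct)
  case (step J)
  have "ln ((real (Suc J) + 1) / (real j + 1)) = ln ((real J + 1) / (real j + 1)) + ln (1 + 1 / Suc J)"
  proof (subst ln_mult_pos[symmetric])
    show "ln ((real (Suc J) + 1) / (real j + 1)) = ln ((real J + 1) / (real j + 1) * (1 + 1 / Suc J))"
    proof (rule arg_cong[of _ _ ln])
      have "1 + 1 / Suc J = (real (Suc J) + 1) / (real J + 1)" by (simp add: field_simps)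
      then show "(real (Suc J) + 1) / (real j + 1) = (real J + 1) / (real j + 1) * (1 + 1 / Suc J)"
        by (simp add: add_nonneg_eq_0_iff)
    qed
  qed (auto intro: add_pos_nonneg)
  also have "ln (1 + 1 / real (Suc J)) \<le> 1 / Suc J" by (rule ln_add_one_self_le_self) simp
  finally show ?case using step by simp
qed auto

text \<open>In block \<open>k\<close> one has \<open>ln p <= (k + 1) ln 2\<close>, so
  \<open>1 / p\<close> is at least \<open>ln p / p\<close> divided by \<open>(k + 1) ln 2\<close>.
  Mertens' first theorem supplies \<open>ln 2\<close> per block on average, which yields the
  harmonic sum; partial summation bounds the effect of the error \<open>E\<close> by
  \<open>3 C\<close>.\<close>

lemma sum_inverse_primes_blocks_ge:
  obtains C where "\<And>j J. 1 \<le> j \<Longrightarrow> j \<le> J \<Longrightarrow>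
    ln ((real J + 1) / (real j + 1)) - C \<le> (\<Sum>k=j..<J. \<Sum>p\<in>prime_block k. 1 / real p)"
proof -
  define C where "C = 1 + 8 * ln (2::real)"
  define E where "E k = (\<Sum>i<k. block_mertens i) - k * ln 2" for k
  have C0: "C > 0" by (simp add: C_def add_pos_pos)
  have E: "\<bar>E k\<bar> \<le> C" for k
    using sum_block_mertens_le[of k] sum_block_mertens_ge[of k] ln_gt_zero[of "2::real"]
    by (simp add: E_def C_def abs_le_iff)
  have *: "ln ((real J + 1) / (real j + 1)) - (3 * C / ln 2) \<le> (\<Sum>k=j..<J. \<Sum>p\<in>prime_block k. 1 / real p)"
    if "1 \<le> j" "j \<le> J" for j J
  proof -
    have J: "real J \<ge> 1" using that by simp
    have "C * 1 \<le> C * real J" using J C0 by (intro mult_left_mono) auto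
    then have "- (C * real J) \<le> E J" using E[of J] by linarith
    then have "- C \<le> E J / J" using J by (simp add: field_simps)
    moreover have "0 \<le> C / J" using C0 by simp
    ultimately have "- (3 * C) \<le> E J / J - 2 * C + C / J" by linarith
    also have "\<dots> \<le> (\<Sum>k=j..<J. (E (Suc k) - E k) / Suc k)"
      by (rule abel_harmonic_le[OF E that])
    finally have 1: "- (3 * C) \<le> (\<Sum>k=j..<J. (E (Suc k) - E k) / Suc k)" .
    have "ln 2 * ln ((real J + 1) / (real j + 1)) \<le> ln 2 * (\<Sum>k=j..<J. 1 / Suc k)"
      by (intro mult_left_mono sum_harmonic_ge that) simp
    then have "ln 2 * ln ((real J + 1) / (real j + 1)) - 3 * C \<le> (\<Sum>k=j..<J. ln 2 / Suc k + (E (Suc k) - E k) / Suc k)"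
      using 1 by (simp add: sum.distrib sum_distrib_left)
    also have "\<dots> = (\<Sum>k=j..<J. block_mertens k / Suc k)"
      by (intro sum.cong refl) (simp add: E_def add_divide_distrib[symmetric] algebra_simps)
    also have "\<dots> \<le> (\<Sum>k=j..<J. ln 2 * (\<Sum>p\<in>prime_block k. 1 / real p))"
    proof (rule sum_mono)
      fix k
      have "block_mertens k \<le> (\<Sum>p\<in>prime_block k. (Suc k * ln 2) * (1 / real p))"
        unfolding block_mertens_def
      proof (rule sum_mono)
        fix p assume p: "p \<in> prime_block k"
        have "ln (real p) \<le> ln (2 ^ Suc k)"
          using prime_block_bounds[OF p] by (subst ln_le_cancel_iff) auto
        also have "\<dots> = Suc k * ln 2" by (simp add: ln_realpow del: power_Suc)
        finally show "ln (real p) / real p \<le> (Suc k * ln 2) * (1 / real p)"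
          by (simp add: divide_right_mono)
      qed
      then have "block_mertens k \<le> (ln 2 * (\<Sum>p\<in>prime_block k. 1 / real p)) * Suc k"
        unfolding sum_distrib_left[symmetric] by (simp only: mult_ac)
      then show "block_mertens k / Suc k \<le> ln 2 * (\<Sum>p\<in>prime_block k. 1 / real p)"
        by (subst pos_divide_le_eq) auto
    qed
    finally have "ln 2 * (ln ((real J + 1) / (real j + 1)) - 3 * C / ln 2) \<le> ln 2 * (\<Sum>k=j..<J. \<Sum>p\<in>prime_block k. 1 / real p)"
      by (simp add: sum_distrib_left[symmetric] right_diff_distrib)
    then show ?thesis by simp
  qed
  then show ?thesis by (intro that) auto
qed

text \<open>\<open>1 - x <= exp (- x)\<close> turns the lower bound for the sum of
  \<open>1 / p\<close> into an upper bound for the product. The factor \<open>2\<close> comes from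
  \<open>j + 1 <= 2 j\<close>.\<close>

lemma prod_primes_between_powers_le:
  obtains C where "C > 0" "\<And>j J. 1 \<le> j \<Longrightarrow> j \<le> J \<Longrightarrow>
    (\<Prod>p | prime p \<and> 2 ^ j < p \<and> p \<le> 2 ^ J. 1 - 1 / real p) \<le> C * (real j / real J)"
proof -
  obtain C where C: "\<And>j J. 1 \<le> j \<Longrightarrow> j \<le> J \<Longrightarrow>
    ln ((real J + 1) / (real j + 1)) - C \<le> (\<Sum>k=j..<J. \<Sum>p\<in>prime_block k. 1 / real p)"
    using sum_inverse_primes_blocks_ge by blast
  have "(\<Prod>p | prime p \<and> 2 ^ j < p \<and> p \<le> 2 ^ J. 1 - 1 / real p) \<le> (2 * exp C) * (real j / real J)"
    if jJ: "1 \<le> j" "j \<le> J" for j J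
  proof -
    define P where "P = {p. prime p \<and> (2::nat) ^ j < p \<and> p \<le> 2 ^ J}"
    have "(\<Prod>p\<in>P. 1 - 1 / real p) \<le> (\<Prod>p\<in>P. exp (- (1 / real p)))"
    proof (intro prod_mono conjI)
      fix p assume "p \<in> P"
      then have "real p > 1" by (auto simp: P_def prime_gt_Suc_0_nat)
      then show "0 \<le> 1 - 1 / real p" by simp
      show "1 - 1 / real p \<le> exp (- (1 / real p))" using exp_ge_add_one_self[of "- (1 / real p)"] by simp
    qed
    also have "\<dots> = exp (- (\<Sum>p\<in>P. 1 / real p))"
      by (subst sum_negf[symmetric], subst exp_sum) (auto simp: P_def)
    also have "\<dots> \<le> exp (C - ln ((real J + 1) / (real j + 1)))"
      using C[OF jJ] sum_primes_between_powers[OF jJ(2), of "\<lambda>p. 1 / real p"] by (simp add: P_def)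
    also have "\<dots> = exp C * ((real j + 1) / (real J + 1))"
      by (subst exp_diff) (simp add: add_pos_nonneg)
    also have "(real j + 1) / (real J + 1) \<le> 2 * (real j / real J)"
    proof -
      have "(real j + 1) / (real J + 1) \<le> (2 * real j) / real J"
        using jJ by (intro frac_le) auto
      then show ?thesis by simp
    qed
    finally show ?thesis by (simp add: P_def mult_ac)
  qed
  then show ?thesis by (intro that[of "2 * exp C"]) auto
qed

section \<open>Mean squares over sifted sets\<close>

definition energy :: "(nat \<Rightarrow> complex) \<Rightarrow> nat set \<Rightarrow> real" where
  "energy f A = (\<Sum>n\<in>A. (cmod (f n))\<^sup>2)"

lemma energy_nonneg [simp]: "energy f A \<ge> 0"
  unfolding energy_def by (intro sum_nonneg) auto

lemma energy_mono: "finite B \<Longrightarrow> A \<subseteq> B \<Longrightarrow> energy f A \<le> energy f B"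
  unfolding energy_def by (intro sum_mono2) auto

lemma energy_Un_le: "finite A \<Longrightarrow> finite B \<Longrightarrow> energy f (A \<union> B) \<le> energy f A + energy f B"
  unfolding energy_def by (subst sum_Un) (auto intro!: sum_nonneg)

lemma energy_le_sum_image:
  assumes "finite S" "A \<subseteq> g ` S"
  shows "energy f A \<le> (\<Sum>s\<in>S. (cmod (f (g s)))\<^sup>2)"
proof -
  have "energy f A \<le> energy f (g ` S)" using assms by (intro energy_mono) auto
  also have "\<dots> \<le> (\<Sum>s\<in>S. (cmod (f (g s)))\<^sup>2)"
    unfolding energy_def using sum_image_le[OF assms(1), of "\<lambda>n. (cmod (f n))\<^sup>2" g] by (simp add: o_def)
  finally show ?thesis .
qed

definition nats_upto :: "real \<Rightarrow> nat set" where
  "nats_upto x = {n. 1 \<le> n \<and> real n \<le> x}"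

lemma nats_upto_subset: "nats_upto x \<subseteq> {1..<1 + nat \<lfloor>x\<rfloor>}"
  unfolding nats_upto_def by (auto simp: le_nat_floor less_Suc_eq_le)

lemma finite_nats_upto [simp]: "finite (nats_upto x)"
  using nats_upto_subset by (rule finite_subset) simp

text \<open>Only the primes in the window are excluded; those up to \<open>2^j\<close> and those
  above \<open>2^J\<close> may divide \<open>m\<close>.\<close>

definition rough :: "nat \<Rightarrow> nat \<Rightarrow> nat set" where
  "rough j J = {m. 1 \<le> m \<and> (\<forall>p. prime p \<and> 2 ^ j < p \<and> p \<le> 2 ^ J \<longrightarrow> \<not> p dvd m)}"

lemma roughD: "m \<in> rough j J \<Longrightarrow> p \<in> prime_block i \<Longrightarrow> j \<le> i \<Longrightarrow> i < J \<Longrightarrow> \<not> p dvd m"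
proof -
  assume *: "m \<in> rough j J" "p \<in> prime_block i" "j \<le> i" "i < J"
  have "(2::nat) ^ j \<le> 2 ^ i" "(2::nat) ^ Suc i \<le> 2 ^ J" using * by (intro power_increasing; simp)+
  moreover have "prime p" "2 ^ i < p" "p \<le> 2 ^ Suc i" using *(2) unfolding prime_block_def by blast+
  ultimately have "prime p" "2 ^ j < p" "p \<le> 2 ^ J" by (blast intro: le_less_trans le_trans)+
  then show "\<not> p dvd m" using *(1) unfolding rough_def by blast
qed

lemma rough_dvd: "n \<in> rough j J \<Longrightarrow> m dvd n \<Longrightarrow> m \<in> rough j J"
  unfolding rough_def by (auto intro: dvd_trans Suc_leI dvd_pos_nat)

lemma not_roughD:
  assumes "m \<notin> rough j J" "m \<ge> 1" "j \<le> J"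
  obtains p i where "p \<in> prime_block i" "j \<le> i" "i < J" "p dvd m"
proof -
  obtain p where p: "prime p" "2 ^ j < p" "p \<le> 2 ^ J" "p dvd m"
    using assms(1,2) unfolding rough_def by blast
  then have "p \<in> (\<Union>k\<in>{j..<J}. prime_block k)"
    unfolding primes_between_powers[OF assms(3), symmetric] by blast
  then show ?thesis using that p(4) by auto
qed

definition square_divisible :: "nat \<Rightarrow> nat \<Rightarrow> nat set" where
  "square_divisible J1 J2 = {n. \<exists>j\<in>{J1..<J2}. \<exists>p\<in>prime_block j. p\<^sup>2 dvd n}"

text \<open>The clauses on squares keep \<open>p\<close> and \<open>q\<close> out of the cofactor
  \<open>n / (p q)\<close>, so that \<open>f\<close> factors completely; the integers violating them
  fall under \<open>square_divisible\<close>.\<close>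

definition top_block_pair :: "nat \<Rightarrow> nat \<Rightarrow> nat set" where
  "top_block_pair J1 J2 = {n. \<exists>j\<in>{J1..<J2}. n \<in> rough (Suc j) J2 \<and>
     (\<exists>p\<in>prime_block j. \<exists>q\<in>prime_block j. p \<noteq> q \<and> p dvd n \<and> q dvd n \<and> \<not> p\<^sup>2 dvd n \<and> \<not> q\<^sup>2 dvd n)}"

definition harmonic_between :: "nat \<Rightarrow> nat \<Rightarrow> real" where
  "harmonic_between J1 J2 = (\<Sum>j=J1..<J2. 1 / real j)"

lemma harmonic_between_nonneg [simp]: "harmonic_between J1 J2 \<ge> 0"
  unfolding harmonic_between_def by (intro sum_nonneg) auto

lemma multiplicative_fun_mult:
  "multiplicative_fun f \<Longrightarrow> m \<ge> 1 \<Longrightarrow> n \<ge> 1 \<Longrightarrow> coprime m n \<Longrightarrow> f (m * n) = f m * f n"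
  unfolding multiplicative_fun_def by blast

text \<open>This is what is extracted from (C1) and (C3), with a single constant. The powers of
  \<open>3 / 2\<close> absorb every fixed power of \<open>a + 1\<close> that the divisor bound
  produces, and \<open>3 / (2 p) <= 1 / 2\<close> for \<open>p >= 3\<close> keeps the series over
  prime powers geometric.\<close>

locale tame_multiplicative =
  fixes f :: "nat \<Rightarrow> complex" and K x0 :: real
  assumes mult: "multiplicative_fun f"
    and K: "K \<ge> 1"
    and energy_upto: "\<And>x. x \<ge> 0 \<Longrightarrow> energy f (nats_upto x) \<le> K * x"
    and energy_rough: "\<And>j J x. 2 \<le> j \<Longrightarrow> j \<le> J \<Longrightarrow> 2 ^ J \<le> x \<Longrightarrow> x0 \<le> x \<Longrightarrow>
      energy f (rough j J \<inter> nats_upto x) \<le> K * x * (real j / real J)"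
    and prime_power: "\<And>p a. prime p \<Longrightarrow> (cmod (f (p ^ a)))\<^sup>2 \<le> K * (3 / 2) ^ a"
begin

lemma prime_value: "prime p \<Longrightarrow> (cmod (f p))\<^sup>2 \<le> 3 / 2 * K"
  using prime_power[of p 1] by (simp add: mult.commute)

lemma prime_mult:
  assumes "prime p" "\<not> p dvd m" "m \<ge> 1"
  shows "f (p * m) = f p * f m"
  using assms prime_gt_0_nat[of p]
  by (intro multiplicative_fun_mult[OF mult]) (auto simp: prime_imp_coprime)

text \<open>Write \<open>n = p^a m\<close> with \<open>a >= 2\<close> the exact exponent. The
  mean-square bound for \<open>m <= X / p^a\<close> leaves a geometric series in
  \<open>3 / (2 p)\<close> starting at the second power.\<close>

lemma energy_prime_power_multiples_le:
  assumes p: "prime p" "p \<ge> 3" and X: "X \<ge> 1"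
  shows "energy f (nats_upto X \<inter> {n. p\<^sup>2 dvd n}) \<le> 9 / 2 * K\<^sup>2 * X / (real p)\<^sup>2"
proof -
  define N where "N = nat \<lfloor>X\<rfloor>"
  define S where "S = (SIGMA a:{2..N}. {m \<in> nats_upto (X / real p ^ a). \<not> p dvd m})"
  have fin: "finite S" by (simp add: S_def)
  have sub: "nats_upto X \<inter> {n. p\<^sup>2 dvd n} \<subseteq> (\<lambda>(a, m). p ^ a * m) ` S"
  proof
    fix n assume "n \<in> nats_upto X \<inter> {n. p\<^sup>2 dvd n}"
    then have n: "n \<ge> 1" "real n \<le> X" "p\<^sup>2 dvd n" by (auto simp: nats_upto_def)
    define a where "a = multiplicity p n"
    have fm: "\<not> is_unit p" using p by auto
    obtain m where m: "n = p ^ a * m" "\<not> p dvd m"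
      using multiplicity_decompose'[of n p] n fm unfolding a_def by auto
    have "2 \<le> a" unfolding a_def using n fm by (intro multiplicity_geI) auto
    have "a < p ^ a" using p by (intro power_gt_expt) auto
    also have "p ^ a \<le> n" using n(1) m(1) prime_gt_0_nat[OF p(1)] by (intro dvd_imp_le) auto
    finally have "a \<le> N" using n by (simp add: N_def le_nat_floor)
    have "m \<in> nats_upto (X / real p ^ a)"
      using n m p by (cases m) (auto simp: nats_upto_def field_simps)
    then show "n \<in> (\<lambda>(a, m). p ^ a * m) ` S"
      using m \<open>2 \<le> a\<close> \<open>a \<le> N\<close> by (auto simp: S_def intro!: image_eqI[of _ _ "(a, m)"])
  qed
  have "energy f (nats_upto X \<inter> {n. p\<^sup>2 dvd n}) \<le> (\<Sum>(a, m)\<in>S. (cmod (f (p ^ a * m)))\<^sup>2)"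
    using energy_le_sum_image[OF fin sub, of f] by (simp add: case_prod_unfold)
  also have "\<dots> = (\<Sum>(a, m)\<in>S. (cmod (f (p ^ a)))\<^sup>2 * (cmod (f m))\<^sup>2)"
  proof (intro sum.cong refl, clarify)
    fix a m assume "(a, m) \<in> S"
    then have "f (p ^ a * m) = f (p ^ a) * f m"
      using p prime_gt_0_nat[of p]
      by (intro multiplicative_fun_mult[OF mult]) (auto simp: S_def nats_upto_def prime_imp_coprime)
    then show "(cmod (f (p ^ a * m)))\<^sup>2 = (cmod (f (p ^ a)))\<^sup>2 * (cmod (f m))\<^sup>2"
      by (simp add: norm_mult power_mult_distrib)
  qed
  also have "\<dots> = (\<Sum>a=2..N. (cmod (f (p ^ a)))\<^sup>2 * energy f {m \<in> nats_upto (X / real p ^ a). \<not> p dvd m})"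
    unfolding S_def energy_def by (subst sum.Sigma[symmetric]) (auto simp: sum_distrib_left)
  also have "\<dots> \<le> (\<Sum>a=2..N. (K * (3 / 2) ^ a) * (K * (X / real p ^ a)))"
  proof (intro sum_mono mult_mono)
    fix a
    have "energy f {m \<in> nats_upto (X / real p ^ a). \<not> p dvd m} \<le> energy f (nats_upto (X / real p ^ a))"
      by (intro energy_mono) auto
    also have "\<dots> \<le> K * (X / real p ^ a)" using X by (intro energy_upto) auto
    finally show "energy f {m \<in> nats_upto (X / real p ^ a). \<not> p dvd m} \<le> K * (X / real p ^ a)" .
  qed (use prime_power p K in auto)
  also have "\<dots> = K\<^sup>2 * X * (\<Sum>a=2..N. (3 / 2 / real p) ^ a)"
    by (simp add: sum_distrib_left power2_eq_square power_divide mult_ac)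
  also have "\<dots> \<le> K\<^sup>2 * X * (2 * (3 / 2 / real p)\<^sup>2)"
    using p X K by (intro mult_left_mono sum_power_ge_2_le) (auto simp: field_simps)
  also have "\<dots> = 9 / 2 * K\<^sup>2 * X / (real p)\<^sup>2"
    by (simp add: power2_eq_square)
  finally show ?thesis .
qed

text \<open>A union bound over the primes. Block \<open>j\<close> has at most \<open>2 * 2^j\<close>
  of them, each costing \<open>9/2 * K^2 X / 4^j\<close>, and \<open>j >= 1\<close> excludes the
  prime \<open>2\<close>.\<close>

lemma energy_square_divisible_le:
  assumes "X \<ge> 1" "1 \<le> J1" "J1 \<le> J2"
  shows "energy f (nats_upto X \<inter> square_divisible J1 J2) \<le> 18 * K\<^sup>2 * X / 2 ^ J1"
proof -
  define P where "P = (\<Union>j\<in>{J1..<J2}. prime_block j)"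
  have fin: "finite P" by (simp add: P_def)
  have "energy f (nats_upto X \<inter> square_divisible J1 J2) \<le> (\<Sum>(p, n)\<in>(SIGMA p:P. nats_upto X \<inter> {n. p\<^sup>2 dvd n}). (cmod (f n))\<^sup>2)"
    using energy_le_sum_image[of "SIGMA p:P. nats_upto X \<inter> {n. p\<^sup>2 dvd n}" "nats_upto X \<inter> square_divisible J1 J2" snd f] fin
    by (force simp: square_divisible_def P_def case_prod_unfold image_iff)
  also have "\<dots> = (\<Sum>p\<in>P. energy f (nats_upto X \<inter> {n. p\<^sup>2 dvd n}))"
    unfolding energy_def using fin by (subst sum.Sigma) auto
  also have "\<dots> = (\<Sum>j=J1..<J2. \<Sum>p\<in>prime_block j. energy f (nats_upto X \<inter> {n. p\<^sup>2 dvd n}))"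
    unfolding P_def using prime_block_disjoint by (intro sum.UNION_disjoint) auto
  also have "\<dots> \<le> (\<Sum>j=J1..<J2. 9 * K\<^sup>2 * X * (1 / 2) ^ j)"
  proof (rule sum_mono)
    fix j assume j: "j \<in> {J1..<J2}"
    then have j1: "j \<ge> 1" using assms by simp
    have "(\<Sum>p\<in>prime_block j. energy f (nats_upto X \<inter> {n. p\<^sup>2 dvd n})) \<le> (\<Sum>p\<in>prime_block j. 9 / 2 * K\<^sup>2 * X / (2 ^ j)\<^sup>2)"
    proof (rule sum_mono)
      fix p assume p: "p \<in> prime_block j"
      have "2 ^ 1 \<le> (2::nat) ^ j" using j1 by (intro power_increasing) auto
      then have "p \<ge> 3" using p by (auto simp: prime_block_def)
      then have "energy f (nats_upto X \<inter> {n. p\<^sup>2 dvd n}) \<le> 9 / 2 * K\<^sup>2 * X / (real p)\<^sup>2"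
        using prime_block_bounds[OF p] assms by (intro energy_prime_power_multiples_le) auto
      also have "\<dots> \<le> 9 / 2 * K\<^sup>2 * X / (2 ^ j)\<^sup>2"
        using prime_block_bounds[OF p] assms K by (intro divide_left_mono power_mono mult_pos_pos) auto
      finally show "energy f (nats_upto X \<inter> {n. p\<^sup>2 dvd n}) \<le> 9 / 2 * K\<^sup>2 * X / (2 ^ j)\<^sup>2" .
    qed
    also have "\<dots> = real (card (prime_block j)) * (9 / 2 * K\<^sup>2 * X / (2 ^ j)\<^sup>2)" by simp
    also have "\<dots> \<le> (2 * 2 ^ j) * (9 / 2 * K\<^sup>2 * X / (2 ^ j)\<^sup>2)"
    proof (rule mult_right_mono)
      have "real (card (prime_block j)) * 1 \<le> real (card (prime_block j)) * real j"
        using j1 by (intro mult_left_mono) auto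
      then show "real (card (prime_block j)) \<le> 2 * 2 ^ j" using card_prime_block_le[of j] by simp
    qed (use assms in auto)
    also have "\<dots> = 9 * K\<^sup>2 * X * (1 / 2) ^ j" by (simp add: power2_eq_square field_simps)
    finally show "(\<Sum>p\<in>prime_block j. energy f (nats_upto X \<inter> {n. p\<^sup>2 dvd n})) \<le> 9 * K\<^sup>2 * X * (1 / 2) ^ j" .
  qed
  also have "\<dots> = 9 * K\<^sup>2 * X * (\<Sum>j=J1..<J2. (1 / 2) ^ j)" by (simp add: sum_distrib_left)
  also have "(\<Sum>j=J1..<J2. (1 / 2 :: real) ^ j) = 2 * (1/2) ^ J1 - 2 * (1/2) ^ J2"
    using assms(3) by (induction J2 rule: dec_induct) auto
  also have "9 * K\<^sup>2 * X * (2 * (1/2) ^ J1 - 2 * (1/2) ^ J2) \<le> 9 * K\<^sup>2 * X * (2 * (1/2) ^ J1)"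
    using assms by (intro mult_left_mono) auto
  also have "\<dots> = 18 * K\<^sup>2 * X / 2 ^ J1" by (simp add: power_divide)
  finally show ?thesis .
qed

text \<open>Block \<open>j\<close> has at most \<open>4 * 4^j / j^2\<close> pairs. For each pair the
  cofactor runs up to \<open>X / 4^j\<close> and is sifted above the block, which gives density
  \<open>(j + 1) / J2 <= 2 j / J2\<close>. So the block contributes
  \<open>O(X / (j J2))\<close>.\<close>

lemma energy_top_block_pair_le:
  assumes X: "8 ^ J2 \<le> X" "x0 * 4 ^ J2 \<le> X" and J: "1 \<le> J1" "J1 \<le> J2"
  shows "energy f (nats_upto X \<inter> top_block_pair J1 J2) \<le> 18 * K ^ 3 * X * harmonic_between J1 J2 / J2"
proof -
  define A where "A j p q = {m \<in> rough (Suc j) J2 \<inter> nats_upto (X / 4 ^ j). \<not> p dvd m \<and> \<not> q dvd m}" for j p q :: nat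
  define B where "B j = {(p, q). p \<in> prime_block j \<and> q \<in> prime_block j \<and> p \<noteq> q}" for j
  define S where "S = (SIGMA j:{J1..<J2}. SIGMA pq:B j. A j (fst pq) (snd pq))"
  have finB: "finite (B j)" for j
    by (rule finite_subset[of _ "prime_block j \<times> prime_block j"]) (auto simp: B_def)
  have finA: "finite (A j p q)" for j p q by (simp add: A_def)
  have fin: "finite S" unfolding S_def by (intro finite_SigmaI finB finA) auto
  have X0: "X > 0" using X(1) by (rule less_le_trans[rotated]) simp
  have sub: "nats_upto X \<inter> top_block_pair J1 J2 \<subseteq> (\<lambda>(j, (p, q), m). p * (q * m)) ` S"
  proof
    fix n assume n: "n \<in> nats_upto X \<inter> top_block_pair J1 J2"
    then obtain j p q where j: "j \<in> {J1..<J2}" "n \<in> rough (Suc j) J2"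
      and p: "p \<in> prime_block j" "p dvd n" "\<not> p\<^sup>2 dvd n"
      and q: "q \<in> prime_block j" "q dvd n" "\<not> q\<^sup>2 dvd n" and "p \<noteq> q"
      unfolding top_block_pair_def by blast
    note pb = prime_block_bounds[OF p(1)] and qb = prime_block_bounds[OF q(1)]
    have "p * q dvd n" using p q \<open>p \<noteq> q\<close> pb qb by (intro divides_mult) (auto simp: primes_coprime)
    then obtain m where "n = p * q * m" by (elim dvdE)
    then have m: "n = p * (q * m)" by (simp only: mult.assoc)
    have n1: "n \<ge> 1" "real n \<le> X" using n by (auto simp: nats_upto_def)
    have "m \<in> rough (Suc j) J2"
      by (rule rough_dvd[OF j(2)]) (simp add: m)
    moreover have "m \<in> nats_upto (X / 4 ^ j)"
    proof -
      have "(2 ^ j * 2 ^ j) * real m \<le> (real p * real q) * real m"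
        using pb qb by (intro mult_right_mono mult_mono) auto
      also have "\<dots> \<le> X" using n1 m by (simp add: mult.assoc)
      finally have "4 ^ j * real m \<le> X" by (simp flip: power_mult_distrib)
      then show ?thesis using n1 m by (cases m) (auto simp: nats_upto_def field_simps)
    qed
    moreover have "\<not> p dvd m"
    proof
      assume "p dvd m"
      then have "p * p dvd p * (q * m)" by (intro mult_dvd_mono dvd_mult dvd_refl)
      then show False using p(3) by (simp add: m power2_eq_square)
    qed
    moreover have "\<not> q dvd m"
    proof
      assume "q dvd m"
      then have "q * q dvd p * (q * m)" by (intro dvd_mult mult_dvd_mono dvd_refl)
      then show False using q(3) by (simp add: m power2_eq_square)
    qed
    ultimately have "(j, (p, q), m) \<in> S"
      using j p q \<open>p \<noteq> q\<close> by (auto simp: S_def A_def B_def)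
    then show "n \<in> (\<lambda>(j, (p, q), m). p * (q * m)) ` S" using m by force
  qed
  have "energy f (nats_upto X \<inter> top_block_pair J1 J2) \<le> (\<Sum>(j, pq, m)\<in>S. (cmod (f (fst pq * (snd pq * m))))\<^sup>2)"
    using energy_le_sum_image[OF fin sub, of f] by (simp add: case_prod_unfold)
  also have "\<dots> \<le> (\<Sum>(j, pq, m)\<in>S. (3 / 2 * K)\<^sup>2 * (cmod (f m))\<^sup>2)"
  proof (rule sum_mono, clarify)
    fix j p q m assume s: "(j, (p, q), m) \<in> S"
    then have pq: "p \<in> prime_block j" "q \<in> prime_block j" "p \<noteq> q" "\<not> p dvd m" "\<not> q dvd m" "m \<ge> 1"
      by (auto simp: S_def B_def A_def nats_upto_def)
    note pb = prime_block_bounds[OF pq(1)] and qb = prime_block_bounds[OF pq(2)]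
    have "\<not> p dvd q * m" using pq pb qb primes_dvd_imp_eq[of p q] by (auto simp: prime_dvd_mult_iff)
    then have "f (p * (q * m)) = f p * (f q * f m)"
      using pq pb qb by (simp add: prime_mult)
    then have "(cmod (f (p * (q * m))))\<^sup>2 = (cmod (f p))\<^sup>2 * (cmod (f q))\<^sup>2 * (cmod (f m))\<^sup>2"
      by (simp add: norm_mult power_mult_distrib)
    also have "\<dots> \<le> (3 / 2 * K) * (3 / 2 * K) * (cmod (f m))\<^sup>2"
      using prime_value pb qb K by (intro mult_right_mono mult_mono) auto
    finally show "(cmod (f (fst (p, q) * (snd (p, q) * m))))\<^sup>2 \<le> (3 / 2 * K)\<^sup>2 * (cmod (f m))\<^sup>2"
      by (simp add: power2_eq_square)
  qed
  also have "\<dots> = (\<Sum>j=J1..<J2. \<Sum>pq\<in>B j. (3 / 2 * K)\<^sup>2 * energy f (A j (fst pq) (snd pq)))"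
    unfolding S_def energy_def sum_distrib_left
    by (subst sum.Sigma[symmetric], simp, simp add: finA finB, rule sum.cong[OF refl],
        subst sum.Sigma[symmetric], simp_all add: finA finB)
  also have "\<dots> \<le> (\<Sum>j=J1..<J2. 18 * K ^ 3 * X / J2 * (1 / real j))"
  proof (rule sum_mono)
    fix j assume j: "j \<in> {J1..<J2}"
    have pow: "2 ^ J2 \<le> X / 4 ^ j" "x0 \<le> X / 4 ^ j"
    proof -
      have le: "(4::real) ^ j \<le> 4 ^ J2" using j by (intro power_increasing) auto
      \<comment> \<open>Here \<open>8^J2 <= X\<close> is spent: the range of the cofactor still
        reaches the top \<open>2^J2\<close> of the sifting range, as (C3) demands.\<close>
      have "2 ^ J2 * (4::real) ^ j \<le> 2 ^ J2 * 4 ^ J2" using le by (intro mult_left_mono) auto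
      also have "\<dots> = 8 ^ J2" by (simp flip: power_mult_distrib)
      finally show "2 ^ J2 \<le> X / 4 ^ j" using X(1) by (simp add: field_simps)
      show "x0 \<le> X / 4 ^ j"
      proof (cases "x0 \<ge> 0")
        case True
        then have "x0 * 4 ^ j \<le> x0 * 4 ^ J2" using le by (intro mult_left_mono) auto
        then show ?thesis using X(2) by (simp add: field_simps)
      next
        case False
        then show ?thesis using X0 by (smt (verit) divide_nonneg_nonneg zero_le_power)
      qed
    qed
    have card: "real (card (B j)) * real j * real j \<le> 4 * 4 ^ j"
    proof -
      have "card (B j) \<le> card (prime_block j \<times> prime_block j)"
        by (intro card_mono) (auto simp: B_def)
      then have "real (card (B j)) \<le> real (card (prime_block j)) * real (card (prime_block j))"
        unfolding card_cartesian_product by (simp only: of_nat_mult[symmetric] of_nat_le_iff)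
      then have "real (card (B j)) * (real j * real j) \<le> (real (card (prime_block j)) * real (card (prime_block j))) * (real j * real j)"
        by (rule mult_right_mono) simp
      also have "\<dots> = (real (card (prime_block j)) * real j) * (real (card (prime_block j)) * real j)"
        by (simp only: mult_ac)
      also have "\<dots> \<le> (2 * 2 ^ j) * (2 * 2 ^ j)"
        by (intro mult_mono card_prime_block_le) auto
      also have "\<dots> = 4 * 4 ^ j" by (simp flip: power_mult_distrib)
      finally show ?thesis by (simp only: mult.assoc)
    qed
    have "(\<Sum>pq\<in>B j. (3 / 2 * K)\<^sup>2 * energy f (A j (fst pq) (snd pq))) \<le> (\<Sum>pq\<in>B j. (3 / 2 * K)\<^sup>2 * (K * (X / 4 ^ j) * (real (Suc j) / real J2)))"
    proof (intro sum_mono mult_left_mono)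
      fix pq
      have "energy f (A j (fst pq) (snd pq)) \<le> energy f (rough (Suc j) J2 \<inter> nats_upto (X / 4 ^ j))"
        by (intro energy_mono) (auto simp: A_def)
      also have "\<dots> \<le> K * (X / 4 ^ j) * (real (Suc j) / real J2)"
        using j pow J by (intro energy_rough) auto
      finally show "energy f (A j (fst pq) (snd pq)) \<le> K * (X / 4 ^ j) * (real (Suc j) / real J2)" .
    qed auto
    also have "\<dots> = real (card (B j)) * ((9 / 4 * K ^ 3) * (X / 4 ^ j) * (real (Suc j) / real J2))"
      by (simp add: power2_eq_square power3_eq_cube)
    also have "\<dots> \<le> real (card (B j)) * ((9 / 4 * K ^ 3) * (X / 4 ^ j) * ((2 * real j) / real J2))"
      using j J X0 K by (intro mult_left_mono divide_right_mono) auto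
    also have "\<dots> = (real (card (B j)) * real j * real j) * ((9 / 2 * K ^ 3) * (X / 4 ^ j) / (real J2 * real j))"
      using j J by (simp add: mult_ac)
    also have "\<dots> \<le> (4 * 4 ^ j) * ((9 / 2 * K ^ 3) * (X / 4 ^ j) / (real J2 * real j))"
      using card X0 K by (intro mult_right_mono) auto
    also have "\<dots> = 18 * K ^ 3 * X / J2 * (1 / real j)" by simp
    finally show "(\<Sum>pq\<in>B j. (3 / 2 * K)\<^sup>2 * energy f (A j (fst pq) (snd pq))) \<le> 18 * K ^ 3 * X / J2 * (1 / real j)" .
  qed
  also have "\<dots> = 18 * K ^ 3 * X * harmonic_between J1 J2 / J2"
    unfolding harmonic_between_def by (simp add: sum_distrib_left sum_divide_distrib mult_ac)
  finally show ?thesis .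
qed

end

section \<open>Factoring out a prime\<close>

text \<open>Members of \<open>T\<close> will be pairs of a modulus and a character. \<open>D\<close>
  is \<open>q\<close> for one modulus and \<open>Q^2\<close> for all of them; moduli up to
  \<open>2 Q\<close> have products up to \<open>4 Q^2\<close>, which turns the constant
  \<open>12\<close> into \<open>48\<close>.\<close>

locale character_family =
  fixes T :: "'t set" and \<psi> :: "'t \<Rightarrow> nat \<Rightarrow> complex" and D :: real
  assumes finite_T: "finite T"
    and D: "D \<ge> 1"
    and \<psi>_mult: "\<And>t m n. t \<in> T \<Longrightarrow> \<psi> t (m * n) = \<psi> t m * \<psi> t n"
    and large_sieve: "\<And>x M N. (\<Sum>t\<in>T. (cmod (\<Sum>n\<in>{M..<M+N}. x n * \<psi> t n))\<^sup>2)
      \<le> 48 * (D + real N) * (\<Sum>n\<in>{M..<M+N}. (cmod (x n))\<^sup>2)"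
begin

lemma large_sieve_on:
  assumes "A \<subseteq> {M..<M+N}"
  shows "(\<Sum>t\<in>T. (cmod (\<Sum>n\<in>A. x n * \<psi> t n))\<^sup>2) \<le> 48 * (D + real N) * energy x A"
proof -
  define y where "y n = (if n \<in> A then x n else 0)" for n
  have "(\<Sum>n\<in>{M..<M+N}. y n * \<psi> t n) = (\<Sum>n\<in>A. x n * \<psi> t n)" for t
    using assms by (intro sum.mono_neutral_cong_right) (auto simp: y_def)
  moreover have "(\<Sum>n\<in>{M..<M+N}. (cmod (y n))\<^sup>2) = energy x A"
    unfolding energy_def using assms by (intro sum.mono_neutral_cong_right) (auto simp: y_def)
  ultimately show ?thesis using large_sieve[of y M N] by simp
qed

lemma large_sieve_upto:
  assumes "A \<subseteq> nats_upto X" "X \<ge> 0"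
  shows "(\<Sum>t\<in>T. (cmod (\<Sum>n\<in>A. x n * \<psi> t n))\<^sup>2) \<le> 48 * (D + X) * energy x A"
proof -
  have "(\<Sum>t\<in>T. (cmod (\<Sum>n\<in>A. x n * \<psi> t n))\<^sup>2) \<le> 48 * (D + real (nat \<lfloor>X\<rfloor>)) * energy x A"
    using assms nats_upto_subset[of X] by (intro large_sieve_on[where M = 1]) auto
  also have "\<dots> \<le> 48 * (D + X) * energy x A"
    using assms by (intro mult_right_mono mult_left_mono add_left_mono) auto
  finally show ?thesis .
qed

end

locale factored_sum = tame_multiplicative f K x0 + character_family T \<psi> D
  for f :: "nat \<Rightarrow> complex" and K x0 :: real
    and T :: "'t set" and \<psi> :: "'t \<Rightarrow> nat \<Rightarrow> complex" and D :: real +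
  fixes X :: real and J1 J2 H :: nat
  assumes J1: "2 \<le> J1" and J12: "J1 \<le> J2" and H: "H \<ge> 1"
    and X_large: "8 ^ J2 \<le> X" "x0 * 4 ^ J2 \<le> X" "x0 \<le> X"
begin

text \<open>The integers \<open>m \<le> X / 2\<^sup>j\<close> fall into \<open>H\<close> intervals of equal length. On each of them the
  condition \<open>p m \<le> X\<close> is replaced by the one for the right end point, so that the sums over
  \<open>p\<close> and \<open>m\<close> separate.\<close>

definition slot :: "nat \<Rightarrow> nat \<Rightarrow> nat" where
  "slot j m = nat \<lfloor>real m * 2 ^ j * real H / X\<rfloor>"

definition slot_set :: "nat \<Rightarrow> nat \<Rightarrow> nat set" where
  "slot_set j v = {m \<in> rough j J2. slot j m = v}"

text \<open>Slot \<open>v\<close> ends at \<open>(v + 1) X / (2^j H)\<close>, and the inequality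
  says that \<open>p\<close> times this end point is at most \<open>X\<close>.\<close>

definition slot_primes :: "nat \<Rightarrow> nat \<Rightarrow> nat set" where
  "slot_primes j v = {p \<in> prime_block j. real p * (real v + 1) \<le> 2 ^ j * real H}"

definition pairs :: "nat \<Rightarrow> (nat \<times> nat) set" where
  "pairs j = {(p, m). m \<in> rough j J2 \<and> p \<in> slot_primes j (slot j m)}"

definition all_pairs :: "(nat \<times> nat) set" where
  "all_pairs = (\<Union>j\<in>{J1..<J2}. pairs j)"

definition remainder :: "nat set" where
  "remainder = nats_upto X - (\<lambda>(p, m). p * m) ` all_pairs"

lemma X_pos: "X \<ge> 1"
proof -
  have "(1::real) \<le> 8 ^ J2" by simp
  then show ?thesis using X_large(1) by linarith
qed

lemma slot_le: "real (slot j m) \<le> real m * 2 ^ j * real H / X"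
  and less_slot: "real m * 2 ^ j * real H / X < real (slot j m) + 1"
proof -
  have "0 \<le> real m * 2 ^ j * real H / X" using X_pos by simp
  then show "real (slot j m) \<le> real m * 2 ^ j * real H / X" "real m * 2 ^ j * real H / X < real (slot j m) + 1"
    unfolding slot_def by linarith+
qed

text \<open>The second inclusion is the one for the large sieve: the number of integers in a slot is
  smaller by a factor \<open>H\<close> than \<open>X / 2^j\<close>, up to rounding.\<close>

lemma slot_set_subset:
  assumes "v < H"
  shows "slot_set j v \<subseteq> nats_upto (X / 2 ^ j)"
    and "slot_set j v \<subseteq> {nat \<lceil>real v * X / (2 ^ j * real H)\<rceil>..<nat \<lceil>real v * X / (2 ^ j * real H)\<rceil> + nat \<lceil>X / (2 ^ j * real H)\<rceil>}"
proof -
  have pos: "2 ^ j * real H > 0" using H by simp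
  have m: "real v * X / (2 ^ j * real H) \<le> real m" "real m < real v * X / (2 ^ j * real H) + X / (2 ^ j * real H)" "m \<ge> 1"
    if "m \<in> slot_set j v" for m
  proof -
    have "real v \<le> real m * 2 ^ j * real H / X" "real m * 2 ^ j * real H / X < real v + 1" and m1: "m \<ge> 1"
      using that slot_le[of j m] less_slot[of m j] by (auto simp: slot_set_def rough_def)
    then have "real v * X \<le> real m * (2 ^ j * real H)" "real m * (2 ^ j * real H) < (real v + 1) * X"
      using X_pos by (simp_all add: pos_le_divide_eq pos_divide_less_eq mult.assoc)
    then have "real v * X / (2 ^ j * real H) \<le> real m" "real m < (real v + 1) * X / (2 ^ j * real H)"
      using pos by (simp_all only: pos_le_divide_eq pos_divide_le_eq pos_less_divide_eq)
    then show "real v * X / (2 ^ j * real H) \<le> real m" "real m < real v * X / (2 ^ j * real H) + X / (2 ^ j * real H)" "m \<ge> 1"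
      using m1 by (simp_all add: distrib_right add_divide_distrib)
  qed
  show "slot_set j v \<subseteq> nats_upto (X / 2 ^ j)"
  proof
    fix n assume n: "n \<in> slot_set j v"
    have "real v * X / (2 ^ j * real H) + X / (2 ^ j * real H) = (real v + 1) * X / (2 ^ j * real H)"
      by (simp add: distrib_right add_divide_distrib)
    also have "\<dots> \<le> real H * X / (2 ^ j * real H)"
      using assms X_pos pos by (intro divide_right_mono mult_right_mono) auto
    also have "\<dots> = X / 2 ^ j" using H by simp
    finally show "n \<in> nats_upto (X / 2 ^ j)" using m[OF n] by (simp add: nats_upto_def)
  qed
  show "slot_set j v \<subseteq> {nat \<lceil>real v * X / (2 ^ j * real H)\<rceil>..<nat \<lceil>real v * X / (2 ^ j * real H)\<rceil> + nat \<lceil>X / (2 ^ j * real H)\<rceil>}"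
  proof
    fix n assume n: "n \<in> slot_set j v"
    have "0 \<le> real v * X / (2 ^ j * real H)" "0 \<le> X / (2 ^ j * real H)" using X_pos by auto
    then show "n \<in> {nat \<lceil>real v * X / (2 ^ j * real H)\<rceil>..<nat \<lceil>real v * X / (2 ^ j * real H)\<rceil> + nat \<lceil>X / (2 ^ j * real H)\<rceil>}"
      using m[OF n] unfolding atLeastLessThan_iff by (intro conjI; linarith)
  qed
qed

lemma finite_slot_set [simp]: "v < H \<Longrightarrow> finite (slot_set j v)"
  using slot_set_subset(1) finite_nats_upto by (rule finite_subset)

lemma finite_slot_primes [simp]: "finite (slot_primes j v)"
  by (simp add: slot_primes_def)

text \<open>Since \<open>p > 2^j\<close> strictly, the last slot has no primes. This gap of one slot
  later provides the minimal length of the prime intervals in (C4).\<close>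

lemma slot_primes_nonempty: "p \<in> slot_primes j v \<Longrightarrow> Suc v < H"
proof -
  assume p: "p \<in> slot_primes j v"
  then have "2 ^ j < real p" using prime_block_bounds by (auto simp: slot_primes_def)
  then have "2 ^ j * (real v + 1) < real p * (real v + 1)" by (intro mult_strict_right_mono) auto
  also have "\<dots> \<le> 2 ^ j * real H" using p by (simp add: slot_primes_def)
  finally have "real v + 1 < real H" by simp
  then show ?thesis by linarith
qed

lemma pairs_eq: "pairs j = (\<Union>v\<in>{..<H}. slot_primes j v \<times> slot_set j v)"
proof (intro equalityI subsetI)
  fix x assume "x \<in> pairs j"
  then obtain p m where x: "x = (p, m)" "m \<in> rough j J2" "p \<in> slot_primes j (slot j m)"
    by (auto simp: pairs_def)
  then have "slot j m < H" using slot_primes_nonempty by fastforce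
  then show "x \<in> (\<Union>v\<in>{..<H}. slot_primes j v \<times> slot_set j v)"
    using x by (auto simp: slot_set_def)
next
  fix x assume "x \<in> (\<Union>v\<in>{..<H}. slot_primes j v \<times> slot_set j v)"
  then show "x \<in> pairs j" by (auto simp: slot_set_def pairs_def)
qed

lemma finite_pairs [simp]: "finite (pairs j)"
  unfolding pairs_eq by (intro finite_UN_I finite_cartesian_product) auto

lemma finite_all_pairs [simp]: "finite all_pairs"
  unfolding all_pairs_def by simp

lemma pairsD:
  assumes "(p, m) \<in> pairs j"
  shows "p \<in> prime_block j" "m \<in> rough j J2" "m \<ge> 1" "real (p * m) \<le> X"
proof -
  show *: "p \<in> prime_block j" "m \<in> rough j J2" using assms by (auto simp: pairs_def slot_primes_def)
  then show "m \<ge> 1" by (simp add: rough_def)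
  have "real p * (real (slot j m) + 1) \<le> 2 ^ j * real H"
    using assms by (auto simp: pairs_def slot_primes_def)
  moreover have "real p * (real m * 2 ^ j * real H / X) \<le> real p * (real (slot j m) + 1)"
    using less_slot[of m j] by (intro mult_left_mono) auto
  ultimately have "real p * (real m * 2 ^ j * real H / X) \<le> 2 ^ j * real H" by linarith
  then have "(2 ^ j * real H) * (real p * real m) \<le> (2 ^ j * real H) * X"
    using X_pos by (simp add: pos_divide_le_eq mult_ac)
  then show "real (p * m) \<le> X" using H by (subst (asm) mult_le_cancel_left_pos) auto
qed

lemma pairs_not_dvd:
  assumes "(p, m) \<in> pairs j" "j < J2"
  shows "\<not> p dvd m"
  using roughD[OF pairsD(2)[OF assms(1)] pairsD(1)[OF assms(1)] order_refl assms(2)] .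

text \<open>Let \<open>q\<close> come from the higher block, or from the same one. Then
  \<open>m\<close> is sifted by that block as well, so \<open>q\<close> does not divide
  \<open>m\<close>, hence divides the prime \<open>p\<close> and equals it.\<close>

lemma pairs_inj:
  assumes "(p, m) \<in> pairs i" "(q, n) \<in> pairs j" "i < J2" "j < J2" "p * m = q * n"
  shows "p = q \<and> m = n"
proof -
  have *: "p = q \<and> m = n"
    if "(p, m) \<in> pairs i" "(q, n) \<in> pairs j" "i < J2" "j < J2" "p * m = q * n" "i \<le> j" for p m q n i j
  proof -
    note pm = pairsD[OF that(1)] and qn = pairsD[OF that(2)]
    have "q dvd p * m" using that(5) by simp
    moreover have "\<not> q dvd m" using roughD[OF pm(2) qn(1) that(6,4)] .
    ultimately have "q dvd p" using prime_block_bounds(3)[OF qn(1)] by (simp add: prime_dvd_mult_iff)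
    then have "q = p"
      by (rule primes_dvd_imp_eq[OF prime_block_bounds(3)[OF qn(1)] prime_block_bounds(3)[OF pm(1)]])
    then show ?thesis using that(5) prime_block_bounds(3)[OF qn(1)] prime_gt_0_nat[of q] by auto
  qed
  show ?thesis
  proof (cases "i \<le> j")
    case True
    then show ?thesis using *[OF assms] by blast
  next
    case False
    then show ?thesis using *[OF assms(2,1,4,3) assms(5)[symmetric]] by simp
  qed
qed

lemma pairs_disjoint:
  assumes "i \<noteq> j"
  shows "pairs i \<inter> pairs j = {}"
  using prime_block_disjoint assms pairsD(1) by fastforce

lemma inj_on_all_pairs: "inj_on (\<lambda>(p, m). p * m) all_pairs"
  by (rule inj_onI) (auto simp: all_pairs_def dest: pairs_inj)

section \<open>The bilinear decomposition\<close>

lemma sum_pairs: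
  assumes "t \<in> T" "j < J2"
  shows "(\<Sum>(p, m)\<in>pairs j. f (p * m) * \<psi> t (p * m))
    = (\<Sum>v<H. (\<Sum>p\<in>slot_primes j v. f p * \<psi> t p) * (\<Sum>m\<in>slot_set j v. f m * \<psi> t m))"
proof -
  have "(\<Sum>(p, m)\<in>pairs j. f (p * m) * \<psi> t (p * m)) = (\<Sum>(p, m)\<in>pairs j. (f p * \<psi> t p) * (f m * \<psi> t m))"
  proof (intro sum.cong refl, clarify)
    fix p m assume pm: "(p, m) \<in> pairs j"
    have "f (p * m) = f p * f m"
      using pairsD[OF pm] prime_block_bounds pairs_not_dvd[OF pm assms(2)] by (intro prime_mult) auto
    then show "f (p * m) * \<psi> t (p * m) = (f p * \<psi> t p) * (f m * \<psi> t m)"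
      by (simp add: \<psi>_mult[OF assms(1)])
  qed
  also have "\<dots> = (\<Sum>v<H. \<Sum>(p, m)\<in>slot_primes j v \<times> slot_set j v. (f p * \<psi> t p) * (f m * \<psi> t m))"
    unfolding pairs_eq
  proof (rule sum.UNION_disjoint)
    show "\<forall>v\<in>{..<H}. finite (slot_primes j v \<times> slot_set j v)" by simp
  qed (auto simp: slot_set_def)
  also have "\<dots> = (\<Sum>v<H. (\<Sum>p\<in>slot_primes j v. f p * \<psi> t p) * (\<Sum>m\<in>slot_set j v. f m * \<psi> t m))"
    by (intro sum.cong refl) (simp add: sum_product sum.cartesian_product)
  finally show ?thesis .
qed

lemma twisted_sum_decomposition:
  assumes "t \<in> T"
  shows "twisted_sum f (\<psi> t) X = (\<Sum>n\<in>remainder. f n * \<psi> t n) + (\<Sum>j=J1..<J2. \<Sum>(p, m)\<in>pairs j. f (p * m) * \<psi> t (p * m))"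
proof -
  have sub: "(\<lambda>(p, m). p * m) ` all_pairs \<subseteq> nats_upto X"
  proof clarify
    fix p m assume "(p, m) \<in> all_pairs"
    then obtain j where "(p, m) \<in> pairs j" by (auto simp: all_pairs_def)
    note pm = pairsD[OF this]
    have "p > 0" using prime_block_bounds(4)[OF pm(1)] by (cases p) auto
    then show "p * m \<in> nats_upto X" using pm by (simp add: nats_upto_def)
  qed
  have "twisted_sum f (\<psi> t) X = (\<Sum>n\<in>nats_upto X. f n * \<psi> t n)"
    by (simp add: twisted_sum_def nats_upto_def)
  also have "\<dots> = (\<Sum>n\<in>remainder. f n * \<psi> t n) + (\<Sum>n\<in>(\<lambda>(p, m). p * m) ` all_pairs. f n * \<psi> t n)"
    unfolding remainder_def using sub by (intro sum.subset_diff) auto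
  also have "(\<Sum>n\<in>(\<lambda>(p, m). p * m) ` all_pairs. f n * \<psi> t n) = (\<Sum>(p, m)\<in>all_pairs. f (p * m) * \<psi> t (p * m))"
    by (subst sum.reindex[OF inj_on_all_pairs]) (simp add: case_prod_unfold)
  also have "\<dots> = (\<Sum>j=J1..<J2. \<Sum>(p, m)\<in>pairs j. f (p * m) * \<psi> t (p * m))"
    unfolding all_pairs_def using pairs_disjoint by (intro sum.UNION_disjoint) auto
  finally show ?thesis .
qed

text \<open>Take the highest eligible block with a prime \<open>p\<close> dividing \<open>n\<close>.
  Outside the first three sets \<open>p\<close> is the only prime of its block dividing
  \<open>n\<close>, and only once, so \<open>m = n / p\<close> is rough and the pair
  \<open>(p, m)\<close> can fail only the slot inequality.\<close>

lemma remainder_subset: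
  "remainder \<subseteq> (rough J1 J2 \<inter> nats_upto X) \<union> (nats_upto X \<inter> square_divisible J1 J2) \<union> (nats_upto X \<inter> top_block_pair J1 J2)
     \<union> {n \<in> nats_upto X. X - 2 * X / H \<le> real n}"
proof
  fix n assume n: "n \<in> remainder"
  then have nX: "n \<in> nats_upto X" and n1: "n \<ge> 1" and nW: "n \<notin> (\<lambda>(p, m). p * m) ` all_pairs"
    by (auto simp: remainder_def nats_upto_def)
  show "n \<in> (rough J1 J2 \<inter> nats_upto X) \<union> (nats_upto X \<inter> square_divisible J1 J2) \<union> (nats_upto X \<inter> top_block_pair J1 J2)
     \<union> {n \<in> nats_upto X. X - 2 * X / H \<le> real n}"
  proof (cases "n \<in> rough J1 J2 \<or> n \<in> square_divisible J1 J2 \<or> n \<in> top_block_pair J1 J2")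
    case True
    then show ?thesis using nX by blast
  next
    case False
    define S where "S = {j \<in> {J1..<J2}. \<exists>p\<in>prime_block j. p dvd n}"
    have fS: "finite S" by (simp add: S_def)
    obtain p0 i0 where "p0 \<in> prime_block i0" "J1 \<le> i0" "i0 < J2" "p0 dvd n"
      using not_roughD[of n J1 J2] False n1 J12 by blast
    then have "i0 \<in> S" by (auto simp: S_def)
    then have neS: "S \<noteq> {}" by blast
    define j where "j = Max S"
    have "j \<in> S" unfolding j_def using fS neS by (rule Max_in)
    then obtain p where j: "J1 \<le> j" "j < J2" and p: "p \<in> prime_block j" "p dvd n"
      by (auto simp: S_def)
    have top: "\<not> r dvd n" if r: "r \<in> prime_block i" "j < i" "i < J2" for r i
    proof
      assume "r dvd n"
      then have "i \<in> S" using r j by (auto simp: S_def)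
      then show False using Max_ge[OF fS] r(2) unfolding j_def by fastforce
    qed
    have nr: "n \<in> rough (Suc j) J2"
    proof (rule ccontr)
      assume "n \<notin> rough (Suc j) J2"
      then obtain r i where "r \<in> prime_block i" "Suc j \<le> i" "i < J2" "r dvd n"
        using not_roughD[of n "Suc j" J2] n1 j(2) by (metis Suc_leI)
      then show False using top by auto
    qed
    have nosq: "\<not> r\<^sup>2 dvd n" if "r \<in> prime_block j" for r
      using False j that by (auto simp: square_divisible_def)
    have only: "r = p" if "r \<in> prime_block j" "r dvd n" for r
    proof (rule ccontr)
      assume "r \<noteq> p"
      then have "\<exists>p\<in>prime_block j. \<exists>q\<in>prime_block j. p \<noteq> q \<and> p dvd n \<and> q dvd n \<and> \<not> p\<^sup>2 dvd n \<and> \<not> q\<^sup>2 dvd n"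
        using p that nosq[OF p(1)] nosq[OF that(1)] by blast
      moreover have "j \<in> {J1..<J2}" using j by simp
      ultimately have "n \<in> top_block_pair J1 J2"
        unfolding top_block_pair_def using nr by blast
      then show False using False by blast
    qed
    obtain m where m: "n = p * m" using p(2) by (elim dvdE)
    have m1: "m \<ge> 1" using n1 m by (cases m) auto
    have mr: "m \<in> rough j J2"
    proof (rule ccontr)
      assume "m \<notin> rough j J2"
      then obtain r i where r: "r \<in> prime_block i" "j \<le> i" "i < J2" "r dvd m"
        using not_roughD[of m j J2] m1 j(2) by (metis less_imp_le)
      have rn: "r dvd n" using r(4) m by simp
      show False
      proof (cases "i = j")
        case True
        then have "r = p" using only r rn by blast
        then have "p * p dvd p * m" using r(4) by (intro mult_dvd_mono) auto
        then show False using nosq[OF p(1)] m by (simp add: power2_eq_square)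
      next
        case False
        then show False using top[OF r(1)] r rn by simp
      qed
    qed
    have "(p, m) \<notin> pairs j"
    proof
      assume "(p, m) \<in> pairs j"
      then have "(p, m) \<in> all_pairs" using j by (auto simp: all_pairs_def)
      then show False using nW m by force
    qed
    \<comment> \<open>Rounding \<open>m\<close> up to the end of its slot changes the slot
      coordinate by at most \<open>1\<close>, hence \<open>p m / X\<close> by at most
      \<open>p / (2^j H) <= 2 / H\<close>. The failure therefore places \<open>n\<close> within
      \<open>2 X / H\<close> of \<open>X\<close>.\<close>
    then have "2 ^ j * real H < real p * (real (slot j m) + 1)"
      using p(1) mr by (auto simp: pairs_def slot_primes_def)
    also have "\<dots> \<le> real p * (real m * 2 ^ j * real H / X + 1)"
      using slot_le[of j m] by (intro mult_left_mono) auto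
    also have "\<dots> = (2 ^ j * real H) * (real n / X + real p / (2 ^ j * real H))"
      using H by (simp add: m distrib_left mult_ac)
    finally have "1 < real n / X + real p / (2 ^ j * real H)"
      using H by simp
    moreover have "real p / (2 ^ j * real H) \<le> (2 * 2 ^ j) / (2 ^ j * real H)"
      using prime_block_bounds[OF p(1)] H by (intro divide_right_mono) auto
    ultimately have "1 < real n / X + 2 / real H" by simp
    then have "X * 1 \<le> X * (real n / X + 2 / real H)" using X_pos by (intro mult_left_mono) auto
    then have "X - 2 * X / H \<le> real n" using X_pos by (simp add: distrib_left mult_ac)
    then show ?thesis using nX by blast
  qed
qed

section \<open>Bounds for the remainder and the bilinear sums\<close>

lemma energy_remainder_le:
  "energy f remainder \<le> K * X * (real J1 / real J2) + 18 * K\<^sup>2 * X / 2 ^ J1 + 18 * K ^ 3 * X * harmonic_between J1 J2 / J2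
     + energy f {n \<in> nats_upto X. X - 2 * X / H \<le> real n}"
proof -
  let ?A = "rough J1 J2 \<inter> nats_upto X" and ?B = "nats_upto X \<inter> square_divisible J1 J2"
    and ?C = "nats_upto X \<inter> top_block_pair J1 J2" and ?D = "{n \<in> nats_upto X. X - 2 * X / H \<le> real n}"
  have "energy f remainder \<le> energy f (?A \<union> ?B \<union> ?C \<union> ?D)"
    by (intro energy_mono remainder_subset) auto
  also have "\<dots> \<le> energy f (?A \<union> ?B \<union> ?C) + energy f ?D" by (intro energy_Un_le) auto
  also have "energy f (?A \<union> ?B \<union> ?C) \<le> energy f (?A \<union> ?B) + energy f ?C" by (intro energy_Un_le) auto
  also have "energy f (?A \<union> ?B) \<le> energy f ?A + energy f ?B" by (intro energy_Un_le) auto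
  also have "energy f ?A \<le> K * X * (real J1 / real J2)"
  proof (intro energy_rough J1 J12)
    have "(2::real) ^ J2 \<le> 8 ^ J2" by (intro power_mono) auto
    then show "2 ^ J2 \<le> X" using X_large(1) by linarith
    show "x0 \<le> X" by (rule X_large(3))
  qed
  also have "energy f ?B \<le> 18 * K\<^sup>2 * X / 2 ^ J1"
    using J1 by (intro energy_square_divisible_le X_pos J12) simp
  also have "energy f ?C \<le> 18 * K ^ 3 * X * harmonic_between J1 J2 / J2"
    using J1 by (intro energy_top_block_pair_le X_large(1,2) J12) simp
  finally show ?thesis by simp
qed

text \<open>The slots are disjoint, so (C3) is applied once to the whole range up to
  \<open>X / 2^j\<close>, without loss in \<open>H\<close>.\<close>

lemma sum_energy_slots_le:
  assumes j: "2 \<le> j" "j < J2"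
  shows "(\<Sum>v<H. energy f (slot_set j v)) \<le> K * (X / 2 ^ j) * (real j / real J2)"
proof -
  have le: "(2::real) ^ j \<le> 4 ^ J2"
  proof -
    have "(2::real) ^ j \<le> 2 ^ J2" using j by (intro power_increasing) auto
    also have "\<dots> \<le> 4 ^ J2" by (intro power_mono) auto
    finally show ?thesis .
  qed
  have "2 ^ J2 * (2::real) ^ j \<le> 2 ^ J2 * 4 ^ J2" using le by (intro mult_left_mono) auto
  also have "\<dots> = 8 ^ J2" by (simp flip: power_mult_distrib)
  finally have pow: "2 ^ J2 \<le> X / 2 ^ j" using X_large(1) by (simp add: field_simps)
  have x0: "x0 \<le> X / 2 ^ j"
  proof (cases "x0 \<ge> 0")
    case True
    then have "x0 * 2 ^ j \<le> x0 * 4 ^ J2" using le by (intro mult_left_mono) auto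
    then show ?thesis using X_large(2) by (simp add: field_simps)
  next
    case False
    then show ?thesis using X_pos by (smt (verit) divide_nonneg_nonneg zero_le_power)
  qed
  have "(\<Sum>v<H. energy f (slot_set j v)) = energy f (\<Union>v\<in>{..<H}. slot_set j v)"
    unfolding energy_def
  proof (rule sum.UNION_disjoint[symmetric])
    show "\<forall>v\<in>{..<H}. finite (slot_set j v)" by simp
  qed (auto simp: slot_set_def)
  also have "\<dots> \<le> energy f (rough j J2 \<inter> nats_upto (X / 2 ^ j))"
  proof (rule energy_mono)
    show "(\<Union>v\<in>{..<H}. slot_set j v) \<subseteq> rough j J2 \<inter> nats_upto (X / 2 ^ j)"
      using slot_set_subset(1)[of _ j] by (auto simp: slot_set_def)
  qed simp
  also have "\<dots> \<le> K * (X / 2 ^ j) * (real j / real J2)"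
    using j pow x0 by (intro energy_rough) auto
  finally show ?thesis .
qed

text \<open>The large sieve acts on each slot separately, so its length term carries
  \<open>1 / H\<close>. Rounding the length up is absorbed by replacing \<open>D\<close> with
  \<open>2 D\<close>.\<close>

lemma sum_slots_le:
  assumes j: "2 \<le> j" "j < J2"
  shows "(\<Sum>t\<in>T. \<Sum>v<H. (cmod (\<Sum>m\<in>slot_set j v. f m * \<psi> t m))\<^sup>2)
    \<le> 48 * (2 * D + X / (2 ^ j * real H)) * (K * (X / 2 ^ j) * (real j / real J2))"
proof -
  have nn: "0 \<le> X / (2 ^ j * real H)" using X_pos by simp
  have "(\<Sum>t\<in>T. \<Sum>v<H. (cmod (\<Sum>m\<in>slot_set j v. f m * \<psi> t m))\<^sup>2)
      = (\<Sum>v<H. \<Sum>t\<in>T. (cmod (\<Sum>m\<in>slot_set j v. f m * \<psi> t m))\<^sup>2)"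
    by (rule sum.swap)
  also have "\<dots> \<le> (\<Sum>v<H. 48 * (2 * D + X / (2 ^ j * real H)) * energy f (slot_set j v))"
  proof (rule sum_mono)
    fix v assume "v \<in> {..<H}"
    then have "(\<Sum>t\<in>T. (cmod (\<Sum>m\<in>slot_set j v. f m * \<psi> t m))\<^sup>2)
        \<le> 48 * (D + real (nat \<lceil>X / (2 ^ j * real H)\<rceil>)) * energy f (slot_set j v)"
      using slot_set_subset(2)[of v j] by (intro large_sieve_on) auto
    also have "\<dots> \<le> 48 * (2 * D + X / (2 ^ j * real H)) * energy f (slot_set j v)"
    proof (intro mult_right_mono mult_left_mono)
      show "D + real (nat \<lceil>X / (2 ^ j * real H)\<rceil>) \<le> 2 * D + X / (2 ^ j * real H)"
        using nn D by linarith
    qed auto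
    finally show "(\<Sum>t\<in>T. (cmod (\<Sum>m\<in>slot_set j v. f m * \<psi> t m))\<^sup>2)
        \<le> 48 * (2 * D + X / (2 ^ j * real H)) * energy f (slot_set j v)" .
  qed
  also have "\<dots> = 48 * (2 * D + X / (2 ^ j * real H)) * (\<Sum>v<H. energy f (slot_set j v))"
    by (simp add: sum_distrib_left)
  also have "\<dots> \<le> 48 * (2 * D + X / (2 ^ j * real H)) * (K * (X / 2 ^ j) * (real j / real J2))"
    using nn D by (intro mult_left_mono sum_energy_slots_le j) auto
  finally show ?thesis .
qed

text \<open>Cauchy-Schwarz over the slots multiplies the bound for one prime sum by
  \<open>H\<close>. In the length term this cancels \<open>1 / H\<close>, and \<open>4^j\<close>
  cancels the two factors \<open>1 / 2^j\<close>; the term with \<open>D\<close> retains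
  \<open>H 2^j\<close>.\<close>

lemma sum_block_le:
  assumes j: "2 \<le> j" "j < J2" and G: "G \<ge> 0"
    and B: "\<And>t v. t \<in> T \<Longrightarrow> v < H \<Longrightarrow>
      (cmod (\<Sum>p\<in>slot_primes j v. f p * \<psi> t p))\<^sup>2 \<le> G * 4 ^ j / ((real j)\<^sup>2 * real j powr \<theta>)"
  shows "(\<Sum>t\<in>T. (cmod (\<Sum>(p, m)\<in>pairs j. f (p * m) * \<psi> t (p * m)))\<^sup>2)
    \<le> 48 * G * K * (2 * D * H * X * 2 ^ J2 + X\<^sup>2) / (real j * real j powr \<theta> * real J2)"
proof -
  define P where "P t v = (\<Sum>p\<in>slot_primes j v. f p * \<psi> t p)" for t v
  define R where "R t v = (\<Sum>m\<in>slot_set j v. f m * \<psi> t m)" for t v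
  define b where "b = G * 4 ^ j / ((real j)\<^sup>2 * real j powr \<theta>)"
  have b0: "b \<ge> 0" using G by (simp add: b_def)
  have jp: "real j > 0" "real j powr \<theta> > 0" "real J2 > 0" using j by auto
  have "(\<Sum>t\<in>T. (cmod (\<Sum>(p, m)\<in>pairs j. f (p * m) * \<psi> t (p * m)))\<^sup>2) \<le> (\<Sum>t\<in>T. (H * b) * (\<Sum>v<H. (cmod (R t v))\<^sup>2))"
  proof (rule sum_mono)
    fix t assume t: "t \<in> T"
    have "(cmod (\<Sum>(p, m)\<in>pairs j. f (p * m) * \<psi> t (p * m)))\<^sup>2 = (cmod (\<Sum>v<H. P t v * R t v))\<^sup>2"
      unfolding sum_pairs[OF t j(2)] P_def R_def ..
    also have "\<dots> \<le> (\<Sum>v<H. cmod (P t v) * cmod (R t v))\<^sup>2"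
      by (intro power_mono sum_norm_le) (simp_all add: norm_mult)
    also have "\<dots> \<le> (\<Sum>v<H. (cmod (P t v))\<^sup>2) * (\<Sum>v<H. (cmod (R t v))\<^sup>2)"
      by (rule Cauchy_Schwarz_ineq_sum)
    also have "\<dots> \<le> (\<Sum>v<H. b) * (\<Sum>v<H. (cmod (R t v))\<^sup>2)"
      using B[OF t] by (intro mult_right_mono sum_mono sum_nonneg) (auto simp: P_def b_def)
    finally show "(cmod (\<Sum>(p, m)\<in>pairs j. f (p * m) * \<psi> t (p * m)))\<^sup>2 \<le> (H * b) * (\<Sum>v<H. (cmod (R t v))\<^sup>2)"
      by simp
  qed
  also have "\<dots> = (H * b) * (\<Sum>t\<in>T. \<Sum>v<H. (cmod (R t v))\<^sup>2)" by (simp add: sum_distrib_left)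
  also have "\<dots> \<le> (H * b) * (48 * (2 * D + X / (2 ^ j * real H)) * (K * (X / 2 ^ j) * (real j / real J2)))"
    unfolding R_def using b0 by (intro mult_left_mono sum_slots_le j) auto
  also have "\<dots> = 48 * G * K * ((4 ^ j / 2 ^ j) * (2 * D * H * X) + (4 ^ j / (2 ^ j * 2 ^ j)) * X\<^sup>2) / (real j * real j powr \<theta> * real J2)"
    using jp H unfolding b_def by (simp add: field_simps power2_eq_square)
  also have "(4::real) ^ j / 2 ^ j = 2 ^ j" by (simp flip: power_divide)
  also have "(4::real) ^ j / (2 ^ j * 2 ^ j) = 1" by (simp flip: power_mult_distrib)
  also have "48 * G * K * (2 ^ j * (2 * D * H * X) + 1 * X\<^sup>2) / (real j * real j powr \<theta> * real J2)
      \<le> 48 * G * K * (2 ^ J2 * (2 * D * H * X) + 1 * X\<^sup>2) / (real j * real j powr \<theta> * real J2)"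
  proof (intro divide_right_mono mult_left_mono add_right_mono mult_right_mono)
    show "(2::real) ^ j \<le> 2 ^ J2" using j by (intro power_increasing) auto
  qed (use G K D X_pos jp in auto)
  finally show ?thesis by (simp add: mult_ac)
qed

text \<open>Cauchy-Schwarz over the blocks with weights \<open>1 / j\<close> produces one factor
  \<open>harmonic_between\<close>. The remaining summand is \<open>j powr (- \<theta>) / J2\<close>,
  at most \<open>J2 powr (- \<theta>) / j\<close> because \<open>\<theta> <= 1\<close>, and its sum
  produces the second factor.\<close>

lemma sum_all_blocks_le:
  assumes G: "G \<ge> 0" and \<theta>: "0 \<le> \<theta>" "\<theta> \<le> 1"
    and B: "\<And>t j v. t \<in> T \<Longrightarrow> J1 \<le> j \<Longrightarrow> j < J2 \<Longrightarrow> v < H \<Longrightarrow>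
      (cmod (\<Sum>p\<in>slot_primes j v. f p * \<psi> t p))\<^sup>2 \<le> G * 4 ^ j / ((real j)\<^sup>2 * real j powr \<theta>)"
  shows "(\<Sum>t\<in>T. (cmod (\<Sum>j=J1..<J2. \<Sum>(p, m)\<in>pairs j. f (p * m) * \<psi> t (p * m)))\<^sup>2)
    \<le> 48 * G * K * (2 * D * H * X * 2 ^ J2 + X\<^sup>2) * ((harmonic_between J1 J2)\<^sup>2 / real J2 powr \<theta>)"
proof -
  define M where "M t j = (\<Sum>(p, m)\<in>pairs j. f (p * m) * \<psi> t (p * m))" for t j
  define A where "A = 48 * G * K * (2 * D * H * X * 2 ^ J2 + X\<^sup>2)"
  define h where "h = harmonic_between J1 J2"
  have A0: "A \<ge> 0" unfolding A_def using G K D X_pos by auto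
  have h0: "h \<ge> 0" by (simp add: h_def)
  have "(\<Sum>t\<in>T. (cmod (\<Sum>j=J1..<J2. M t j))\<^sup>2) \<le> (\<Sum>t\<in>T. h * (\<Sum>j=J1..<J2. real j * (cmod (M t j))\<^sup>2))"
  proof (rule sum_mono)
    fix t
    have "(cmod (\<Sum>j=J1..<J2. M t j))\<^sup>2 \<le> (\<Sum>j=J1..<J2. (1 / sqrt j) * (sqrt j * cmod (M t j)))\<^sup>2"
      using J1 by (intro power_mono sum_norm_le) auto
    also have "\<dots> \<le> (\<Sum>j=J1..<J2. (1 / sqrt j)\<^sup>2) * (\<Sum>j=J1..<J2. (sqrt j * cmod (M t j))\<^sup>2)"
      by (rule Cauchy_Schwarz_ineq_sum)
    also have "\<dots> = h * (\<Sum>j=J1..<J2. real j * (cmod (M t j))\<^sup>2)"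
      by (simp add: h_def harmonic_between_def power_divide power_mult_distrib)
    finally show "(cmod (\<Sum>j=J1..<J2. M t j))\<^sup>2 \<le> h * (\<Sum>j=J1..<J2. real j * (cmod (M t j))\<^sup>2)" .
  qed
  also have "\<dots> = h * (\<Sum>j=J1..<J2. real j * (\<Sum>t\<in>T. (cmod (M t j))\<^sup>2))"
    unfolding sum_distrib_left by (rule sum.swap)
  also have "\<dots> \<le> h * (\<Sum>j=J1..<J2. A / real J2 powr \<theta> * (1 / real j))"
  proof (intro mult_left_mono sum_mono h0)
    fix j assume "j \<in> {J1..<J2}"
    then have j: "J1 \<le> j" "2 \<le> j" "j < J2" using J1 by auto
    have jp: "real j > 0" "real J2 > 0" using j by auto
    have "real j * (\<Sum>t\<in>T. (cmod (M t j))\<^sup>2) \<le> real j * (A / (real j * real j powr \<theta> * real J2))"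
      unfolding M_def A_def using j B by (intro mult_left_mono sum_block_le G) auto
    also have "\<dots> = A * (real j powr (1 - \<theta>) / (real j * real J2))"
      using jp by (simp add: powr_diff)
    also have "\<dots> \<le> A * (real J2 powr (1 - \<theta>) / (real j * real J2))"
      using j \<theta> A0 by (intro mult_left_mono divide_right_mono powr_mono2) auto
    also have "\<dots> = A / real J2 powr \<theta> * (1 / real j)"
      using jp by (simp add: powr_diff)
    finally show "real j * (\<Sum>t\<in>T. (cmod (M t j))\<^sup>2) \<le> A / real J2 powr \<theta> * (1 / real j)" .
  qed
  also have "\<dots> = A * (h\<^sup>2 / real J2 powr \<theta>)"
    unfolding h_def harmonic_between_def sum_distrib_left[symmetric] by (simp add: power2_eq_square)
  finally show ?thesis by (simp add: M_def A_def h_def)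
qed

lemma sum_norm_twisted_sum_le:
  assumes "G \<ge> 0" "0 \<le> \<theta>" "\<theta> \<le> 1"
    and "\<And>t j v. t \<in> T \<Longrightarrow> J1 \<le> j \<Longrightarrow> j < J2 \<Longrightarrow> v < H \<Longrightarrow>
      (cmod (\<Sum>p\<in>slot_primes j v. f p * \<psi> t p))\<^sup>2 \<le> G * 4 ^ j / ((real j)\<^sup>2 * real j powr \<theta>)"
  shows "(\<Sum>t\<in>T. (cmod (twisted_sum f (\<psi> t) X))\<^sup>2)
    \<le> 96 * (D + X) * (K * X * (real J1 / real J2) + 18 * K\<^sup>2 * X / 2 ^ J1 + 18 * K ^ 3 * X * harmonic_between J1 J2 / J2
        + energy f {n \<in> nats_upto X. X - 2 * X / H \<le> real n})
      + 96 * G * K * (2 * D * H * X * 2 ^ J2 + X\<^sup>2) * ((harmonic_between J1 J2)\<^sup>2 / real J2 powr \<theta>)"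
proof -
  define R where "R t = (\<Sum>n\<in>remainder. f n * \<psi> t n)" for t
  define M where "M t = (\<Sum>j=J1..<J2. \<Sum>(p, m)\<in>pairs j. f (p * m) * \<psi> t (p * m))" for t
  have sq: "(cmod (x + y))\<^sup>2 \<le> 2 * (cmod x)\<^sup>2 + 2 * (cmod y)\<^sup>2" for x y
  proof -
    have "(cmod (x + y))\<^sup>2 \<le> (cmod x + cmod y)\<^sup>2" by (intro power_mono norm_triangle_ineq) auto
    also have "\<dots> \<le> 2 * (cmod x)\<^sup>2 + 2 * (cmod y)\<^sup>2"
      using sum_squares_bound[of "cmod x" "cmod y"] by (simp add: power2_sum)
    finally show ?thesis .
  qed
  have "(\<Sum>t\<in>T. (cmod (twisted_sum f (\<psi> t) X))\<^sup>2) = (\<Sum>t\<in>T. (cmod (R t + M t))\<^sup>2)"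
    by (intro sum.cong refl) (simp add: twisted_sum_decomposition R_def M_def)
  also have "\<dots> \<le> (\<Sum>t\<in>T. 2 * (cmod (R t))\<^sup>2 + 2 * (cmod (M t))\<^sup>2)"
    by (intro sum_mono sq)
  also have "\<dots> = 2 * (\<Sum>t\<in>T. (cmod (R t))\<^sup>2) + 2 * (\<Sum>t\<in>T. (cmod (M t))\<^sup>2)"
    by (simp add: sum.distrib sum_distrib_left)
  also have "(\<Sum>t\<in>T. (cmod (R t))\<^sup>2) \<le> 48 * (D + X) * energy f remainder"
    unfolding R_def using X_pos by (intro large_sieve_upto) (auto simp: remainder_def)
  also have "48 * (D + X) * energy f remainder \<le> 48 * (D + X) * (K * X * (real J1 / real J2) + 18 * K\<^sup>2 * X / 2 ^ J1 + 18 * K ^ 3 * X * harmonic_between J1 J2 / J2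
        + energy f {n \<in> nats_upto X. X - 2 * X / H \<le> real n})"
    using D X_pos by (intro mult_left_mono energy_remainder_le) auto
  also have "(\<Sum>t\<in>T. (cmod (M t))\<^sup>2) \<le> 48 * G * K * (2 * D * H * X * 2 ^ J2 + X\<^sup>2) * ((harmonic_between J1 J2)\<^sup>2 / real J2 powr \<theta>)"
    unfolding M_def by (intro sum_all_blocks_le assms)
  finally have le: "(\<Sum>t\<in>T. (cmod (twisted_sum f (\<psi> t) X))\<^sup>2)
    \<le> 2 * (48 * (D + X) * (K * X * (real J1 / real J2) + 18 * K\<^sup>2 * X / 2 ^ J1 + 18 * K ^ 3 * X * harmonic_between J1 J2 / J2
        + energy f {n \<in> nats_upto X. X - 2 * X / H \<le> real n}))
      + 2 * (48 * G * K * (2 * D * H * X * 2 ^ J2 + X\<^sup>2) * ((harmonic_between J1 J2)\<^sup>2 / real J2 powr \<theta>))"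
    by simp
  have eq: "2 * (48 * a * b) + 2 * (48 * u * v * w * z) = 96 * a * b + 96 * u * v * w * z" for a b u v w z :: real
    by (simp add: algebra_simps)
  show ?thesis using le unfolding eq .
qed

end

section \<open>Choice of the parameters\<close>

text \<open>Each of the \<open>d\<close> factors is one of the \<open>a + 1\<close> powers of
  \<open>p\<close> up to \<open>p^a\<close>. A bound polynomial in \<open>a\<close> is all that is
  used later.\<close>

lemma divisor_tau_prime_power_le:
  assumes "prime p"
  shows "divisor_tau d (p ^ a) \<le> (a + 1) ^ d"
proof -
  define A where "A = (\<lambda>i. p ^ i) ` {..a}"
  have dvd: "x dvd prod_list xs" if "x \<in> set xs" for x and xs :: "nat list"
    using that by (induction xs) auto
  have "{xs. length xs = d \<and> prod_list xs = p ^ a} \<subseteq> {xs. set xs \<subseteq> A \<and> length xs = d}"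
  proof
    fix xs assume "xs \<in> {xs. length xs = d \<and> prod_list xs = p ^ a}"
    then have xs: "length xs = d" "prod_list xs = p ^ a" by simp_all
    have "x \<in> A" if "x \<in> set xs" for x
    proof -
      have "x dvd p ^ a" using dvd[OF that] xs by simp
      then show ?thesis using assms by (auto simp: A_def divides_primepow_nat)
    qed
    then show "xs \<in> {xs. set xs \<subseteq> A \<and> length xs = d}" using xs(1) by blast
  qed
  then have "divisor_tau d (p ^ a) \<le> card {xs. set xs \<subseteq> A \<and> length xs = d}"
    unfolding divisor_tau_def by (intro card_mono finite_lists_length_eq) (auto simp: A_def)
  also have "\<dots> = card A ^ d" by (intro card_lists_length_eq) (simp add: A_def)
  also have "\<dots> \<le> (a + 1) ^ d"
    unfolding A_def using card_image_le[of "{..a}" "\<lambda>i. p ^ i"] by (intro power_mono) auto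
  finally show ?thesis .
qed

lemma polynomial_le_exponential:
  obtains C :: real where "C > 0" "\<And>a. ((real a + 1) ^ d)\<^sup>2 \<le> C * (3 / 2) ^ a"
proof -
  have "(\<lambda>a::nat. (real a + 1) ^ (2 * d) / (3 / 2) ^ a) \<longlonglongrightarrow> 0"
    by real_asymp
  then have "Bseq (\<lambda>a::nat. (real a + 1) ^ (2 * d) / (3 / 2) ^ a)"
    by (intro convergent_imp_Bseq convergentI)
  then obtain C where C: "C > 0" "\<And>a. norm ((real a + 1) ^ (2 * d) / (3 / 2) ^ a) \<le> C"
    by (elim BseqE) blast
  have "((real a + 1) ^ d)\<^sup>2 \<le> C * (3 / 2) ^ a" for a
  proof -
    have "(real a + 1) ^ (2 * d) / (3 / 2) ^ a \<le> C" using C(2)[of a] by (simp add: abs_le_iff)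
    then show ?thesis by (simp add: divide_le_eq power_mult[symmetric] mult.commute)
  qed
  then show ?thesis using that C(1) by blast
qed

text \<open>(C3) with \<open>P1 = P2 = 5 / 2\<close> sifts by no prime at all and gives the plain
  mean-square bound from \<open>max X3 (5 / 2)\<close> on. Below that the divisor bound gives a
  constant, at most that constant times \<open>x\<close> once \<open>x >= 1\<close>, and for
  \<open>x < 1\<close> the sum is empty.\<close>

lemma energy_nats_upto_le:
  assumes div: "divisor_bound d K1 f" and sieve: "sieve_bound K3 X3 f" and x: "x \<ge> 0"
  shows "energy f (nats_upto x) \<le> (\<bar>K3\<bar> + (\<Sum>n\<in>nats_upto (max X3 (5 / 2)). (K1 * real (divisor_tau d n))\<^sup>2)) * x"
proof -
  define x1 where "x1 = max X3 (5 / 2)"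
  define c where "c = (\<Sum>n\<in>nats_upto x1. (K1 * real (divisor_tau d n))\<^sup>2)"
  have c0: "c \<ge> 0" unfolding c_def by (intro sum_nonneg) auto
  have "energy f (nats_upto x) \<le> (\<bar>K3\<bar> + c) * x"
  proof (cases "x \<ge> x1")
    case True
    have no: "{p. prime p \<and> 5 / 2 \<le> real p \<and> real p \<le> 5 / 2} = {}"
    proof -
      have "real p \<noteq> 5 / 2" for p
      proof
        assume "real p = 5 / 2"
        then have "real (2 * p) = real 5" by simp
        then have "2 * p = 5" by (simp only: of_nat_eq_iff)
        then show False by presburger
      qed
      then show ?thesis by force
    qed
    have "(\<Sum>n | 1 \<le> n \<and> real n \<le> x \<and> coprime n (\<Prod>p | prime p \<and> 5 / 2 \<le> real p \<and> real p \<le> 5 / 2. p). (norm (f n))\<^sup>2)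
        \<le> K3 * (x * (\<Prod>p | prime p \<and> 5 / 2 \<le> real p \<and> real p \<le> 5 / 2. 1 - 1 / real p))"
      using sieve True unfolding sieve_bound_def x1_def
      by (elim allE[of _ x] allE[of _ "5/2"] impE) auto
    then have "energy f (nats_upto x) \<le> K3 * x"
      unfolding no by (simp add: energy_def nats_upto_def)
    also have "\<dots> \<le> (\<bar>K3\<bar> + c) * x" using x c0 by (intro mult_right_mono) auto
    finally show ?thesis .
  next
    case False
    show ?thesis
    proof (cases "x < 1")
      case True
      then have "nats_upto x = {}" by (auto simp: nats_upto_def)
      then show ?thesis using x c0 by (simp add: energy_def)
    next
      case False
      have "energy f (nats_upto x) \<le> energy f (nats_upto x1)"
        using \<open>\<not> x1 \<le> x\<close> by (intro energy_mono finite_nats_upto) (auto simp: nats_upto_def)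
      also have "\<dots> \<le> c"
        unfolding energy_def c_def
        using div by (intro sum_mono power_mono) (auto simp: divisor_bound_def nats_upto_def)
      also have "\<dots> \<le> (\<bar>K3\<bar> + c) * x"
        using False c0 mult_mono[of c "\<bar>K3\<bar> + c" 1 x] by simp
      finally show ?thesis .
    qed
  qed
  then show ?thesis by (simp add: c_def x1_def)
qed

lemma not_prime_power_of_two:
  assumes "2 \<le> j"
  shows "\<not> prime ((2::nat) ^ j)"
  using assms by (simp add: prime_power_iff)

text \<open>Since \<open>2\<^sup>j\<close> is not prime for \<open>j \<ge> 2\<close>, it makes no difference whether the end point
  \<open>2\<^sup>j\<close> is included in the sifting range.\<close>

lemma energy_rough_le:
  assumes sieve: "sieve_bound K3 X3 f"
    and C: "C > 0" "\<And>j J. 1 \<le> j \<Longrightarrow> j \<le> J \<Longrightarrow>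
      (\<Prod>p | prime p \<and> 2 ^ j < p \<and> p \<le> 2 ^ J. 1 - 1 / real p) \<le> C * (real j / real J)"
    and j: "2 \<le> j" "j \<le> J" and x: "2 ^ J \<le> x" "X3 \<le> x"
  shows "energy f (rough j J \<inter> nats_upto x) \<le> \<bar>K3\<bar> * C * x * (real j / real J)"
proof -
  define P where "P = {p. prime p \<and> (2::nat) ^ j < p \<and> p \<le> 2 ^ J}"
  have P_eq: "{p. prime p \<and> 2 ^ j \<le> real p \<and> real p \<le> 2 ^ J} = P"
  proof -
    have "2 ^ j \<le> real p \<longleftrightarrow> 2 ^ j \<le> p" "real p \<le> 2 ^ J \<longleftrightarrow> p \<le> 2 ^ J" for p
      by (metis of_nat_le_iff of_nat_numeral of_nat_power)+
    moreover have "p \<noteq> 2 ^ j" if "prime p" for p :: nat using not_prime_power_of_two[OF j(1)] that by blast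
    ultimately show ?thesis unfolding P_def by (auto simp: le_less)
  qed
  have fin: "finite P" by (rule finite_subset[of _ "{..2 ^ J}"]) (auto simp: P_def)
  have x0: "x \<ge> 0" using x(1) by (meson order_trans zero_le_numeral zero_le_power)
  have cop: "coprime n (\<Prod>p\<in>P. p) \<longleftrightarrow> (\<forall>p\<in>P. \<not> p dvd n)" for n
  proof
    assume c: "coprime n (\<Prod>p\<in>P. p)"
    show "\<forall>p\<in>P. \<not> p dvd n"
    proof (intro ballI notI)
      fix p assume p: "p \<in> P" "p dvd n"
      have "p dvd (\<Prod>p\<in>P. p)" using dvd_prodI[OF fin p(1), of "\<lambda>p. p"] .
      then have "is_unit p" using c p(2) by (metis coprime_common_divisor)
      then show False using p(1) by (auto simp: P_def)
    qed
  next
    assume "\<forall>p\<in>P. \<not> p dvd n"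
    then show "coprime n (\<Prod>p\<in>P. p)"
      by (intro prod_coprime_right) (auto simp: P_def prime_imp_coprime coprime_commute[of n])
  qed
  have set_eq: "{n. 1 \<le> n \<and> real n \<le> x \<and> coprime n (\<Prod>p\<in>P. p)} = rough j J \<inter> nats_upto x"
    unfolding cop by (auto simp: rough_def nats_upto_def P_def)
  have "(\<Sum>n | 1 \<le> n \<and> real n \<le> x \<and> coprime n (\<Prod>p | prime p \<and> 2 ^ j \<le> real p \<and> real p \<le> 2 ^ J. p). (norm (f n))\<^sup>2)
        \<le> K3 * (x * (\<Prod>p | prime p \<and> 2 ^ j \<le> real p \<and> real p \<le> 2 ^ J. 1 - 1 / real p))"
  proof -
    have "(2::real) ^ 1 \<le> 2 ^ j" "(2::real) ^ j \<le> 2 ^ J" using j by (intro power_increasing; simp)+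
    then have "x \<ge> X3 \<and> (2::real) \<le> 2 ^ j \<and> (2::real) ^ j \<le> 2 ^ J \<and> 2 ^ J \<le> x" using x by simp
    then show ?thesis using sieve unfolding sieve_bound_def by blast
  qed
  then have le: "energy f (rough j J \<inter> nats_upto x) \<le> K3 * (x * (\<Prod>p\<in>P. 1 - 1 / real p))"
    unfolding P_eq set_eq energy_def .
  have nn: "0 \<le> (\<Prod>p\<in>P. 1 - 1 / real p)"
    by (intro prod_nonneg) (auto simp: P_def)
  note le
  also have "K3 * (x * (\<Prod>p\<in>P. 1 - 1 / real p)) \<le> \<bar>K3\<bar> * (x * (C * (real j / real J)))"
  proof (intro mult_mono mult_left_mono)
    show "(\<Prod>p\<in>P. 1 - 1 / real p) \<le> C * (real j / real J)"
      unfolding P_def using j by (intro C(2)) auto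
  qed (use x0 nn in auto)
  finally show ?thesis by (simp add: mult_ac)
qed

text \<open>\<open>K\<close> is fixed before \<open>f\<close>, from the constants of the hypotheses
  alone; this carries the uniformity of the final constant.\<close>

lemma tame_multiplicative_exists:
  obtains K :: real where "K \<ge> 1" "\<And>f. multiplicative_fun f \<Longrightarrow> divisor_bound d K1 f \<Longrightarrow> sieve_bound K3 X3 f \<Longrightarrow>
    tame_multiplicative f K X3"
proof -
  obtain C where C: "C > 0" "\<And>j J. 1 \<le> j \<Longrightarrow> j \<le> J \<Longrightarrow>
      (\<Prod>p | prime p \<and> 2 ^ j < p \<and> p \<le> 2 ^ J. 1 - 1 / real p) \<le> C * (real j / real J)"
    using prod_primes_between_powers_le by blast
  obtain C' :: real where C': "C' > 0" "\<And>a. ((real a + 1) ^ d)\<^sup>2 \<le> C' * (3 / 2) ^ a"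
    using polynomial_le_exponential by blast
  define a where "a = \<bar>K3\<bar> + (\<Sum>n\<in>nats_upto (max X3 (5 / 2)). (K1 * real (divisor_tau d n))\<^sup>2)"
  define K where "K = 1 + a + \<bar>K3\<bar> * C + K1\<^sup>2 * C'"
  have a0: "a \<ge> 0" unfolding a_def by (intro add_nonneg_nonneg sum_nonneg) auto
  have K: "K \<ge> 1" "a \<le> K" "\<bar>K3\<bar> * C \<le> K" "K1\<^sup>2 * C' \<le> K"
    using a0 C(1) C'(1) by (auto simp: K_def)
  have "tame_multiplicative f K X3"
    if f: "multiplicative_fun f" "divisor_bound d K1 f" "sieve_bound K3 X3 f" for f
  proof
    show "multiplicative_fun f" "1 \<le> K" using f K by auto
  next
    fix x :: real assume x: "x \<ge> 0"
    have "energy f (nats_upto x) \<le> a * x"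
      unfolding a_def by (rule energy_nats_upto_le[OF f(2,3) x])
    also have "\<dots> \<le> K * x" using K x by (intro mult_right_mono) auto
    finally show "energy f (nats_upto x) \<le> K * x" .
  next
    fix j J :: nat and x :: real
    assume jJ: "2 \<le> j" "j \<le> J" and x: "2 ^ J \<le> x" "X3 \<le> x"
    have x0: "x \<ge> 0" using x(1) by (meson order_trans zero_le_numeral zero_le_power)
    have "energy f (rough j J \<inter> nats_upto x) \<le> \<bar>K3\<bar> * C * x * (real j / real J)"
      by (rule energy_rough_le[OF f(3) C jJ x])
    also have "\<dots> \<le> K * x * (real j / real J)" using K x0 by (intro mult_right_mono) auto
    finally show "energy f (rough j J \<inter> nats_upto x) \<le> K * x * (real j / real J)" .
  next
    fix p b :: nat assume p: "prime p"
    have "cmod (f (p ^ b)) \<le> K1 * real (divisor_tau d (p ^ b))"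
      using f(2) prime_gt_0_nat[OF p] by (simp add: divisor_bound_def)
    also have "\<dots> \<le> \<bar>K1\<bar> * real ((b + 1) ^ d)"
      using divisor_tau_prime_power_le[OF p, of d b] by (intro mult_mono) (simp_all only: of_nat_le_iff abs_ge_self abs_ge_zero of_nat_0_le_iff)
    finally have "(cmod (f (p ^ b)))\<^sup>2 \<le> (\<bar>K1\<bar> * real ((b + 1) ^ d))\<^sup>2" by (intro power_mono) auto
    also have "\<dots> = K1\<^sup>2 * ((real b + 1) ^ d)\<^sup>2" by (simp add: power_mult_distrib add.commute)
    also have "\<dots> \<le> K1\<^sup>2 * (C' * (3 / 2) ^ b)" by (intro mult_left_mono C') auto
    also have "\<dots> \<le> K * (3 / 2) ^ b"
      using K by (simp only: mult.assoc[symmetric]) (intro mult_right_mono; simp)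
    finally show "(cmod (f (p ^ b)))\<^sup>2 \<le> K * (3 / 2) ^ b" .
  qed
  then show ?thesis using that K(1) by blast
qed

lemma harmonic_between_le_ln:
  assumes "2 \<le> J1" "J1 \<le> J2"
  shows "harmonic_between J1 J2 \<le> ln (real J2)"
proof -
  \<comment> \<open>The shift by one is what \<open>1 / J <= ln J - ln (J - 1)\<close> telescopes
    to; \<open>J1 >= 2\<close> makes the right-hand side nonnegative for the empty sum.\<close>
  have "harmonic_between J1 J2 \<le> ln (real J2 - 1)"
    using assms(2)
  proof (induction J2 rule: dec_induct)
    case base
    then show ?case using assms by (simp add: harmonic_between_def)
  next
    case (step J)
    have J: "real J \<ge> 2" using step assms by simp
    have "ln ((real J - 1) / real J) \<le> (real J - 1) / real J - 1"
      using J by (intro ln_le_minus_one) auto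
    moreover have "ln ((real J - 1) / real J) = ln (real J - 1) - ln (real J)"
      using J by (subst ln_div) auto
    moreover have "(real J - 1) / real J - 1 = - (1 / real J)"
      using J by (simp add: field_simps)
    ultimately have "1 / real J \<le> ln (real J) - ln (real J - 1)" by linarith
    then show ?case using step by (simp add: harmonic_between_def)
  qed
  also have "\<dots> \<le> ln (real J2)" using assms by (intro ln_mono) auto
  finally show ?thesis .
qed

text \<open>With \<open>L = ln X\<close> the five small quantities are at most of the orders
  \<open>L powr (\<alpha> - 1) * ln L\<close>, \<open>exp (- (L powr \<alpha>))\<close>,
  \<open>(ln L)^2 / L\<close>, \<open>1 / L\<close> and, up to a power of \<open>ln L\<close>,
  \<open>L powr (- \<theta>)\<close>. The strict inequalities for \<open>\<eta>\<close> absorb all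
  logarithms of \<open>L\<close>.\<close>

lemma sieving_parameters_exist:
  fixes \<alpha> \<eta> \<theta> \<epsilon> x0 :: real
  assumes \<alpha>: "0 < \<alpha>" "\<alpha> < 1" "\<eta> < 1 - \<alpha>" and \<theta>: "0 < \<theta>" "\<eta> < \<theta>" and \<epsilon>: "\<epsilon> > 0"
  shows "\<forall>\<^sub>F X in at_top. \<exists>J1 J2 H :: nat. 2 \<le> J1 \<and> J1 \<le> J2 \<and> 4 \<le> H \<and> real H \<le> ln X \<and>
    exp (ln X powr \<alpha>) \<le> 2 ^ J1 \<and> 2 ^ J2 \<le> exp (ln X / ln (ln X)) \<and>
    8 ^ J2 \<le> X \<and> x0 * 4 ^ J2 \<le> X \<and> x0 \<le> X \<and>
    real J1 / real J2 \<le> 6 * ln X powr (- \<eta>) \<and> 1 / 2 ^ J1 \<le> ln X powr (- \<eta>) \<and>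
    harmonic_between J1 J2 / real J2 \<le> 2 * ln X powr (- \<eta>) \<and> 1 / real H \<le> ln X powr (- \<eta>) \<and>
    (harmonic_between J1 J2)\<^sup>2 / real J2 powr \<theta> \<le> ln X powr (- \<eta>) \<and> real H * 2 ^ J2 \<le> X powr \<epsilon>"
    (is "\<forall>\<^sub>F X in at_top. ?P X")
proof -
  have \<eta>1: "\<eta> < 1" using \<alpha> by simp
  have "\<forall>\<^sub>F L in at_top. L \<ge> (5::real)" by (rule eventually_ge_at_top)
  moreover have "\<forall>\<^sub>F L::real in at_top. ln L \<ge> 2" by real_asymp
  moreover have "\<forall>\<^sub>F L::real in at_top. L powr (\<alpha> - 1) * ln L \<le> L powr (- \<eta>)"
    using \<alpha> by real_asymp
  moreover have "\<forall>\<^sub>F L::real in at_top. exp (- (L powr \<alpha>)) \<le> L powr (- \<eta>)"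
    using \<alpha> by real_asymp
  moreover have "\<forall>\<^sub>F L::real in at_top. ln L / (L / ln L) \<le> L powr (- \<eta>)"
    using \<eta>1 by real_asymp
  moreover have "\<forall>\<^sub>F L::real in at_top. 2 / L \<le> L powr (- \<eta>)"
    using \<eta>1 by real_asymp
  moreover have "\<forall>\<^sub>F L::real in at_top. (ln L)\<^sup>2 / (L / (2 * ln L)) powr \<theta> \<le> L powr (- \<eta>)"
    using \<theta> by real_asymp
  moreover have "\<forall>\<^sub>F L::real in at_top. L * exp (L / ln L) \<le> exp (\<epsilon> * L)"
    using \<epsilon> by real_asymp
  moreover have "\<forall>\<^sub>F L::real in at_top. exp (3 * (L / ln L)) \<le> exp L" by real_asymp
  moreover have "\<forall>\<^sub>F L::real in at_top. \<bar>x0\<bar> * exp (2 * (L / ln L)) \<le> exp L" by real_asymp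
  moreover have "\<forall>\<^sub>F L::real in at_top. L powr \<alpha> / ln 2 + 1 \<le> L / (ln 2 * ln L) - 1"
    using \<alpha> by real_asymp
  moreover have "\<forall>\<^sub>F L::real in at_top. L powr \<alpha> \<ge> 2" using \<alpha> by real_asymp
  moreover have "\<forall>\<^sub>F L::real in at_top. L / ln L - 1 \<ge> L / (2 * ln L)" by real_asymp
  ultimately have "\<forall>\<^sub>F L in at_top. ?P (exp L)"
  proof eventually_elim
    case (elim L)
    have l2: "ln (2::real) > 0" "ln (2::real) < 1" "ln (2::real) \<ge> 1 / 2"
      using ln_2_less_1 ln_le_minus_one[of "1 / 2 :: real"] by (auto simp: ln_div)
    have L: "L > 0" "ln L > 0" using elim(1,2) by auto
    \<comment> \<open>The rounding keeps the eligible range inside that of (C4): \<open>J1\<close>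
      is rounded up, \<open>J2\<close> and \<open>H\<close> are rounded down.\<close>
    define J1 where "J1 = nat \<lceil>L powr \<alpha> / ln 2\<rceil>"
    define J2 where "J2 = nat \<lfloor>L / (ln 2 * ln L)\<rfloor>"
    define H where "H = nat \<lfloor>L\<rfloor>"
    have La: "2 \<le> L powr \<alpha> / ln 2" "L powr \<alpha> / ln 2 \<le> 2 * L powr \<alpha>"
    proof -
      have "L powr \<alpha> * 1 \<le> L powr \<alpha> * (2 * ln 2)" "L powr \<alpha> * ln 2 \<le> L powr \<alpha> * 1"
        using elim(12) l2 by (intro mult_left_mono; simp)+
      moreover have "2 * ln 2 \<le> L powr \<alpha>" using elim(12) l2 by linarith
      ultimately show "2 \<le> L powr \<alpha> / ln 2" "L powr \<alpha> / ln 2 \<le> 2 * L powr \<alpha>"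
        using elim(12) l2 by (simp_all add: pos_le_divide_eq pos_divide_le_eq)
    qed
    have J1: "L powr \<alpha> / ln 2 \<le> real J1" "real J1 \<le> L powr \<alpha> / ln 2 + 1"
      using La unfolding J1_def by linarith+
    have J2a: "real J2 \<le> L / (ln 2 * ln L)" "L / (ln 2 * ln L) - 1 \<le> real J2"
    proof -
      have "0 \<le> L / (ln 2 * ln L)" using L l2 by simp
      then show "real J2 \<le> L / (ln 2 * ln L)" "L / (ln 2 * ln L) - 1 \<le> real J2"
        unfolding J2_def by linarith+
    qed
    have "L / ln L \<le> L / (ln 2 * ln L)"
      using L l2 by (intro divide_left_mono mult_pos_pos) auto
    then have J2: "L / (2 * ln L) \<le> real J2" using J2a elim(13) by linarith
    have J2pos: "L / (2 * ln L) > 0" using L by simp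
    have J2le: "real J2 \<le> L"
    proof -
      have "1 \<le> ln 2 * ln L" using l2 elim(2) mult_mono[of "1/2" "ln 2" 2 "ln L"] by simp
      then have "L / (ln 2 * ln L) \<le> L / 1" using L by (intro divide_left_mono) auto
      then show ?thesis using J2a by simp
    qed
    have j12: "2 \<le> J1" "J1 \<le> J2"
    proof -
      have "2 \<le> real J1" using La J1 by linarith
      then show "2 \<le> J1" by linarith
      have "real J1 \<le> real J2" using J1 J2a elim(11) by linarith
      then show "J1 \<le> J2" by simp
    qed
    have H: "4 \<le> H" "real H \<le> L" "L / 2 \<le> real H"
      using elim(1) unfolding H_def by linarith+
    have pow1: "exp (L powr \<alpha>) \<le> 2 ^ J1"
    proof -
      have "L powr \<alpha> \<le> real J1 * ln 2" using J1(1) l2 by (simp add: field_simps)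
      then have "exp (L powr \<alpha>) \<le> exp (real J1 * ln 2)" by simp
      also have "\<dots> = 2 ^ J1" by (simp add: exp_of_nat_mult)
      finally show ?thesis .
    qed
    have pow2: "2 ^ J2 \<le> exp (L / ln L)"
    proof -
      have "real J2 * ln 2 \<le> L / ln L" using J2a(1) l2 L by (simp add: field_simps)
      then have "exp (real J2 * ln 2) \<le> exp (L / ln L)" by simp
      moreover have "exp (real J2 * ln 2) = 2 ^ J2" by (simp add: exp_of_nat_mult)
      ultimately show ?thesis by simp
    qed
    have pow8: "8 ^ J2 \<le> exp L"
    proof -
      have "(8::real) ^ J2 = (2 ^ J2) ^ 3" by (simp add: power_mult[symmetric] mult.commute[of J2] power_mult)
      also have "\<dots> \<le> exp (L / ln L) ^ 3" by (intro power_mono pow2) auto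
      also have "\<dots> = exp (3 * (L / ln L))" by (simp flip: exp_of_nat_mult)
      finally show ?thesis using elim(9) by linarith
    qed
    have pow4: "x0 * 4 ^ J2 \<le> exp L" "x0 \<le> exp L"
    proof -
      have "(4::real) ^ J2 = (2 ^ J2) ^ 2" by (simp add: power_mult[symmetric] mult.commute[of J2] power_mult)
      also have "\<dots> \<le> exp (L / ln L) ^ 2" by (intro power_mono pow2) auto
      also have "\<dots> = exp (2 * (L / ln L))" by (simp flip: exp_of_nat_mult)
      finally have 4: "(4::real) ^ J2 \<le> exp (2 * (L / ln L))" .
      have "x0 * 4 ^ J2 \<le> \<bar>x0\<bar> * 4 ^ J2" by (intro mult_right_mono) auto
      also have "\<dots> \<le> \<bar>x0\<bar> * exp (2 * (L / ln L))" by (intro mult_left_mono 4) auto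
      finally show "x0 * 4 ^ J2 \<le> exp L" using elim(10) by linarith
      have "x0 \<le> \<bar>x0\<bar> * 1" by simp
      also have "\<dots> \<le> \<bar>x0\<bar> * exp (2 * (L / ln L))" using L by (intro mult_left_mono) auto
      finally show "x0 \<le> exp L" using elim(10) by linarith
    qed
    have h: "harmonic_between J1 J2 \<le> ln L"
    proof -
      have "harmonic_between J1 J2 \<le> ln (real J2)" by (rule harmonic_between_le_ln[OF j12])
      also have "\<dots> \<le> ln L" using J2le j12 L by (subst ln_le_cancel_iff) auto
      finally show ?thesis .
    qed
    have e1: "real J1 / real J2 \<le> 6 * L powr (- \<eta>)"
    proof -
      have "real J1 / real J2 \<le> (3 * L powr \<alpha>) / (L / (2 * ln L))"
        using J1(2) La J2 J2pos elim(12) by (intro frac_le) auto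
      also have "\<dots> = 6 * (L powr (\<alpha> - 1) * ln L)"
        using L by (simp add: powr_diff)
      also have "\<dots> \<le> 6 * L powr (- \<eta>)" using elim(3) by simp
      finally show ?thesis .
    qed
    have e2: "1 / 2 ^ J1 \<le> L powr (- \<eta>)"
    proof -
      have "1 / 2 ^ J1 \<le> 1 / exp (L powr \<alpha>)" by (intro divide_left_mono pow1) auto
      also have "\<dots> = exp (- (L powr \<alpha>))" by (simp add: exp_minus inverse_eq_divide)
      finally show ?thesis using elim(4) by linarith
    qed
    have e3: "harmonic_between J1 J2 / real J2 \<le> 2 * L powr (- \<eta>)"
    proof -
      have "harmonic_between J1 J2 / real J2 \<le> ln L / (L / (2 * ln L))"
        using h L J2 J2pos by (intro frac_le) auto
      also have "\<dots> = 2 * (ln L / (L / ln L))" by simp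
      finally show ?thesis using elim(5) by linarith
    qed
    have e4: "1 / real H \<le> L powr (- \<eta>)"
    proof -
      have "1 / real H \<le> 1 / (L / 2)" using H L by (intro divide_left_mono) auto
      also have "\<dots> = 2 / L" by simp
      finally show ?thesis using elim(6) by linarith
    qed
    have e5: "(harmonic_between J1 J2)\<^sup>2 / real J2 powr \<theta> \<le> L powr (- \<eta>)"
    proof -
      have "(harmonic_between J1 J2)\<^sup>2 / real J2 powr \<theta> \<le> (ln L)\<^sup>2 / (L / (2 * ln L)) powr \<theta>"
        using h L J2 J2pos \<theta> by (intro frac_le power_mono powr_mono2) auto
      then show ?thesis using elim(7) by linarith
    qed
    have e6: "real H * 2 ^ J2 \<le> exp L powr \<epsilon>"
    proof -
      have "real H * 2 ^ J2 \<le> L * exp (L / ln L)" using H(2) L by (intro mult_mono pow2) auto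
      also have "\<dots> \<le> exp (\<epsilon> * L)" by (rule elim(8))
      also have "\<dots> = exp L powr \<epsilon>" by (simp add: powr_def)
      finally show ?thesis .
    qed
    show ?case
      unfolding ln_exp
      using j12 H(1,2) pow1 pow2 pow8 pow4 e1 e2 e3 e4 e5 e6 by blast
  qed
  then have "\<forall>\<^sub>F X in at_top. ?P (exp (ln X))"
    by (rule eventually_compose_filterlim[OF _ ln_at_top])
  moreover have "\<forall>\<^sub>F X::real in at_top. X > 0" by (rule eventually_gt_at_top)
  ultimately show ?thesis
    by eventually_elim simp
qed

section \<open>The mean square over a family of characters\<close>

text \<open>The integers near \<open>X\<close> lie in \<open>[X', X' + Y]\<close> with
  \<open>X' + Y = X\<close>. The chosen \<open>\<delta>\<close> makes
  \<open>X' powr (1 - \<delta> X')\<close> equal to \<open>X' / (ln X')^2\<close>, which is below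
  \<open>Y\<close> because \<open>H <= ln X\<close>. As \<open>\<delta>\<close> is one fixed
  function, the threshold \<open>X2 \<delta>\<close> is a constant.\<close>

lemma energy_boundary_le:
  fixes X2 :: "(real \<Rightarrow> real) \<Rightarrow> real" and X :: real
  defines "\<delta> \<equiv> \<lambda>x. 2 * ln (ln x) / ln x"
  assumes avg: "average_bound K2 X2 f" and X: "2 * X2 \<delta> \<le> X" "4 \<le> X" and H: "4 \<le> H" "real H \<le> ln X"
  shows "energy f {n \<in> nats_upto X. X - 2 * X / H \<le> real n} \<le> \<bar>K2\<bar> * (2 * X / H)"
proof -
  define Y where "Y = 2 * X / H"
  define X' where "X' = X - Y"
  have Y: "0 < Y" "Y \<le> X / 2" using X H by (auto simp: Y_def field_simps)
  then have X': "X / 2 \<le> X'" "X' \<le> X" "X' > 0" using X by (auto simp: X'_def)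
  have lnX: "4 \<le> ln X" using H by linarith
  have lnX': "ln X / 2 \<le> ln X'"
  proof -
    have "ln X / 2 \<le> ln X - ln 2" using lnX ln_2_less_1 by linarith
    also have "\<dots> = ln (X / 2)" using X by (subst ln_div) auto
    also have "\<dots> \<le> ln X'" using X' X by (intro ln_mono) auto
    finally show ?thesis .
  qed
  have "X' powr (1 - \<delta> X') = X' / (ln X')\<^sup>2"
  proof -
    have "(1 - \<delta> X') * ln X' = ln X' - 2 * ln (ln X')"
      using lnX lnX' by (simp add: \<delta>_def left_diff_distrib)
    then have "X' powr (1 - \<delta> X') = exp (ln X' - 2 * ln (ln X'))" using X' by (simp add: powr_def)
    also have "\<dots> = X' / exp (2 * ln (ln X'))" using X' by (simp add: exp_diff)
    also have "exp (2 * ln (ln X')) = (ln X')\<^sup>2"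
      using lnX lnX' by (simp add: exp_double)
    finally show ?thesis .
  qed
  also have "\<dots> \<le> X / H"
  proof (rule frac_le)
    \<comment> \<open>\<open>4 <= H <= ln X\<close> gives \<open>ln X / 4 >= 1\<close>.\<close>
    have "real H * 1 \<le> ln X * (ln X / 4)" using H lnX by (intro mult_mono) auto
    also have "\<dots> = (ln X / 2)\<^sup>2" by (simp add: power2_eq_square)
    also have "\<dots> \<le> (ln X')\<^sup>2" using lnX lnX' by (intro power_mono) auto
    finally show "real H \<le> (ln X')\<^sup>2" by simp
  qed (use X X' H in auto)
  also have "\<dots> \<le> Y" using X H by (auto simp: Y_def field_simps)
  finally have low: "X' powr (1 - \<delta> X') \<le> Y" .
  have \<delta>: "(\<delta> \<longlongrightarrow> 0) at_top" unfolding \<delta>_def by real_asymp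
  have "X' \<ge> 2 \<and> X' \<ge> X2 \<delta> \<and> X' powr (1 - \<delta> X') \<le> Y \<and> Y \<le> X'"
    using X X' Y low by auto
  then have "(\<Sum>n | X' \<le> real n \<and> real n \<le> X' + Y. (norm (f n))\<^sup>2) \<le> K2 * Y"
    using avg \<delta> unfolding average_bound_def by blast
  moreover have "energy f {n \<in> nats_upto X. X - 2 * X / H \<le> real n} \<le> energy f {n. X' \<le> real n \<and> real n \<le> X' + Y}"
  proof (rule energy_mono)
    show "finite {n. X' \<le> real n \<and> real n \<le> X' + Y}"
      by (rule finite_subset[of _ "{..nat \<lfloor>X' + Y\<rfloor>}"]) (auto simp: le_nat_floor)
  qed (auto simp: nats_upto_def X'_def Y_def)
  ultimately have "energy f {n \<in> nats_upto X. X - 2 * X / H \<le> real n} \<le> K2 * Y"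
    by (simp add: energy_def)
  also have "\<dots> \<le> \<bar>K2\<bar> * Y" using Y by (intro mult_right_mono) auto
  finally show ?thesis by (simp add: Y_def)
qed

context factored_sum
begin

text \<open>The primes attached to a slot are exactly those in \<open>[Y, Y + h]\<close> with
  \<open>Y = 2^j\<close>, the left end point being no prime. By \<open>v + 2 <= H <= ln X\<close>
  the interval is long enough for (C4), whose bound is the same for every admissible
  \<open>h\<close>.\<close>

lemma slot_primes_sum_le:
  assumes canc: "prime_cancellation \<beta> \<gamma> K4 X {g} f" and \<delta>: "\<delta> > 0"
    and range: "exp (ln X powr (\<beta> + \<delta>)) \<le> 2 ^ J1" "2 ^ J2 \<le> exp (ln X / ln (ln X))"
    and HX: "real H \<le> ln X" and j: "J1 \<le> j" "j < J2"
  shows "cmod (\<Sum>p\<in>slot_primes j v. f p * g p) \<le> \<bar>K4 \<delta>\<bar> * (2 ^ j / ln (2 ^ j) powr (1 + \<gamma>))"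
proof (cases "Suc v < H")
  case False
  then have "slot_primes j v = {}" using slot_primes_nonempty by blast
  then show ?thesis by simp
next
  case True
  define Y :: real where "Y = 2 ^ j"
  \<comment> \<open>The first entry of the minimum is the end of the block, the second the bound
    \<open>p (v + 1) <= 2^j H\<close>.\<close>
  define h where "h = min Y (Y * real H / (real v + 1) - Y)"
  have Y: "Y > 0" by (simp add: Y_def)
  have lnX: "ln X \<ge> 1" "ln X > 0" using HX H by linarith+
  have v: "real v + 2 \<le> real H" using True by linarith
  have "exp (ln X powr (\<beta> + \<delta>)) \<le> Y"
    using order_trans[OF range(1) power_increasing[OF j(1)]] by (simp add: Y_def)
  moreover have "Y \<le> exp (ln X / ln (ln X))"
    using order_trans[OF power_increasing[OF less_imp_le[OF j(2)]] range(2)] by (simp add: Y_def)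
  moreover have "Y / ln X \<le> h"
  proof -
    have "Y / ln X \<le> Y / 1" using lnX Y by (intro divide_left_mono) auto
    moreover have "Y / ln X \<le> Y * real H / (real v + 1) - Y"
    proof -
      have "Y / ln X \<le> Y / (real v + 1)" using v HX Y by (intro divide_left_mono) auto
      also have "\<dots> = Y * 1 / (real v + 1)" by simp
      also have "\<dots> \<le> Y * (real H - (real v + 1)) / (real v + 1)"
        using v Y by (intro divide_right_mono mult_left_mono) auto
      also have "\<dots> = Y * real H / (real v + 1) - Y"
        by (simp add: right_diff_distrib diff_divide_distrib)
      finally show ?thesis .
    qed
    ultimately show ?thesis by (simp add: h_def)
  qed
  moreover have "h \<le> Y" by (simp add: h_def)
  ultimately have "norm (\<Sum>p | prime p \<and> Y \<le> real p \<and> real p \<le> Y + h. f p * g p) \<le> K4 \<delta> * (Y / ln Y powr (1 + \<gamma>))"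
    using canc \<delta> unfolding prime_cancellation_def by blast
  moreover have "{p. prime p \<and> Y \<le> real p \<and> real p \<le> Y + h} = slot_primes j v"
  proof -
    have "Y \<le> real p \<and> real p \<le> Y + h \<longleftrightarrow> 2 ^ j < p \<and> p \<le> 2 ^ Suc j \<and> real p * (real v + 1) \<le> 2 ^ j * real H"
      if "prime p" for p :: nat
    proof -
      have "p \<noteq> 2 ^ j" using not_prime_power_of_two[of j] that j J1 by auto
      then have "Y \<le> real p \<longleftrightarrow> 2 ^ j < p"
        unfolding Y_def by (metis le_less of_nat_le_iff of_nat_numeral of_nat_power)
      moreover have "real p \<le> Y + h \<longleftrightarrow> real p \<le> 2 * Y \<and> real p \<le> Y * real H / (real v + 1)"
        by (auto simp: h_def)
      moreover have "real p \<le> 2 * Y \<longleftrightarrow> p \<le> 2 ^ Suc j"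
        unfolding Y_def by (metis of_nat_le_iff of_nat_numeral of_nat_power power_Suc)
      moreover have "real p \<le> Y * real H / (real v + 1) \<longleftrightarrow> real p * (real v + 1) \<le> 2 ^ j * real H"
        unfolding Y_def by (rule pos_le_divide_eq) simp
      ultimately show ?thesis by blast
    qed
    then show ?thesis unfolding slot_primes_def prime_block_def by blast
  qed
  ultimately have "cmod (\<Sum>p\<in>slot_primes j v. f p * g p) \<le> K4 \<delta> * (Y / ln Y powr (1 + \<gamma>))" by simp
  also have "\<dots> \<le> \<bar>K4 \<delta>\<bar> * (Y / ln Y powr (1 + \<gamma>))"
    using Y by (intro mult_right_mono) auto
  finally show ?thesis by (simp add: Y_def)
qed

lemma slot_primes_sum_square_le:
  assumes "prime_cancellation \<beta> \<gamma> K4 X {g} f" "\<delta> > 0"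
    "exp (ln X powr (\<beta> + \<delta>)) \<le> 2 ^ J1" "2 ^ J2 \<le> exp (ln X / ln (ln X))"
    "real H \<le> ln X" "J1 \<le> j" "j < J2" and \<theta>: "\<theta> \<le> 2 * \<gamma>"
  shows "(cmod (\<Sum>p\<in>slot_primes j v. f p * g p))\<^sup>2
    \<le> ((K4 \<delta>)\<^sup>2 / ln 2 powr (2 + 2 * \<gamma>)) * 4 ^ j / ((real j)\<^sup>2 * real j powr \<theta>)"
proof -
  have j: "real j \<ge> 1" using assms(6) J1 by simp
  have "(cmod (\<Sum>p\<in>slot_primes j v. f p * g p))\<^sup>2 \<le> (\<bar>K4 \<delta>\<bar> * (2 ^ j / ln (2 ^ j) powr (1 + \<gamma>)))\<^sup>2"
    by (intro power_mono slot_primes_sum_le[OF assms(1-7)]) auto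
  also have "\<dots> = (K4 \<delta>)\<^sup>2 * (2 ^ j)\<^sup>2 / (ln (2 ^ j) powr (1 + \<gamma>))\<^sup>2"
    by (simp add: power_mult_distrib power_divide)
  also have "(ln (2 ^ j) powr (1 + \<gamma>))\<^sup>2 = ln (2 ^ j) powr (2 + 2 * \<gamma>)"
    by (simp add: power2_eq_square powr_add[symmetric])
  also have "ln (2 ^ j :: real) = real j * ln 2" by (simp add: ln_realpow)
  also have "(real j * ln 2) powr (2 + 2 * \<gamma>) = ln 2 powr (2 + 2 * \<gamma>) * ((real j)\<^sup>2 * real j powr (2 * \<gamma>))"
    using j by (simp add: powr_mult powr_add powr_numeral mult_ac)
  also have "((2::real) ^ j)\<^sup>2 = 4 ^ j" by (simp add: power_mult[symmetric] mult.commute[of j] power_mult)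
  also have "(K4 \<delta>)\<^sup>2 * 4 ^ j / (ln 2 powr (2 + 2 * \<gamma>) * ((real j)\<^sup>2 * real j powr (2 * \<gamma>)))
      \<le> (K4 \<delta>)\<^sup>2 * 4 ^ j / (ln 2 powr (2 + 2 * \<gamma>) * ((real j)\<^sup>2 * real j powr \<theta>))"
    using j \<theta> by (intro divide_left_mono mult_left_mono powr_mono mult_pos_pos) auto
  finally show ?thesis by simp
qed

end

text \<open>Beyond a threshold \<open>X0\<close> the sieving parameters are available; below it the
  large sieve over all \<open>n <= X\<close> suffices. Neither \<open>X0\<close> nor
  \<open>C\<close> depends on \<open>f\<close>, \<open>T\<close>, \<open>\<psi>\<close>,
  \<open>D\<close> or \<open>X\<close>.\<close>

lemma character_family_mean_square:
  fixes d :: nat and \<beta> \<gamma> \<eta> \<epsilon> K1 K2 K3 X3 :: real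
    and X2 :: "(real \<Rightarrow> real) \<Rightarrow> real" and K4 :: "real \<Rightarrow> real"
  assumes \<beta>: "0 \<le> \<beta>" "\<beta> < 1" and \<gamma>: "\<gamma> > 0" and \<eta>: "\<eta> < min (2 / 3 * \<gamma>) (1 - \<beta>)" and \<epsilon>: "\<epsilon> > 0"
  obtains C where "C \<ge> 0"
    and "\<And>f (T :: 't set) \<psi> D X. multiplicative_fun f \<Longrightarrow> divisor_bound d K1 f \<Longrightarrow> average_bound K2 X2 f \<Longrightarrow>
      sieve_bound K3 X3 f \<Longrightarrow> character_family T \<psi> D \<Longrightarrow> X \<ge> 2 \<Longrightarrow>
      (\<And>t. t \<in> T \<Longrightarrow> prime_cancellation \<beta> \<gamma> K4 X {\<psi> t} f) \<Longrightarrow>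
      (\<Sum>t\<in>T. (norm (twisted_sum f (\<psi> t) X))\<^sup>2) \<le> C * (D * X powr (1 + \<epsilon>) + X\<^sup>2 / ln X powr \<eta>)"
proof -
  obtain K :: real where K1: "K \<ge> 1" and tame: "\<And>f. multiplicative_fun f \<Longrightarrow> divisor_bound d K1 f \<Longrightarrow>
      sieve_bound K3 X3 f \<Longrightarrow> tame_multiplicative f K X3"
    using tame_multiplicative_exists[of d K1 K3 X3] by metis
  define \<delta> where "\<delta> = (\<lambda>x::real. 2 * ln (ln x) / ln x)"
  \<comment> \<open>\<open>\<eta>\<close> may be negative. With \<open>\<eta>' >= 0\<close> the
    factor \<open>ln X powr (- \<eta>')\<close> is at most \<open>1\<close>, as the terms with
    \<open>D\<close> require.\<close>
  define \<eta>' where "\<eta>' = max \<eta> 0"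
  \<comment> \<open>Half the gap, so that the exponent \<open>\<beta> + \<kappa>\<close> of the
    lower end lies strictly between \<open>\<beta>\<close> and \<open>1 - \<eta>'\<close>.\<close>
  define \<kappa> where "\<kappa> = (1 - \<beta> - \<eta>') / 2"
  \<comment> \<open>The squared prime sums save \<open>j powr (2 * \<gamma>)\<close>; the density
    \<open>j / J2\<close> of the cofactors limits the exponent that survives the summation over
    blocks to \<open>1\<close>.\<close>
  define \<theta> where "\<theta> = min (2 * \<gamma>) 1"
  have par: "\<kappa> > 0" "0 < \<beta> + \<kappa>" "\<beta> + \<kappa> < 1" "\<eta>' < 1 - (\<beta> + \<kappa>)" "0 < \<theta>" "\<theta> \<le> 1" "\<eta>' < \<theta>" "\<theta> \<le> 2 * \<gamma>" "\<eta> \<le> \<eta>'" "\<eta>' \<ge> 0"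
  proof -
    have *: "\<eta>' < 1 - \<beta>" "\<eta>' < 2 * \<gamma>" "\<eta>' \<ge> 0" "\<eta> \<le> \<eta>'"
      using \<beta> \<gamma> \<eta> by (auto simp: \<eta>'_def)
    have \<kappa>: "\<kappa> * 2 = 1 - \<beta> - \<eta>'" by (simp add: \<kappa>_def)
    show "\<kappa> > 0" "0 < \<beta> + \<kappa>" "\<beta> + \<kappa> < 1" "\<eta>' < 1 - (\<beta> + \<kappa>)" "\<eta> \<le> \<eta>'" "\<eta>' \<ge> 0"
      using * \<kappa> \<beta> by linarith+
    show "0 < \<theta>" "\<theta> \<le> 1" "\<eta>' < \<theta>" "\<theta> \<le> 2 * \<gamma>"
      using * \<beta> \<gamma> by (auto simp: \<theta>_def)
  qed
  define G where "G = (K4 \<kappa>)\<^sup>2 / ln 2 powr (2 + 2 * \<gamma>)"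
  define A where "A = 6 * K + 18 * K\<^sup>2 + 36 * K ^ 3 + 2 * \<bar>K2\<bar>"
  have G0: "G \<ge> 0" by (simp add: G_def)
  have A0: "A \<ge> 0" using K1 by (simp add: A_def)
  obtain X1 where X1: "\<And>X. X \<ge> X1 \<Longrightarrow> \<exists>J1 J2 H :: nat. 2 \<le> J1 \<and> J1 \<le> J2 \<and> 4 \<le> H \<and> real H \<le> ln X \<and>
    exp (ln X powr (\<beta> + \<kappa>)) \<le> 2 ^ J1 \<and> 2 ^ J2 \<le> exp (ln X / ln (ln X)) \<and>
    8 ^ J2 \<le> X \<and> X3 * 4 ^ J2 \<le> X \<and> X3 \<le> X \<and>
    real J1 / real J2 \<le> 6 * ln X powr (- \<eta>') \<and> 1 / 2 ^ J1 \<le> ln X powr (- \<eta>') \<and>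
    harmonic_between J1 J2 / real J2 \<le> 2 * ln X powr (- \<eta>') \<and> 1 / real H \<le> ln X powr (- \<eta>') \<and>
    (harmonic_between J1 J2)\<^sup>2 / real J2 powr \<theta> \<le> ln X powr (- \<eta>') \<and> real H * 2 ^ J2 \<le> X powr \<epsilon>"
    using sieving_parameters_exist[OF par(2,3,4,5,7) \<epsilon>, of X3] unfolding eventually_at_top_linorder by blast
  define X0 where "X0 = max (max X1 4) (2 * X2 \<delta>)"
  \<comment> \<open>The first two terms serve \<open>X >= X0\<close>, the last one serves
    \<open>X < X0\<close>.\<close>
  define C where "C = 96 * A + 192 * G * K + 48 * K * (1 + X0)"
  have C: "C \<ge> 0" "96 * A + 192 * G * K \<le> C" "48 * K * (1 + X0) \<le> C"
    using K1 G0 A0 by (auto simp: C_def X0_def)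
  have main: "(\<Sum>t\<in>T. (norm (twisted_sum f (\<psi> t) X))\<^sup>2) \<le> C * (D * X powr (1 + \<epsilon>) + X\<^sup>2 / ln X powr \<eta>)"
    if f: "multiplicative_fun f" "divisor_bound d K1 f" "average_bound K2 X2 f" "sieve_bound K3 X3 f"
      and family: "character_family T \<psi> D" and X: "X \<ge> 2"
      and canc: "\<And>t. t \<in> T \<Longrightarrow> prime_cancellation \<beta> \<gamma> K4 X {\<psi> t} f"
    for f and T :: "'t set" and \<psi> D X
  proof -
    interpret tame_multiplicative f K X3 by (rule tame[OF f(1,2,4)])
    interpret character_family T \<psi> D by (rule family)
    define U where "U = D * X powr (1 + \<epsilon>)"
    define V where "V = X\<^sup>2 / ln X powr \<eta>"
    have UV: "U \<ge> 0" "V \<ge> 0" using D by (auto simp: U_def V_def)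
    have DX: "D * X \<le> U"
    proof -
      have "X powr 1 \<le> X powr (1 + \<epsilon>)" using X \<epsilon> by (intro powr_mono) auto
      then show ?thesis using D X by (simp add: U_def)
    qed
    show ?thesis
    proof (cases "X \<ge> X0")
      case False
      \<comment> \<open>As \<open>X < X0\<close> and \<open>D >= 1\<close>, the trivial bound
        \<open>(D + X) X\<close> is at most a constant times \<open>D X\<close>, which the first
        term of the claim dominates.\<close>
      have "(\<Sum>t\<in>T. (norm (twisted_sum f (\<psi> t) X))\<^sup>2) = (\<Sum>t\<in>T. (cmod (\<Sum>n\<in>nats_upto X. f n * \<psi> t n))\<^sup>2)"
        by (simp add: twisted_sum_def nats_upto_def)
      also have "\<dots> \<le> 48 * (D + X) * energy f (nats_upto X)"
        using X by (intro large_sieve_upto) auto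
      also have "\<dots> \<le> 48 * (D * (1 + X0)) * (K * X)"
      proof (intro mult_mono mult_left_mono energy_upto)
        have "1 * X \<le> D * X0" using D X False by (intro mult_mono) auto
        then show "D + X \<le> D * (1 + X0)" by (simp add: distrib_left)
      qed (use D X in \<open>auto simp: X0_def\<close>)
      also have "\<dots> = (48 * K * (1 + X0)) * (D * X)" by (simp add: mult_ac)
      also have "\<dots> \<le> C * (U + V)"
        using C DX UV D X by (intro mult_mono) auto
      finally show ?thesis by (simp add: U_def V_def)
    next
      case True
      then have Xl: "X1 \<le> X" "4 \<le> X" "2 * X2 \<delta> \<le> X" by (auto simp: X0_def)
      obtain J1 J2 H :: nat where J: "2 \<le> J1" "J1 \<le> J2" and H4: "4 \<le> H" "real H \<le> ln X"
        and range: "exp (ln X powr (\<beta> + \<kappa>)) \<le> 2 ^ J1" "2 ^ J2 \<le> exp (ln X / ln (ln X))"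
        and big: "8 ^ J2 \<le> X" "X3 * 4 ^ J2 \<le> X" "X3 \<le> X"
        and e: "real J1 / real J2 \<le> 6 * ln X powr (- \<eta>')" "1 / 2 ^ J1 \<le> ln X powr (- \<eta>')"
          "harmonic_between J1 J2 / real J2 \<le> 2 * ln X powr (- \<eta>')" "1 / real H \<le> ln X powr (- \<eta>')"
          "(harmonic_between J1 J2)\<^sup>2 / real J2 powr \<theta> \<le> ln X powr (- \<eta>')" "real H * 2 ^ J2 \<le> X powr \<epsilon>"
        using X1[OF Xl(1)] by blast
      interpret factored_sum f K X3 T \<psi> D X J1 J2 H
        by unfold_locales (use J H4 big in auto)
      define w where "w = ln X powr (- \<eta>')"
      define F where "F = (harmonic_between J1 J2)\<^sup>2 / real J2 powr \<theta>"
      define E where "E = K * X * (real J1 / real J2) + 18 * K\<^sup>2 * X / 2 ^ J1 + 18 * K ^ 3 * X * harmonic_between J1 J2 / J2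
        + energy f {n \<in> nats_upto X. X - 2 * X / H \<le> real n}"
      have lnX: "ln X \<ge> 1" using H4 by linarith
      have w: "0 \<le> w" "w \<le> 1"
        using lnX par powr_mono[of "- \<eta>'" 0 "ln X"] by (auto simp: w_def)
      have wV: "X\<^sup>2 * w \<le> V"
      proof -
        have "w \<le> ln X powr (- \<eta>)" unfolding w_def using lnX par by (intro powr_mono) auto
        then have "X\<^sup>2 * w \<le> X\<^sup>2 * ln X powr (- \<eta>)" by (intro mult_left_mono) auto
        then show ?thesis by (simp add: V_def powr_minus divide_inverse)
      qed
      have E: "E \<le> A * X * w"
      proof -
        have "K * X * (real J1 / real J2) \<le> K * X * (6 * w)"
          using e(1) K1 X by (intro mult_left_mono) (auto simp: w_def)
        moreover have "(18 * K\<^sup>2 * X) * (1 / 2 ^ J1) \<le> (18 * K\<^sup>2 * X) * w"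
          using e(2) K1 X by (intro mult_left_mono) (auto simp: w_def)
        moreover have "(18 * K ^ 3 * X) * (harmonic_between J1 J2 / J2) \<le> (18 * K ^ 3 * X) * (2 * w)"
          using e(3) K1 X by (intro mult_left_mono) (auto simp: w_def)
        moreover have "energy f {n \<in> nats_upto X. X - 2 * X / H \<le> real n} \<le> (2 * \<bar>K2\<bar> * X) * w"
        proof -
          have "energy f {n \<in> nats_upto X. X - 2 * X / H \<le> real n} \<le> \<bar>K2\<bar> * (2 * X / H)"
            using Xl H4 f(3) unfolding \<delta>_def by (intro energy_boundary_le) auto
          also have "\<dots> = (2 * \<bar>K2\<bar> * X) * (1 / H)" by simp
          also have "\<dots> \<le> (2 * \<bar>K2\<bar> * X) * w"
            using e(4) X by (intro mult_left_mono) (auto simp: w_def)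
          finally show ?thesis .
        qed
        ultimately show ?thesis by (simp add: E_def A_def algebra_simps)
      qed
      have first: "96 * (D + X) * E \<le> 96 * A * (U + V)"
      proof -
        have "(D + X) * E \<le> (D + X) * (A * X * w)" using E D X by (intro mult_left_mono) auto
        also have "\<dots> = A * (D * X * w + X\<^sup>2 * w)" by (simp add: power2_eq_square algebra_simps)
        also have "\<dots> \<le> A * (U + V)"
        proof (intro mult_left_mono add_mono wV A0)
          have "D * X * w \<le> D * X * 1" using w D X by (intro mult_left_mono) auto
          then show "D * X * w \<le> U" using DX by simp
        qed
        finally have "96 * ((D + X) * E) \<le> 96 * (A * (U + V))" by simp
        then show ?thesis by (simp only: mult.assoc)
      qed
      have second: "96 * G * K * (2 * D * H * X * 2 ^ J2 + X\<^sup>2) * F \<le> 192 * G * K * (U + V)"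
      proof -
        have Fw: "F \<le> w" using e(5) by (simp add: F_def w_def)
        have "(2 * D * H * X * 2 ^ J2 + X\<^sup>2) * F \<le> (2 * D * H * X * 2 ^ J2 + X\<^sup>2) * w"
          using Fw D X by (intro mult_left_mono) auto
        also have "\<dots> = 2 * D * X * (H * 2 ^ J2) * w + X\<^sup>2 * w" by (simp add: algebra_simps)
        also have "\<dots> \<le> 2 * U + V"
        proof (intro add_mono wV)
          have "2 * D * X * (H * 2 ^ J2) * w \<le> 2 * D * X * (X powr \<epsilon>) * 1"
            using e(6) w D X by (intro mult_mono) auto
          also have "\<dots> = 2 * U" using X by (simp add: U_def powr_add)
          finally show "2 * D * X * (H * 2 ^ J2) * w \<le> 2 * U" .
        qed
        also have "\<dots> \<le> 2 * (U + V)" using UV by simp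
        finally have "(96 * G * K) * ((2 * D * H * X * 2 ^ J2 + X\<^sup>2) * F) \<le> (96 * G * K) * (2 * (U + V))"
          using G0 K1 by (intro mult_left_mono) auto
        moreover have "(96 * G * K) * (2 * (U + V)) = 192 * G * K * (U + V)" by simp
        ultimately show ?thesis by (simp only: mult.assoc)
      qed
      have "(\<Sum>t\<in>T. (norm (twisted_sum f (\<psi> t) X))\<^sup>2) \<le> 96 * (D + X) * E + 96 * G * K * (2 * D * H * X * 2 ^ J2 + X\<^sup>2) * F"
        unfolding E_def F_def
      proof (rule sum_norm_twisted_sum_le)
        fix t j v assume "t \<in> T" "J1 \<le> j" "j < J2"
        then show "(cmod (\<Sum>p\<in>slot_primes j v. f p * \<psi> t p))\<^sup>2 \<le> G * 4 ^ j / ((real j)\<^sup>2 * real j powr \<theta>)"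
          unfolding G_def using canc par range H4 by (intro slot_primes_sum_square_le) auto
      qed (use G0 par in auto)
      also have "\<dots> \<le> 96 * A * (U + V) + 192 * G * K * (U + V)"
        by (intro add_mono first second)
      also have "\<dots> = (96 * A + 192 * G * K) * (U + V)" by (simp only: distrib_right)
      also have "\<dots> \<le> C * (U + V)" using C UV by (intro mult_right_mono) auto
      finally show ?thesis by (simp add: U_def V_def)
    qed
  qed
  show ?thesis using that[OF C(1)] main by blast
qed

lemma primitive_character_family:
  fixes R :: "nat set" and E :: "nat \<Rightarrow> (nat \<Rightarrow> complex) set" and D :: real
  assumes R: "finite R" and E: "\<And>q. q \<in> R \<Longrightarrow> finite (E q)" "\<And>q. q \<in> R \<Longrightarrow> E q \<subseteq> primitive_dirichlet_characters q"
    and D: "D \<ge> 1"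
    and le: "\<And>x M N. (\<Sum>q\<in>R. \<Sum>\<chi>\<in>E q. (cmod (\<Sum>n\<in>{M..<M+N}. x n * \<chi> n))\<^sup>2)
      \<le> 48 * (D + real N) * (\<Sum>n\<in>{M..<M+N}. (cmod (x n))\<^sup>2)"
  shows "character_family (Sigma R E) snd D"
proof
  show "finite (Sigma R E)" using R E by (intro finite_SigmaI) auto
  show "1 \<le> D" by (rule D)
  show "snd t (m * n) = snd t m * snd t n" if t0: "t \<in> Sigma R E" for t m n
  proof -
    obtain q \<chi> where t: "t = (q, \<chi>)" "q \<in> R" "\<chi> \<in> E q" using t0 by blast
    then have "dirichlet_character q \<chi>" using E(2) unfolding primitive_dirichlet_characters_def by blast
    then show ?thesis unfolding t(1) snd_conv by (rule dirichlet_character_mult)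
  qed
  show "(\<Sum>t\<in>Sigma R E. (cmod (\<Sum>n\<in>{M..<M+N}. x n * snd t n))\<^sup>2)
      \<le> 48 * (D + real N) * (\<Sum>n\<in>{M..<M+N}. (cmod (x n))\<^sup>2)" for x M N
    using le[of x M N] R E(1) by (subst (asm) sum.Sigma) (auto simp: case_prod_unfold)
qed

theorem theorem1p8:
  fixes d :: nat
    and \<beta> \<gamma> \<eta> \<epsilon> :: real
    and K1 K2 K3 X3 :: real
    and X2 :: "(real \<Rightarrow> real) \<Rightarrow> real"
    and K4 :: "real \<Rightarrow> real"
  assumes "d \<ge> 2" and "0 \<le> \<beta>" and "\<beta> < 1" and "\<gamma> > 0"
    and "\<eta> < min (2 / 3 * \<gamma>) (1 - \<beta>)" and "\<epsilon> > 0"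
  shows "\<exists>C :: real. \<forall>f :: nat \<Rightarrow> complex.
    multiplicative_fun f \<and> divisor_bound d K1 f \<and> average_bound K2 X2 f \<and> sieve_bound K3 X3 f \<longrightarrow>
    (\<forall>X Q :: real. X \<ge> 2 \<and> Q \<ge> 2 \<longrightarrow>
      (\<forall>(q :: nat) (E :: (nat \<Rightarrow> complex) set).
         Q \<le> real q \<and> real q \<le> 2 * Q \<and> E \<subseteq> primitive_dirichlet_characters q \<and>
         prime_cancellation \<beta> \<gamma> K4 X E f \<longrightarrow>
         (\<Sum>\<chi>\<in>E. (norm (twisted_sum f \<chi> X))\<^sup>2)
           \<le> C * (real q * X powr (1 + \<epsilon>) + X\<^sup>2 / ln X powr \<eta>)) \<and>
      (\<forall>E :: nat \<Rightarrow> (nat \<Rightarrow> complex) set.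
         (\<forall>q. Q \<le> real q \<and> real q \<le> 2 * Q \<longrightarrow>
            E q \<subseteq> primitive_dirichlet_characters q \<and> prime_cancellation \<beta> \<gamma> K4 X (E q) f) \<longrightarrow>
         (\<Sum>q | Q \<le> real q \<and> real q \<le> 2 * Q. \<Sum>\<chi>\<in>E q. (norm (twisted_sum f \<chi> X))\<^sup>2)
           \<le> C * (Q\<^sup>2 * X powr (1 + \<epsilon>) + X\<^sup>2 / ln X powr \<eta>)))"
proof -
  obtain C where C0: "C \<ge> 0"
    and C: "\<And>f (T :: (nat \<times> (nat \<Rightarrow> complex)) set) \<psi> D X. multiplicative_fun f \<Longrightarrow> divisor_bound d K1 f \<Longrightarrow> average_bound K2 X2 f \<Longrightarrow>
      sieve_bound K3 X3 f \<Longrightarrow> character_family T \<psi> D \<Longrightarrow> X \<ge> 2 \<Longrightarrow>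
      (\<And>t. t \<in> T \<Longrightarrow> prime_cancellation \<beta> \<gamma> K4 X {\<psi> t} f) \<Longrightarrow>
      (\<Sum>t\<in>T. (norm (twisted_sum f (\<psi> t) X))\<^sup>2) \<le> C * (D * X powr (1 + \<epsilon>) + X\<^sup>2 / ln X powr \<eta>)"
    using character_family_mean_square[OF assms(2-6)] by metis
  have restrict: "prime_cancellation \<beta> \<gamma> K4 X {\<chi>} f"
    if "prime_cancellation \<beta> \<gamma> K4 X E f" "\<chi> \<in> E" for X E f \<chi>
    using that unfolding prime_cancellation_def by blast
  show ?thesis
  proof (intro exI[of _ C] allI impI conjI, goal_cases)
    case (1 f X Q q E)
    then have f: "multiplicative_fun f" "divisor_bound d K1 f" "average_bound K2 X2 f" "sieve_bound K3 X3 f"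
      and X: "X \<ge> 2" and q: "real q \<ge> 2" and E: "E \<subseteq> primitive_dirichlet_characters q"
      and canc: "prime_cancellation \<beta> \<gamma> K4 X E f" by auto
    show ?case
    proof (cases "finite E")
      \<comment> \<open>A sum over an infinite set is \<open>0\<close> by convention, so
        \<open>C >= 0\<close> settles this case and the number of characters need not be
        discussed.\<close>
      case False
      then show ?thesis using C0 by simp
    next
      case True
      have fam: "character_family (Sigma {q} (\<lambda>_. E)) snd (real q)"
      proof (rule primitive_character_family)
        fix x :: "nat \<Rightarrow> complex" and M N
        have "(\<Sum>\<chi>\<in>E. (cmod (\<Sum>n\<in>{M..<M+N}. x n * \<chi> n))\<^sup>2) \<le> 12 * (real q + real N) * (\<Sum>n\<in>{M..<M+N}. (cmod (x n))\<^sup>2)"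
          using q by (intro multiplicative_large_sieve_single E True) simp
        also have "\<dots> \<le> 48 * (real q + real N) * (\<Sum>n\<in>{M..<M+N}. (cmod (x n))\<^sup>2)"
          by (intro mult_right_mono sum_nonneg) auto
        finally show "(\<Sum>q\<in>{q}. \<Sum>\<chi>\<in>E. (cmod (\<Sum>n\<in>{M..<M+N}. x n * \<chi> n))\<^sup>2)
            \<le> 48 * (real q + real N) * (\<Sum>n\<in>{M..<M+N}. (cmod (x n))\<^sup>2)" by simp
      qed (use True E q in auto)
      have "(\<Sum>t\<in>Sigma {q} (\<lambda>_. E). (norm (twisted_sum f (snd t) X))\<^sup>2) \<le> C * (real q * X powr (1 + \<epsilon>) + X\<^sup>2 / ln X powr \<eta>)"
        using restrict[OF canc] by (intro C[OF f fam X]) auto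
      moreover have "(\<Sum>t\<in>Sigma {q} (\<lambda>_. E). (norm (twisted_sum f (snd t) X))\<^sup>2) = (\<Sum>q\<in>{q}. \<Sum>\<chi>\<in>E. (norm (twisted_sum f \<chi> X))\<^sup>2)"
        using True by (subst sum.Sigma) (auto simp: case_prod_unfold)
      ultimately show ?thesis by simp
    qed
  next
    case (2 f X Q E)
    define R where "R = {q. Q \<le> real q \<and> real q \<le> 2 * Q}"
    \<comment> \<open>Infinite sets are replaced by the empty set, which leaves the inner sums
      unchanged and makes the index set of the family finite.\<close>
    define E' where "E' q = (if finite (E q) then E q else {})" for q
    from 2 have f: "multiplicative_fun f" "divisor_bound d K1 f" "average_bound K2 X2 f" "sieve_bound K3 X3 f"
      and X: "X \<ge> 2" and Q: "Q \<ge> 2" by auto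
    have E: "E q \<subseteq> primitive_dirichlet_characters q" "prime_cancellation \<beta> \<gamma> K4 X (E q) f" if "q \<in> R" for q
      using 2 that by (auto simp: R_def)
    have finR: "finite R"
      by (rule finite_subset[of _ "{..nat \<lfloor>2 * Q\<rfloor>}"]) (auto simp: R_def le_nat_floor)
    have Q2: "Q\<^sup>2 \<ge> 1" using Q by (simp add: one_le_power)
    have fam: "character_family (Sigma R E') snd (Q\<^sup>2)"
    proof (rule primitive_character_family)
      fix x :: "nat \<Rightarrow> complex" and M N
      have "(\<Sum>q\<in>R. \<Sum>\<chi>\<in>E' q. (cmod (\<Sum>n\<in>{M..<M+N}. x n * \<chi> n))\<^sup>2) \<le> 12 * (4 * Q\<^sup>2 + real N) * (\<Sum>n\<in>{M..<M+N}. (cmod (x n))\<^sup>2)"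
      proof (rule multiplicative_large_sieve)
        show "real q * real r \<le> 4 * Q\<^sup>2" if "q \<in> R" "r \<in> R" for q r
          using mult_mono[of "real q" "2 * Q" "real r" "2 * Q"] that Q by (simp add: R_def power2_eq_square)
        show "q > 0" if "q \<in> R" for q using that Q by (cases q) (auto simp: R_def)
      qed (use finR E Q2 in \<open>auto simp: E'_def\<close>)
      also have "\<dots> \<le> 48 * (Q\<^sup>2 + real N) * (\<Sum>n\<in>{M..<M+N}. (cmod (x n))\<^sup>2)"
        by (intro mult_right_mono sum_nonneg) auto
      finally show "(\<Sum>q\<in>R. \<Sum>\<chi>\<in>E' q. (cmod (\<Sum>n\<in>{M..<M+N}. x n * \<chi> n))\<^sup>2)
          \<le> 48 * (Q\<^sup>2 + real N) * (\<Sum>n\<in>{M..<M+N}. (cmod (x n))\<^sup>2)" .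
    qed (use finR E Q2 in \<open>auto simp: E'_def\<close>)
    have "(\<Sum>t\<in>Sigma R E'. (norm (twisted_sum f (snd t) X))\<^sup>2) \<le> C * (Q\<^sup>2 * X powr (1 + \<epsilon>) + X\<^sup>2 / ln X powr \<eta>)"
      using restrict[OF E(2)] by (intro C[OF f fam X]) (auto simp: E'_def split: if_splits)
    moreover have "(\<Sum>t\<in>Sigma R E'. (norm (twisted_sum f (snd t) X))\<^sup>2) = (\<Sum>q\<in>R. \<Sum>\<chi>\<in>E' q. (norm (twisted_sum f \<chi> X))\<^sup>2)"
      using finR by (subst sum.Sigma) (auto simp: case_prod_unfold E'_def)
    moreover have "(\<Sum>q\<in>R. \<Sum>\<chi>\<in>E' q. (norm (twisted_sum f \<chi> X))\<^sup>2) = (\<Sum>q\<in>R. \<Sum>\<chi>\<in>E q. (norm (twisted_sum f \<chi> X))\<^sup>2)"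
      by (rule sum.cong[OF refl]) (simp add: E'_def)
    ultimately show ?case by (simp add: R_def)
  qed
qed

end
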